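(* There exist constants $c_1,c_2,C_1,C_2>0$ such that the following holds. Let $S\subseteq\{1,\dots,n\}$ with $|S|=s\le n/2$, let $x\in\mathbb{R}^n$ or $\mathbb{C}^n$ be supported on $S$ and satisfy the random sign assumption, let $A$ be the random sensing matrix of the setting with parameters $\Lambda(S,F)$ and $\Gamma(F)$, and let $y=Ax+\epsilon$ with $\|\epsilon\|_2\le\eta$. For every $0<\varepsilon<1$, if $$\Lambda(S,F)\ge c_1\,\Gamma(F)\ln(3n/\varepsilon)\quad\text{and}\quad m\ge c_2\,\Lambda(S,F)\ln\!\left(\tfrac{3n}{\varepsilon}\right),$$ then with probability at least $1-\varepsilon$ every minimizer $x^\sharp$ of (qBP) satisfies $\|x-x^\sharp\|_2\le(C_1+C_2\sqrt s)\eta$. In the noiseless case $\eta=0$, with $c_1=50$ and $c_2=100$, $x$ is the unique minimizer of (BP) with probability at least $1-\varepsilon$.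
   Context: Setting: Let $n,m\ge 1$. For $\ell=1,\dots,m$ let $F_\ell$ be a probability distribution on $\mathbb{C}^{p_\ell\times n}$ ($p_\ell\ge1$), $F=(F_\ell)_{\ell=1}^m$, let $B_1,\dots,B_m$ be independent random matrices with $B_\ell\sim F_\ell$, and $A=\frac{1}{\sqrt m}\begin{pmatrix}B_1\\ \vdots\\ B_m\end{pmatrix}$. Isotropy is assumed: $\mathbb{E}(A^*A)=\frac1m\sum_{\ell=1}^m\mathbb{E}(B_\ell^*B_\ell)=\mathrm{Id}_n$. For $S\subseteq\{1,\dots,n\}$, $P_S$ is the restriction $P_Sx=x_S$, $M_S:=MP_S^*$, $B_{\ell,S}=B_\ell P_S^*$. $\|M\|_{p\to q}=\sup_{\|v\|_p\le1}\|Mv\|_q$; $\|M\|_{1\to2}$ is the maximal $\ell^2$ norm of a column of $M$. $\Lambda(S,F)$ and $\Gamma(F)$ denote positive reals such that almost surely, for all $\ell$, $\|B_{\ell,S}^*B_{\ell,S}\|_{2\to2}\le\Lambda(S,F)$ and $\|B_\ell\|_{1\to2}^2=\max_{i}\|B_\ell e_i\|_2^2\le\Gamma(F)$. Random sign assumption: the vector $(x_i/|x_i|)_{i\in S}$ is a Rademacher sequence (independent uniform $\pm1$ entries) if $x$ is real, or a Steinhaus sequence (independent entries uniform on the complex unit circle) if $x$ is complex, independent of $A$. (BP): $\min_{z\in\mathbb{C}^n}\|z\|_1$ s.t. $Az=y$. (qBP): $\min_{z\in\mathbb{C}^n}\|z\|_1$ s.t. $\|y-Az\|_2\le\eta$.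 *)

theory Defs
  imports "HOL-Probability.Probability"
begin

text \<open>Conventions. Indices are 0-based: coordinates of vectors in C^n are the
naturals 0..n-1, a vector of C^n is a function nat => complex vanishing from n on.
Blocks are indexed by l in 0..m-1; block l is a p l by n complex matrix, represented
as a function on pairs (row, column) with row < p l, column < n.
The stacked matrix A has row index set rows m p = pairs (l, r) with r < p l.\<close>

definition vnorm :: "'i set \<Rightarrow> ('i \<Rightarrow> complex) \<Rightarrow> real" where
  "vnorm I v = sqrt (\<Sum>i\<in>I. (cmod (v i))^2)"

definition l1norm :: "nat \<Rightarrow> (nat \<Rightarrow> complex) \<Rightarrow> real" where
  "l1norm n z = (\<Sum>i<n. cmod (z i))"

definition in_Cn :: "nat \<Rightarrow> (nat \<Rightarrow> complex) \<Rightarrow> bool" where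
  "in_Cn n z \<longleftrightarrow> (\<forall>i\<ge>n. z i = 0)"

definition matvec :: "'c set \<Rightarrow> ('r \<times> 'c \<Rightarrow> complex) \<Rightarrow> ('c \<Rightarrow> complex) \<Rightarrow> 'r \<Rightarrow> complex" where
  "matvec C M v = (\<lambda>i. \<Sum>j\<in>C. M (i, j) * v j)"

definition op_norm22 :: "'r set \<Rightarrow> 'c set \<Rightarrow> ('r \<times> 'c \<Rightarrow> complex) \<Rightarrow> real" where
  "op_norm22 R C M = Sup {vnorm R (matvec C M v) | v. vnorm C v \<le> 1}"

definition gram :: "'r set \<Rightarrow> ('r \<times> 'c \<Rightarrow> complex) \<Rightarrow> ('c \<times> 'c \<Rightarrow> complex)" where
  "gram R B = (\<lambda>(j, k). \<Sum>r\<in>R. cnj (B (r, j)) * B (r, k))"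

definition rows :: "nat \<Rightarrow> (nat \<Rightarrow> nat) \<Rightarrow> (nat \<times> nat) set" where
  "rows m p = Sigma {..<m} (\<lambda>l. {..<p l})"

definition block_space :: "nat \<Rightarrow> nat \<Rightarrow> (nat \<times> nat \<Rightarrow> complex) measure" where
  "block_space p n = PiM ({..<p} \<times> {..<n}) (\<lambda>_. borel)"

text \<open>Action of A = (1/sqrt m) [B_0; ...; B_(m-1)] on z in C^n.\<close>
definition sensing :: "nat \<Rightarrow> nat \<Rightarrow> (nat \<Rightarrow> (nat \<times> nat \<Rightarrow> complex)) \<Rightarrow> (nat \<Rightarrow> complex) \<Rightarrow> nat \<times> nat \<Rightarrow> complex" where
  "sensing m n B z = (\<lambda>(l, r). complex_of_real (1 / sqrt (real m)) * (\<Sum>j<n. B l (r, j) * z j))"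

definition setting ::
  "nat \<Rightarrow> nat \<Rightarrow> (nat \<Rightarrow> nat) \<Rightarrow> (nat \<Rightarrow> (nat \<times> nat \<Rightarrow> complex) measure) \<Rightarrow> nat set \<Rightarrow> real \<Rightarrow> real \<Rightarrow> bool" where
  "setting n m p F S \<Lambda> \<Gamma> \<longleftrightarrow>
     n \<ge> 1 \<and> m \<ge> 1 \<and> S \<subseteq> {..<n} \<and> \<Lambda> > 0 \<and> \<Gamma> > 0 \<and>
     (\<forall>l<m. p l \<ge> 1 \<and> prob_space (F l) \<and> sets (F l) = sets (block_space (p l) n)) \<and>
     \<comment> \<open>isotropy: (1/m) sum_l E(B_l^* B_l) = Id_n\<close>
     (\<forall>j<n. \<forall>k<n. (1 / real m) * (\<Sum>l<m. integral\<^sup>L (F l) (\<lambda>B. gram {..<p l} B (j, k)))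
                    = (if j = k then 1 else 0)) \<and>
     (\<forall>l<m. AE B in F l. op_norm22 S S (gram {..<p l} B) \<le> \<Lambda>) \<and>
     (\<forall>l<m. AE B in F l. \<forall>i<n. (\<Sum>r<p l. (cmod (B (r, i)))^2) \<le> \<Gamma>)"

definition rademacher :: "complex measure" where
  "rademacher = distr (measure_pmf (pmf_of_set {1, -1})) borel (\<lambda>z. z)"

definition steinhaus :: "complex measure" where
  "steinhaus = distr (uniform_measure lborel {0..1::real}) borel (\<lambda>t. cis (2 * pi * t))"

definition sign_dist :: "bool \<Rightarrow> complex measure" where
  "sign_dist real_case = (if real_case then rademacher else steinhaus)"

definition sample_space ::
  "nat \<Rightarrow> (nat \<Rightarrow> (nat \<times> nat \<Rightarrow> complex) measure) \<Rightarrow> nat set \<Rightarrow> bool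
   \<Rightarrow> ((nat \<Rightarrow> (nat \<times> nat \<Rightarrow> complex)) \<times> (nat \<Rightarrow> complex)) measure" where
  "sample_space m F S real_case = (PiM {..<m} F) \<Otimes>\<^sub>M (PiM S (\<lambda>_. sign_dist real_case))"

text \<open>The signal: x_i = a_i sigma_i on S (a_i = |x_i| > 0), 0 elsewhere.\<close>
definition signal :: "nat set \<Rightarrow> (nat \<Rightarrow> real) \<Rightarrow> (nat \<Rightarrow> complex) \<Rightarrow> nat \<Rightarrow> complex" where
  "signal S a \<sigma> = (\<lambda>i. if i \<in> S then complex_of_real (a i) * \<sigma> i else 0)"

definition qBP_minimizer ::
  "nat \<Rightarrow> nat \<Rightarrow> (nat \<Rightarrow> nat) \<Rightarrow> (nat \<Rightarrow> (nat \<times> nat \<Rightarrow> complex)) \<Rightarrow> (nat \<times> nat \<Rightarrow> complex)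
   \<Rightarrow> real \<Rightarrow> (nat \<Rightarrow> complex) \<Rightarrow> bool" where
  "qBP_minimizer n m p B y \<eta> z \<longleftrightarrow>
     in_Cn n z \<and> vnorm (rows m p) (\<lambda>q. y q - sensing m n B z q) \<le> \<eta> \<and>
     (\<forall>w. in_Cn n w \<and> vnorm (rows m p) (\<lambda>q. y q - sensing m n B w q) \<le> \<eta>
          \<longrightarrow> l1norm n z \<le> l1norm n w)"

definition BP_unique_minimizer ::
  "nat \<Rightarrow> nat \<Rightarrow> (nat \<Rightarrow> nat) \<Rightarrow> (nat \<Rightarrow> (nat \<times> nat \<Rightarrow> complex)) \<Rightarrow> (nat \<times> nat \<Rightarrow> complex)
   \<Rightarrow> (nat \<Rightarrow> complex) \<Rightarrow> bool" where
  "BP_unique_minimizer n m p B y x \<longleftrightarrow>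
     in_Cn n x \<and> (\<forall>q\<in>rows m p. sensing m n B x q = y q) \<and>
     (\<forall>z. in_Cn n z \<and> (\<forall>q\<in>rows m p. sensing m n B z q = y q) \<and> z \<noteq> x
          \<longrightarrow> l1norm n x < l1norm n z)"

end

theory Submission
  imports Defs "HOL-Library.Function_Algebras"
begin

text \<open>Write \<open>A\<^sub>S\<close> for the columns in \<open>S\<close>, \<open>G = A\<^sub>S\<^sup>* A\<^sub>S\<close>, \<open>a\<^sub>i\<close> for a column off the support, and
  \<open>L = ln (3 n / \<epsilon>)\<close>. The vector \<open>h = A\<^sub>S G\<inverse> \<sigma>\<close> is a dual certificate as soon as
  \<open>G \<ge> 1/2\<close> and all \<open>\<bar>\<langle>G\<inverse> A\<^sub>S\<^sup>* a\<^sub>i, \<sigma>\<rangle>\<bar> \<le> 9/10\<close>. By Hoeffding's inequality for the signs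
  \<open>\<sigma>\<close>, the second condition is likely once \<open>\<parallel>A\<^sub>S\<^sup>* a\<^sub>i\<parallel> \<le> 0.15 / sqrt L\<close>.

  The bound \<open>G \<ge> 1/2\<close> comes from the potential \<open>tr (1/2 + G)\<^sup>-\<^sup>q\<close> with \<open>q\<close> odd and close to \<open>3 L\<close>:
  replacing the independent summands of \<open>G\<close> one at a time by \<open>9/10\<close> of their means does not
  decrease its expectation, and after all replacements it equals \<open>card S / (7/5)\<^sup>q\<close>, because the
  means add up to the identity. The blocks need not be identically distributed, so the
  Golden--Thompson inequality would not suffice here.

  The bound on \<open>A\<^sub>S\<^sup>* a\<^sub>i\<close> is dimension free and must use that the variance in each fixed direction is
  smaller than the total variance by a factor \<open>1 / (50 L)\<close>. It is obtained by averaging the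
  exponential moments over a Gaussian prior and shifting the prior towards the sum.\<close>

section \<open>Matrices indexed by a finite set\<close>

text \<open>A replacement step works because the first-order change of \<open>tr H^(-q)\<close> is
  linear in the increment, so a random \<open>X\<close> and its mean contribute equally in
  expectation. Convexity bounds the deterministic step by this change from below; a random
  \<open>X\<close> that is small relative to \<open>H\<close> realizes at least the fraction
  \<open>c = 1 - (q + 1) * r / (2 * \<tau>)\<close> of it, and moving by \<open>c\<close> times the
  mean compensates for the loss. The shift 1/2 makes \<open>X\<close> relatively small: it supplies
  \<open>\<tau> = 1/2\<close> before any summand is added. A potential below 1 forces 1/2 + G to be
  at least the identity.

  Spectral decompositions are avoided throughout: traces of products are written as sums of
  quadratic forms, which is where odd \<open>q\<close> enters, and powers of a matrix are compared
  by Cauchy-Schwarz.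

  For the correlations, a net or a union over coordinates would bring in \<open>card S\<close>. The
  prior instead pays a relative entropy that depends only on the length of the shift, even though
  the direction of the shift follows the random sum.

  The 3 in the logarithm fixes the failure budget: \<open>n * exp (- L)\<close> is \<epsilon>/3 for
  the matrices, and the signs then cost at most 4 \<epsilon>/9.\<close>

type_synonym 'i cmat = "'i \<Rightarrow> 'i \<Rightarrow> complex"

definition smult_mat :: "real \<Rightarrow> 'i cmat \<Rightarrow> 'i cmat" (infixr "*\<^sub>m" 72) where
  "c *\<^sub>m A = (\<lambda>i j. of_real c * A i j)"

definition adj_mat :: "'i cmat \<Rightarrow> 'i cmat" where
  "adj_mat A = (\<lambda>i j. cnj (A j i))"

lemma adj_mat_adj_mat [simp]: "adj_mat (adj_mat A) = A"
  by (simp add: adj_mat_def)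

lemma adj_mat_add: "adj_mat (A + B) = adj_mat A + adj_mat B"
  and adj_mat_diff: "adj_mat (A - B) = adj_mat A - adj_mat B"
  and adj_mat_smult: "adj_mat (c *\<^sub>m A) = c *\<^sub>m adj_mat A"
  by (simp_all add: adj_mat_def smult_mat_def fun_eq_iff)

text \<open>The index set is a locale parameter and not a type: it is instantiated with the support
  \<open>S\<close> as well as with the row sets \<open>{..<p l}\<close> and
  \<open>rows m p\<close>.\<close>

locale finite_index =
  fixes S :: "'i set"
  assumes finite_S: "finite S"
begin

definition mm :: "'i cmat \<Rightarrow> 'i cmat \<Rightarrow> 'i cmat" (infixl "\<odot>" 70) where
  "A \<odot> B = (\<lambda>i j. \<Sum>k\<in>S. A i k * B k j)"

definition mv :: "'i cmat \<Rightarrow> ('i \<Rightarrow> complex) \<Rightarrow> 'i \<Rightarrow> complex" where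
  "mv A v = (\<lambda>i. \<Sum>k\<in>S. A i k * v k)"

definition ip :: "('i \<Rightarrow> complex) \<Rightarrow> ('i \<Rightarrow> complex) \<Rightarrow> complex" where
  "ip u v = (\<Sum>i\<in>S. cnj (u i) * v i)"

definition nsq :: "('i \<Rightarrow> complex) \<Rightarrow> real" where
  "nsq v = (\<Sum>i\<in>S. (cmod (v i))\<^sup>2)"

definition tr :: "'i cmat \<Rightarrow> complex" where
  "tr A = (\<Sum>i\<in>S. A i i)"

definition id_mat :: "'i cmat" where
  "id_mat = (\<lambda>i j. if i = j \<and> i \<in> S then 1 else 0)"

primrec mpow :: "'i cmat \<Rightarrow> nat \<Rightarrow> 'i cmat" where
  "mpow A 0 = id_mat"
| "mpow A (Suc k) = A \<odot> mpow A k"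

text \<open>Matrices are total functions. Zeros outside \<open>S\<close> make \<open>id_mat\<close>
  a genuine unit and let matrix identities be equalities of functions, so that inverses are
  unique.\<close>

definition supported :: "'i cmat \<Rightarrow> bool" where
  "supported A \<longleftrightarrow> (\<forall>i j. i \<notin> S \<or> j \<notin> S \<longrightarrow> A i j = 0)"

definition herm :: "'i cmat \<Rightarrow> bool" where
  "herm A \<longleftrightarrow> supported A \<and> adj_mat A = A"

definition qf :: "'i cmat \<Rightarrow> ('i \<Rightarrow> complex) \<Rightarrow> real" where
  "qf A v = Re (ip v (mv A v))"

definition psd :: "'i cmat \<Rightarrow> bool" where
  "psd A \<longleftrightarrow> herm A \<and> (\<forall>v. 0 \<le> qf A v)"

lemma mm_assoc: "A \<odot> B \<odot> C = A \<odot> (B \<odot> C)"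
proof (intro ext)
  fix i j
  have "(A \<odot> B \<odot> C) i j = (\<Sum>k\<in>S. \<Sum>l\<in>S. A i l * B l k * C k j)"
    by (simp add: mm_def sum_distrib_right)
  also have "\<dots> = (\<Sum>l\<in>S. \<Sum>k\<in>S. A i l * B l k * C k j)"
    by (rule sum.swap)
  also have "\<dots> = (A \<odot> (B \<odot> C)) i j"
    by (simp add: mm_def sum_distrib_left mult.assoc)
  finally show "(A \<odot> B \<odot> C) i j = (A \<odot> (B \<odot> C)) i j" .
qed

lemma mm_add_left: "(A + B) \<odot> C = A \<odot> C + B \<odot> C"
  and mm_add_right: "C \<odot> (A + B) = C \<odot> A + C \<odot> B"
  and mm_diff_left: "(A - B) \<odot> C = A \<odot> C - B \<odot> C"
  and mm_diff_right: "C \<odot> (A - B) = C \<odot> A - C \<odot> B"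
  by (simp_all add: mm_def fun_eq_iff ring_distribs sum.distrib sum_subtractf)

lemma mm_smult_left: "(c *\<^sub>m A) \<odot> B = c *\<^sub>m (A \<odot> B)"
  and mm_smult_right: "A \<odot> (c *\<^sub>m B) = c *\<^sub>m (A \<odot> B)"
  by (simp_all add: mm_def smult_mat_def fun_eq_iff sum_distrib_left mult_ac)

lemma tr_add: "tr (A + B) = tr A + tr B"
  and tr_diff: "tr (A - B) = tr A - tr B"
  and tr_smult: "tr (c *\<^sub>m A) = of_real c * tr A"
  by (simp_all add: tr_def smult_mat_def sum.distrib sum_subtractf sum_distrib_left)

lemma tr_mm_commute: "tr (A \<odot> B) = tr (B \<odot> A)"
  unfolding tr_def mm_def by (subst sum.swap) (simp add: mult.commute)

lemma mm_id_right: "supported A \<Longrightarrow> A \<odot> id_mat = A"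
  by (auto simp: mm_def id_mat_def supported_def fun_eq_iff finite_S if_distrib
      cong: if_cong)

lemma mm_id_left: "supported A \<Longrightarrow> id_mat \<odot> A = A"
proof (intro ext)
  fix i j assume A: "supported A"
  have "(id_mat \<odot> A) i j = (\<Sum>k\<in>S. if i = k then A k j else 0)"
    by (auto simp: mm_def id_mat_def intro!: sum.cong)
  also have "\<dots> = A i j" using A by (auto simp: finite_S supported_def)
  finally show "(id_mat \<odot> A) i j = A i j" .
qed

lemma supported_id [simp]: "supported id_mat"
  by (auto simp: supported_def id_mat_def)

lemma supported_mm: "supported A \<Longrightarrow> supported B \<Longrightarrow> supported (A \<odot> B)"
  by (auto simp: supported_def mm_def)

lemma supported_add: "supported A \<Longrightarrow> supported B \<Longrightarrow> supported (A + B)"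
  and supported_diff: "supported A \<Longrightarrow> supported B \<Longrightarrow> supported (A - B)"
  and supported_smult: "supported A \<Longrightarrow> supported (c *\<^sub>m A)"
  by (auto simp: supported_def smult_mat_def)

lemma supported_mpow: "supported A \<Longrightarrow> supported (mpow A k)"
  by (induction k) (auto simp: supported_mm)

lemma adj_mat_mm: "adj_mat (A \<odot> B) = adj_mat B \<odot> adj_mat A"
  by (simp add: adj_mat_def mm_def fun_eq_iff mult.commute)

lemma adj_mat_id [simp]: "adj_mat id_mat = id_mat"
  by (auto simp: adj_mat_def id_mat_def fun_eq_iff)

lemma mpow_add: "supported A \<Longrightarrow> mpow A (a + b) = mpow A a \<odot> mpow A b"
  by (induction a) (simp_all add: mm_id_left supported_mpow mm_assoc)

lemma mpow_Suc_right: "supported A \<Longrightarrow> mpow A (Suc k) = mpow A k \<odot> A"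
  using mpow_add[of A k 1] by (simp add: mm_id_right)

lemma mpow_1: "supported A \<Longrightarrow> mpow A (Suc 0) = A"
  by (simp add: mm_id_right)

lemma adj_mat_mpow: "supported A \<Longrightarrow> adj_mat A = A \<Longrightarrow> adj_mat (mpow A k) = mpow A k"
proof (induction k)
  case (Suc k)
  then show ?case using mpow_Suc_right[of A k] by (simp add: adj_mat_mm)
qed simp

lemma mv_mm: "mv (A \<odot> B) v = mv A (mv B v)"
proof (intro ext)
  fix i
  have "mv (A \<odot> B) v i = (\<Sum>k\<in>S. \<Sum>l\<in>S. A i l * B l k * v k)"
    by (simp add: mv_def mm_def sum_distrib_right)
  also have "\<dots> = (\<Sum>l\<in>S. \<Sum>k\<in>S. A i l * B l k * v k)" by (rule sum.swap)
  also have "\<dots> = mv A (mv B v) i" by (simp add: mv_def sum_distrib_left mult.assoc)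
  finally show "mv (A \<odot> B) v i = mv A (mv B v) i" .
qed

lemma ip_mv_adj: "ip u (mv A v) = ip (mv (adj_mat A) u) v"
proof -
  have "ip u (mv A v) = (\<Sum>i\<in>S. \<Sum>k\<in>S. cnj (u i) * A i k * v k)"
    by (simp add: ip_def mv_def sum_distrib_left mult.assoc)
  also have "\<dots> = (\<Sum>k\<in>S. \<Sum>i\<in>S. cnj (u i) * A i k * v k)" by (rule sum.swap)
  also have "\<dots> = ip (mv (adj_mat A) u) v"
    by (simp add: ip_def mv_def adj_mat_def sum_distrib_left sum_distrib_right mult_ac)
  finally show ?thesis .
qed

lemma ip_commute: "ip u v = cnj (ip v u)"
  by (simp add: ip_def mult.commute)

lemma Re_ip_commute: "Re (ip u v) = Re (ip v u)"
  by (subst ip_commute) simp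

lemma nsq_ip: "nsq v = Re (ip v v)"
  by (simp add: nsq_def ip_def cmod_power2) (simp add: power2_eq_square)

lemma nsq_nonneg [simp]: "0 \<le> nsq v"
  by (simp add: nsq_def sum_nonneg)

lemma ip_cong: "(\<And>i. i \<in> S \<Longrightarrow> u i = u' i) \<Longrightarrow> (\<And>i. i \<in> S \<Longrightarrow> v i = v' i) \<Longrightarrow> ip u v = ip u' v'"
  by (simp add: ip_def)

lemma mv_id: "i \<in> S \<Longrightarrow> mv id_mat v i = v i"
proof -
  assume i: "i \<in> S"
  have "mv id_mat v i = (\<Sum>k\<in>S. if i = k then v k else 0)"
    by (auto simp: mv_def id_mat_def intro!: sum.cong)
  then show ?thesis using i by (simp add: finite_S)
qed

lemma ip_mv_id: "ip u (mv id_mat v) = ip u v"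
  by (intro ip_cong) (simp_all add: mv_id)

lemma mv_add: "mv (A + B) v = mv A v + mv B v"
  and mv_diff: "mv (A - B) v = mv A v - mv B v"
  by (simp_all add: mv_def fun_eq_iff ring_distribs sum.distrib sum_subtractf)

lemma mv_smult: "mv (c *\<^sub>m A) v = (\<lambda>i. of_real c * mv A v i)"
  by (simp add: mv_def smult_mat_def fun_eq_iff sum_distrib_left mult_ac)

lemma ip_add_right: "ip u (v + w) = ip u v + ip u w"
  and ip_add_left: "ip (v + w) u = ip v u + ip w u"
  and ip_diff_right: "ip u (v - w) = ip u v - ip u w"
  by (simp_all add: ip_def ring_distribs sum.distrib sum_subtractf)

lemma ip_scale_right: "ip u (\<lambda>i. c * v i) = c * ip u v"
  and ip_scale_left: "ip (\<lambda>i. c * u i) v = cnj c * ip u v"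
  by (simp_all add: ip_def sum_distrib_left mult_ac)

lemma qf_add: "qf (A + B) v = qf A v + qf B v"
  and qf_diff: "qf (A - B) v = qf A v - qf B v"
  and qf_smult: "qf (c *\<^sub>m A) v = c * qf A v"
  and qf_id: "qf id_mat v = nsq v"
  by (simp_all add: qf_def mv_add mv_diff mv_smult ip_add_right ip_diff_right ip_scale_right
      ip_mv_id nsq_ip)

section \<open>Positive semidefinite matrices\<close>

lemma psd_add: "psd A \<Longrightarrow> psd B \<Longrightarrow> psd (A + B)"
  by (simp add: psd_def herm_def supported_add adj_mat_add qf_add)

lemma psd_smult: "psd A \<Longrightarrow> 0 \<le> c \<Longrightarrow> psd (c *\<^sub>m A)"
  by (simp add: psd_def herm_def supported_smult adj_mat_smult qf_smult)

lemma psd_id: "psd id_mat"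
  by (simp add: psd_def herm_def qf_id)

lemma psd_conj:
  assumes "psd P" "supported W"
  shows "psd (adj_mat W \<odot> P \<odot> W)"
proof -
  have "supported (adj_mat W)" using assms(2) by (auto simp: supported_def adj_mat_def)
  moreover have "qf (adj_mat W \<odot> P \<odot> W) v = qf P (mv W v)" for v
    unfolding qf_def by (simp add: mm_assoc mv_mm) (subst ip_mv_adj, simp)
  ultimately show ?thesis using assms
    by (simp add: psd_def herm_def supported_mm adj_mat_mm mm_assoc)
qed

text \<open>With \<open>W\<close> a lower power of \<open>A\<close>, an even power is the congruence
  of the identity by \<open>W\<close> and an odd power the congruence of \<open>A\<close> by
  \<open>W\<close>.\<close>

lemma psd_mpow:
  assumes A: "psd A" shows "psd (mpow A k)"
proof -
  have s: "supported A" and adj: "adj_mat (mpow A a) = mpow A a" for a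
    using A by (auto simp: psd_def herm_def adj_mat_mpow)
  show ?thesis
  proof (cases "even k")
    case True
    then obtain a where k: "k = a + a" by (metis evenE mult_2)
    have "mpow A k = adj_mat (mpow A a) \<odot> id_mat \<odot> mpow A a"
      using s by (simp add: k mpow_add adj mm_id_right supported_mpow)
    then show ?thesis using psd_conj[OF psd_id supported_mpow[OF s]] by simp
  next
    case False
    then obtain a where k: "k = a + Suc a" by (metis oddE add_Suc_right mult_2 Suc_eq_plus1)
    have "mpow A k = adj_mat (mpow A a) \<odot> A \<odot> mpow A a"
      unfolding k mpow_add[OF s] adj mm_assoc using mpow_Suc_right[OF s, of a] by (simp flip: mm_assoc)
    then show ?thesis using psd_conj[OF A supported_mpow[OF s]] by simp
  qed
qed

text \<open>The columns of \<open>W\<close> serve as test vectors, so inequalities between quadratic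
  forms pass to weighted traces.\<close>

lemma tr_conj: "Re (tr (adj_mat W \<odot> P \<odot> W)) = (\<Sum>i\<in>S. qf P (\<lambda>j. W j i))"
proof -
  have "(adj_mat W \<odot> P \<odot> W) i i = ip (\<lambda>j. W j i) (mv P (\<lambda>j. W j i))" for i
    unfolding mm_assoc by (simp add: mm_def ip_def mv_def adj_mat_def)
  then show ?thesis by (simp add: tr_def qf_def)
qed

lemma tr_conj_nonneg: "(\<And>v. 0 \<le> qf P v) \<Longrightarrow> 0 \<le> Re (tr (adj_mat W \<odot> P \<odot> W))"
  unfolding tr_conj by (intro sum_nonneg) auto

lemma tr_conj_mono:
  "(\<And>v. qf P v \<le> c * qf Q v) \<Longrightarrow>
    Re (tr (adj_mat W \<odot> P \<odot> W)) \<le> c * Re (tr (adj_mat W \<odot> Q \<odot> W))"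
  unfolding tr_conj by (simp add: sum_distrib_left sum_mono)

text \<open>Since the exponents have odd sum, one of the two powers is a square; this avoids taking
  square roots of matrices.\<close>
lemma tr_mpow_conj_nonneg:
  assumes A: "psd A" and B: "psd B" and odd: "odd (a + b)"
  shows "0 \<le> Re (tr (mpow A a \<odot> Y \<odot> mpow B b \<odot> adj_mat Y))"
proof -
  have *: "0 \<le> Re (tr (mpow A a \<odot> Y \<odot> mpow B b \<odot> adj_mat Y))"
    if A: "psd A" and B: "psd B" and "even a" for A B a b Y
  proof -
    obtain c where c: "a = c + c" using \<open>even a\<close> by (metis evenE mult_2)
    have s: "supported A" and adj: "adj_mat (mpow A c) = mpow A c"
      using A by (auto simp: psd_def herm_def adj_mat_mpow)
    define W where "W = adj_mat Y \<odot> mpow A c"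
    have "tr (mpow A a \<odot> Y \<odot> mpow B b \<odot> adj_mat Y)
        = tr (mpow A c \<odot> (mpow A c \<odot> Y \<odot> mpow B b \<odot> adj_mat Y))"
      using s by (simp add: c mpow_add mm_assoc)
    also have "\<dots> = tr (adj_mat W \<odot> mpow B b \<odot> W)"
      by (subst tr_mm_commute) (simp add: W_def adj_mat_mm adj mm_assoc)
    finally show ?thesis using tr_conj_nonneg psd_mpow[OF B] by (simp add: psd_def)
  qed
  show ?thesis
  proof (cases "even a")
    case True then show ?thesis using * A B by blast
  next
    case False
    then have "even b" using odd by simp
    have "tr (mpow A a \<odot> Y \<odot> mpow B b \<odot> adj_mat Y)
        = tr (mpow B b \<odot> adj_mat Y \<odot> mpow A a \<odot> adj_mat (adj_mat Y))"
      using tr_mm_commute[of "mpow A a \<odot> Y" "mpow B b \<odot> adj_mat Y"] by (simp add: mm_assoc)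
    then show ?thesis using *[OF B A \<open>even b\<close>, of "adj_mat Y" a] by simp
  qed
qed

text \<open>Discriminant argument for the real polynomial \<open>t \<mapsto> qf P (u + t v)\<close>,
  which is nonnegative. The form may be degenerate, so a vanishing leading coefficient is a separate
  case.\<close>

lemma psd_Cauchy_Schwarz:
  assumes "psd P"
  shows "(Re (ip u (mv P v)))\<^sup>2 \<le> qf P u * qf P v"
proof -
  let ?b = "Re (ip u (mv P v))"
  have sym: "Re (ip v (mv P u)) = ?b"
    using assms by (subst Re_ip_commute, subst ip_mv_adj[of u])
      (simp add: psd_def herm_def)
  have *: "0 \<le> qf P u + 2 * t * ?b + t\<^sup>2 * qf P v" for t :: real
  proof -
    define w where "w = (\<lambda>i. of_real t * v i)"
    have "mv P (u + w) = mv P u + (\<lambda>i. of_real t * mv P v i)"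
      by (simp add: mv_def w_def fun_eq_iff ring_distribs sum.distrib sum_distrib_left mult_ac)
    then have "qf P (u + w) = qf P u + t * ?b + t * Re (ip v (mv P u)) + t * t * qf P v"
      by (simp add: qf_def ip_add_left ip_add_right ip_scale_right)
        (simp add: w_def ip_scale_left ring_distribs mult_ac)
    then show ?thesis using assms sym by (simp add: psd_def power2_eq_square algebra_simps)
        (metis)
  qed
  have nn: "0 \<le> qf P u" "0 \<le> qf P v" using assms by (auto simp: psd_def)
  show ?thesis
  proof (cases "qf P v = 0")
    case True
    have "?b = 0"
    proof (rule ccontr)
      assume "?b \<noteq> 0"
      \<comment> \<open>Here the polynomial is affine with nonzero slope; this argument is the one
        where it would take the value -1.\<close>
      have "0 \<le> qf P u + 2 * (-(qf P u + 1) / (2 * ?b)) * ?b" using *[of "-(qf P u + 1) / (2 * ?b)"] True by simp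
      also have "\<dots> = -1" using \<open>?b \<noteq> 0\<close> by (simp add: field_simps)
      finally show False by simp
    qed
    then show ?thesis using nn by simp
  next
    case False
    then have c: "qf P v > 0" using nn by simp
    have "0 \<le> qf P u + 2 * (- ?b / qf P v) * ?b + (- ?b / qf P v)\<^sup>2 * qf P v" by (rule *)
    also have "\<dots> = qf P u - ?b\<^sup>2 / qf P v" using c by (simp add: field_simps power2_eq_square)
    finally show ?thesis using c by (simp add: field_simps)
  qed
qed

end

section \<open>Trace powers of inverses under a positive perturbation\<close>

text \<open>Up to its first ascent a discretely convex sequence descends from the left end;
  afterwards it keeps ascending towards the right end.\<close>

lemma convex_seq_max:
  fixes f :: "nat \<Rightarrow> real"
  assumes "\<And>k. 1 \<le> k \<Longrightarrow> k < n \<Longrightarrow> 2 * f (Suc k) \<le> f k + f (Suc (Suc k))"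
    and "1 \<le> k" "k \<le> Suc n"
  shows "f k \<le> max (f 1) (f (Suc n))"
  using assms(2,3)
proof (induction k rule: dec_induct)
  case (step k)
  show ?case
  proof (cases "f (Suc k) \<le> f k")
    case True
    then show ?thesis using step by simp
  next
    case False
    have "f (Suc k) \<le> f j \<and> f j \<le> f (Suc j)" if "Suc k \<le> j" "j \<le> n" for j
      using that
    proof (induction j rule: dec_induct)
      case base
      then show ?case using assms(1)[of k] step(1) False by auto
    next
      case (step j)
      then show ?case using assms(1)[of j] \<open>1 \<le> k\<close> by auto
    qed
    note inc = this
    have "f (Suc k) \<le> f (Suc n)"
    proof (cases "Suc k \<le> n")
      case True
      then show ?thesis using inc[of n] by auto
    next
      case False
      then have "k = n" using step by simp
      then show ?thesis by simp
    qed
    then show ?thesis by simp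
  qed
qed simp

context finite_index
begin

text \<open>\<open>A\<close> and \<open>B\<close> stand for the inverses of \<open>H\<close> and
  \<open>H + X\<close>, and \<open>q * D\<close> is the first-order decrease of the trace. The
  difference of the traces is the sum of the mixed traces \<open>d 1, ..., d q\<close> defined
  below. Each would equal \<open>D\<close> if \<open>B\<close> were \<open>A\<close>; the work lies
  in bounding how far they fall below \<open>D\<close>.\<close>

lemma trace_power_difference:
  assumes A: "psd A" and B: "psd B" and X: "psd X" and odd: "odd q"
    and AXB: "A - B = A \<odot> X \<odot> B" and BXA: "A - B = B \<odot> X \<odot> A"
    and XAX: "\<And>v. qf (X \<odot> A \<odot> X) v \<le> \<kappa> * qf X v"
    and XBX: "\<And>v. qf (X \<odot> B \<odot> X) v \<le> \<kappa> * qf X v"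
    and \<kappa>: "0 \<le> \<kappa>"
  defines "D \<equiv> Re (tr (mpow A (Suc q) \<odot> X))"
  shows "Re (tr (mpow A q)) - Re (tr (mpow B q)) \<le> real q * D"
    and "real q * (1 - (real q + 1) * \<kappa> / 2) * D \<le> Re (tr (mpow A q)) - Re (tr (mpow B q))"
proof -
  have sA: "supported A" and sB: "supported B" and sX: "supported X"
    and aA: "adj_mat A = A" and aB: "adj_mat B = B" and aX: "adj_mat X = X"
    using A B X by (auto simp: psd_def herm_def)
  have aBp: "adj_mat (mpow B k) = mpow B k" and aAp: "adj_mat (mpow A k) = mpow A k" for k
    by (simp_all add: adj_mat_mpow sA sB aA aB)
  have sAp: "supported (mpow A k)" and sBp: "supported (mpow B k)" for k
    by (simp_all add: supported_mpow sA sB)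
  define d where "d k = Re (tr (mpow A k \<odot> X \<odot> mpow B (q + 1 - k)))" for k
  \<comment> \<open>These are the increments of \<open>d\<close>. Their exponents add up to the odd
    number \<open>q + 2\<close>, hence they are nonnegative.\<close>
  define f where "f k = Re (tr (mpow A k \<odot> X \<odot> mpow B (q + 2 - k) \<odot> X))" for k
  have f_nonneg: "0 \<le> f k" if "k \<le> q + 2" for k
    unfolding f_def using tr_mpow_conj_nonneg[OF A B, of k "q + 2 - k" X] odd that
    by (simp add: aX)
  have d_step: "d (Suc k) - d k = f (Suc k)" if "k \<le> q" for k
  proof -
    define b where "b = q - k"
    have b: "q + 1 - Suc k = b" "q + 1 - k = Suc b" "q + 2 - Suc k = Suc b"
      using that by (auto simp: b_def)
    have "tr (mpow A (Suc k) \<odot> X \<odot> mpow B (Suc b) \<odot> X)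
        = tr (X \<odot> mpow B (Suc b) \<odot> X \<odot> (A \<odot> mpow A k))"
      using tr_mm_commute[of "mpow A (Suc k)" "X \<odot> mpow B (Suc b) \<odot> X"]
      by (simp add: mm_assoc)
    also have "X \<odot> mpow B (Suc b) \<odot> X \<odot> (A \<odot> mpow A k)
        = X \<odot> mpow B b \<odot> (B \<odot> X \<odot> A) \<odot> mpow A k"
      unfolding mpow_Suc_right[OF sB] by (simp add: mm_assoc)
    also have "\<dots> = X \<odot> mpow B b \<odot> (A - B) \<odot> mpow A k" by (simp only: BXA)
    also have "\<dots> = X \<odot> mpow B b \<odot> mpow A (Suc k) - X \<odot> mpow B (Suc b) \<odot> mpow A k"
      unfolding mpow_Suc_right[OF sB] by (simp add: mm_diff_left mm_diff_right mm_assoc)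
    also have "tr \<dots> = tr (mpow A (Suc k) \<odot> X \<odot> mpow B b) - tr (mpow A k \<odot> X \<odot> mpow B (Suc b))"
      using tr_mm_commute[of "mpow A (Suc k)" "X \<odot> mpow B b"]
        tr_mm_commute[of "mpow A k" "X \<odot> mpow B (Suc b)"]
      by (simp add: tr_diff mm_assoc)
    finally show ?thesis unfolding d_def f_def b by simp
  qed
  have f_convex: "2 * f (Suc k) \<le> f k + f (Suc (Suc k))" if "k \<le> q" for k
  proof -
    define b where "b = q - k"
    have b: "q + 2 - k = Suc (Suc b)" "q + 2 - Suc k = Suc b" "q + 2 - Suc (Suc k) = b"
      using that by (auto simp: b_def)
    \<comment> \<open>The second difference of \<open>f\<close> is the trace of a congruence by this
      \<open>C\<close>, with exponents adding up to \<open>q\<close>, which is odd again.\<close>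
    define C where "C = A \<odot> X - X \<odot> B"
    have aC: "adj_mat C = X \<odot> A - B \<odot> X"
      by (simp add: C_def adj_mat_diff adj_mat_mm aA aB aX)
    have "mpow A k \<odot> C \<odot> mpow B b \<odot> adj_mat C
       = mpow A (Suc k) \<odot> X \<odot> mpow B b \<odot> X \<odot> A
         - mpow A (Suc k) \<odot> X \<odot> mpow B (Suc b) \<odot> X
         - mpow A k \<odot> X \<odot> mpow B (Suc b) \<odot> X \<odot> A
         + mpow A k \<odot> X \<odot> mpow B (Suc (Suc b)) \<odot> X"
      unfolding aC unfolding C_def mpow_Suc_right[OF sA]
        mpow_Suc_right[OF sB, of "Suc b"]
      unfolding mpow.simps(2)[of B b]
      by (simp add: mm_diff_left mm_diff_right mm_assoc)
        (simp add: mpow_Suc_right[OF sB, unfolded mpow.simps] flip: mm_assoc)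
    moreover have "tr (mpow A (Suc k) \<odot> X \<odot> mpow B b \<odot> X \<odot> A)
        = tr (mpow A (Suc (Suc k)) \<odot> X \<odot> mpow B b \<odot> X)"
      using tr_mm_commute[of "mpow A (Suc k) \<odot> X \<odot> mpow B b \<odot> X" A]
      by (simp add: mm_assoc)
    moreover have "tr (mpow A k \<odot> X \<odot> mpow B (Suc b) \<odot> X \<odot> A)
        = tr (mpow A (Suc k) \<odot> X \<odot> mpow B (Suc b) \<odot> X)"
      using tr_mm_commute[of "mpow A k \<odot> X \<odot> mpow B (Suc b) \<odot> X" A]
      by (simp add: mm_assoc)
    ultimately have "Re (tr (mpow A k \<odot> C \<odot> mpow B b \<odot> adj_mat C))
        = f (Suc (Suc k)) - 2 * f (Suc k) + f k"
      unfolding f_def b by (simp add: tr_add tr_diff)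
    moreover have "0 \<le> Re (tr (mpow A k \<odot> C \<odot> mpow B b \<odot> adj_mat C))"
      by (rule tr_mpow_conj_nonneg[OF A B]) (use odd that in \<open>simp add: b_def\<close>)
    ultimately show ?thesis by simp
  qed
  have d0: "d 0 = Re (tr (mpow B (Suc q) \<odot> X))"
    using tr_mm_commute[of X "mpow B (Suc q)"] by (simp add: d_def mm_id_left sX)
  have dlast: "d (Suc q) = D"
    by (simp add: d_def D_def mm_id_right supported_mm sA sX sAp)
  obtain a where a: "Suc q = a + a" using odd by (metis evenE even_Suc mult_2)
  \<comment> \<open>By convexity only the end values of \<open>f\<close> need a bound. There a
    single \<open>A\<close> or \<open>B\<close> stands between two factors \<open>X\<close>, where
    the hypotheses with \<open>\<kappa>\<close> apply, and the other power has the even exponent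
    \<open>Suc q\<close>, so it splits into two equal halves.\<close>
  have f1: "f 1 \<le> \<kappa> * d 0"
  proof -
    have "f 1 = Re (tr (A \<odot> X \<odot> mpow B (Suc q) \<odot> X))"
      by (simp add: f_def mpow_1 sA mm_id_right)
    also have "tr (A \<odot> X \<odot> mpow B (Suc q) \<odot> X) = tr (mpow B a \<odot> mpow B a \<odot> X \<odot> A \<odot> X)"
      using tr_mm_commute[of "A \<odot> X" "mpow B (Suc q) \<odot> X"]
      unfolding a mpow_add[OF sB] by (simp add: mm_assoc)
    also have "\<dots> = tr (adj_mat (mpow B a) \<odot> (X \<odot> A \<odot> X) \<odot> mpow B a)"
      using tr_mm_commute[of "mpow B a" "mpow B a \<odot> X \<odot> A \<odot> X"] by (simp add: aBp mm_assoc)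
    also have "Re \<dots> \<le> \<kappa> * Re (tr (adj_mat (mpow B a) \<odot> X \<odot> mpow B a))"
      by (rule tr_conj_mono) (rule XAX)
    also have "tr (adj_mat (mpow B a) \<odot> X \<odot> mpow B a) = tr (mpow B (Suc q) \<odot> X)"
      using tr_mm_commute[of "mpow B a \<odot> X" "mpow B a"]
      unfolding a mpow_add[OF sB] by (simp add: aBp mm_assoc)
    finally show ?thesis by (simp add: d0)
  qed
  have flast: "f (Suc q) \<le> \<kappa> * D"
  proof -
    have "f (Suc q) = Re (tr (mpow A (Suc q) \<odot> (X \<odot> B \<odot> X)))"
      by (simp add: f_def mpow_1 sB mm_id_right mm_assoc)
    also have "tr (mpow A (Suc q) \<odot> (X \<odot> B \<odot> X)) = tr (adj_mat (mpow A a) \<odot> (X \<odot> B \<odot> X) \<odot> mpow A a)"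
      using tr_mm_commute[of "mpow A a" "mpow A a \<odot> (X \<odot> B \<odot> X)"]
      unfolding a mpow_add[OF sA] by (simp add: aAp mm_assoc)
    also have "Re \<dots> \<le> \<kappa> * Re (tr (adj_mat (mpow A a) \<odot> X \<odot> mpow A a))"
      by (rule tr_conj_mono) (rule XBX)
    also have "tr (adj_mat (mpow A a) \<odot> X \<odot> mpow A a) = tr (mpow A (Suc q) \<odot> X)"
      using tr_mm_commute[of "mpow A a \<odot> X" "mpow A a"]
      unfolding a mpow_add[OF sA] by (simp add: aAp mm_assoc)
    finally show ?thesis by (simp add: D_def)
  qed
  have d_mono: "d k \<le> D" if "k \<le> Suc q" for k
    using that
  proof (induction k rule: inc_induct)
    case (step n)
    then show ?case using d_step[of n] f_nonneg[of "Suc n"] by simp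
  qed (simp add: dlast)
  have f_le: "f k \<le> \<kappa> * D" if "1 \<le> k" "k \<le> Suc q" for k
  proof -
    have "f k \<le> max (f 1) (f (Suc q))"
      by (rule convex_seq_max) (use f_convex that in auto)
    moreover have "\<kappa> * d 0 \<le> \<kappa> * D" using d_mono[of 0] \<kappa> by (simp add: mult_left_mono)
    ultimately show ?thesis using f1 flast by linarith
  qed
  \<comment> \<open>Going down from \<open>d (Suc q) = D\<close>, each of the
    \<open>Suc q - k\<close> increments costs at most \<open>\<kappa> * D\<close>. Summing these
    costs produces the factor \<open>(q + 1) / 2\<close>.\<close>
  have d_lower: "D - real (Suc q - k) * (\<kappa> * D) \<le> d k" if "k \<le> Suc q" for k
    using that
  proof (induction k rule: inc_induct)
    case (step n)
    have "real (Suc q - n) = real (Suc q - Suc n) + 1" using step by simp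
    then show ?case using step d_step[of n] f_le[of "Suc n"] by (simp add: algebra_simps)
  qed (simp add: dlast)
  have tele: "Re (tr (mpow A q)) - Re (tr (mpow B q)) = (\<Sum>k<q. d (Suc k))"
  proof -
    define p where "p k = Re (tr (mpow A k \<odot> mpow B (q - k)))" for k
    have "p (Suc k) - p k = d (Suc k)" if "k < q" for k
    proof -
      define b where "b = q - Suc k"
      have b: "q - k = Suc b" "q - Suc k = b" "q + 1 - Suc k = Suc b"
        using that by (auto simp: b_def)
      have "mpow A (Suc k) \<odot> mpow B b - mpow A k \<odot> mpow B (Suc b)
          = mpow A k \<odot> (A - B) \<odot> mpow B b"
        unfolding mpow_Suc_right[OF sA] by (simp add: mm_diff_left mm_diff_right mm_assoc)
      also have "\<dots> = mpow A (Suc k) \<odot> X \<odot> mpow B (Suc b)"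
        unfolding AXB mpow_Suc_right[OF sA] by (simp add: mm_assoc)
      finally show ?thesis unfolding p_def d_def b
        by (metis (no_types) minus_complex.sel(1) tr_diff)
    qed
    then have "(\<Sum>k<q. d (Suc k)) = (\<Sum>k<q. p (Suc k) - p k)" by simp
    also have "\<dots> = p q - p 0" by (rule sum_lessThan_telescope)
    finally show ?thesis by (simp add: p_def mm_id_left mm_id_right sAp sBp)
  qed
  show "Re (tr (mpow A q)) - Re (tr (mpow B q)) \<le> real q * D"
    unfolding tele using sum_mono[of "{..<q}" "\<lambda>k. d (Suc k)" "\<lambda>_. D"] d_mono by simp
  have "(\<Sum>k<q. D - real (q - k) * (\<kappa> * D)) \<le> (\<Sum>k<q. d (Suc k))"
    proof (intro sum_mono)
    fix k assume "k \<in> {..<q}"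
    then show "D - real (q - k) * (\<kappa> * D) \<le> d (Suc k)" using d_lower[of "Suc k"] by simp
  qed
  moreover have "(\<Sum>k<q. real (q - k)) = real q * (real q + 1) / 2"
  proof -
    have "(\<Sum>k<q. real (q - k)) = (\<Sum>k<q. real (Suc k))"
      using sum.nat_diff_reindex[of "\<lambda>k. real (Suc k)" q]
      by (metis (no_types, lifting) Suc_diff_Suc lessThan_iff sum.cong)
    also have "\<dots> = real q * (real q + 1) / 2"
      by (induction q) (auto simp: field_simps)
    finally show ?thesis .
  qed
  then have "(\<Sum>k<q. D - real (q - k) * (\<kappa> * D)) = real q * (1 - (real q + 1) * \<kappa> / 2) * D"
    by (simp add: sum_subtractf flip: sum_distrib_right) (simp add: field_simps)
  ultimately show "real q * (1 - (real q + 1) * \<kappa> / 2) * D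
      \<le> Re (tr (mpow A q)) - Re (tr (mpow B q))"
    unfolding tele by simp
qed

text \<open>Cauchy-Schwarz for the form of \<open>X\<close> at the vectors \<open>X v\<close> and
  \<open>v\<close>, divided by \<open>nsq (mv X v)\<close>. This replaces the operator inequality
  \<open>X^2 \<le> r X\<close>.\<close>

lemma nsq_mv_le:
  assumes "psd X" and "\<And>v. qf X v \<le> r * nsq v"
  shows "nsq (mv X v) \<le> r * qf X v"
proof -
  let ?w = "mv X v"
  have "(nsq ?w)\<^sup>2 \<le> qf X ?w * qf X v"
    using psd_Cauchy_Schwarz[OF assms(1), of ?w v] by (simp add: nsq_ip)
  also have "\<dots> \<le> r * nsq ?w * qf X v"
    using assms by (intro mult_right_mono) (auto simp: psd_def)
  finally have *: "nsq ?w * nsq ?w \<le> nsq ?w * (r * qf X v)" by (simp add: power2_eq_square mult_ac)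
  show ?thesis
  proof (cases "nsq ?w = 0")
    case True
    \<comment> \<open>\<open>r\<close> carries no sign assumption; if \<open>qf X v\<close> is
      positive, then the bound by \<open>r * nsq v\<close> forces \<open>r\<close> to be
      nonnegative.\<close>
    have "0 \<le> r * qf X v"
    proof (cases "qf X v = 0")
      case False
      then have "0 < qf X v" using assms(1) by (simp add: psd_def less_le)
      then have "0 < r * nsq v" using assms(2)[of v] by linarith
      then have "0 \<le> r" using nsq_nonneg[of v] by (meson less_le_not_le mult_nonpos_nonneg not_le_imp_less)
      then show ?thesis using \<open>0 < qf X v\<close> by simp
    qed simp
    then show ?thesis using True by simp
  next
    case False
    then have "0 < nsq ?w" using nsq_nonneg[of ?w] by linarith
    then show ?thesis using * by simp
  qed
qed

section \<open>Inverses and their order bounds\<close>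

definition inverse_of :: "'i cmat \<Rightarrow> 'i cmat \<Rightarrow> bool" where
  "inverse_of H K \<longleftrightarrow> supported K \<and> H \<odot> K = id_mat \<and> K \<odot> H = id_mat"

lemma inverse_of_unique: "inverse_of H K \<Longrightarrow> inverse_of H K' \<Longrightarrow> K = K'"
  unfolding inverse_of_def by (metis mm_assoc mm_id_left mm_id_right)

lemma inverse_of_herm: "herm H \<Longrightarrow> inverse_of H K \<Longrightarrow> herm K"
proof -
  assume H: "herm H" and K: "inverse_of H K"
  have "inverse_of H (adj_mat K)"
    using H K unfolding inverse_of_def herm_def
    by (metis adj_mat_adj_mat adj_mat_id adj_mat_mm supported_def adj_mat_def complex_cnj_zero)
  then have "adj_mat K = K" using K inverse_of_unique by blast
  then show ?thesis using K by (simp add: herm_def inverse_of_def)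
qed

lemma inverse_of_qf:
  assumes "herm H" "inverse_of H K"
  shows "qf K v = qf H (mv K v)"
proof -
  have "mv H (mv K v) = mv id_mat v" using assms(2) by (simp add: inverse_of_def flip: mv_mm)
  then have "qf H (mv K v) = Re (ip (mv K v) v)" by (simp add: qf_def ip_mv_id)
  then show ?thesis by (simp add: qf_def Re_ip_commute)
qed

lemma inverse_of_psd: "psd H \<Longrightarrow> inverse_of H K \<Longrightarrow> psd K"
  by (auto simp: psd_def inverse_of_qf intro: inverse_of_herm)

text \<open>With \<open>u = mv K v\<close>, the square of \<open>qf K v\<close> is at most
  \<open>nsq v * nsq u\<close>, while \<open>\<tau> * nsq u \<le> qf H u = qf K v\<close>.\<close>

lemma inverse_of_le:
  assumes "psd H" "inverse_of H K" and "0 < \<tau>" and "\<And>v. \<tau> * nsq v \<le> qf H v"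
  shows "\<tau> * qf K v \<le> nsq v"
proof -
  let ?u = "mv K v"
  have H: "herm H" using assms(1) by (simp add: psd_def)
  have K: "psd K" using assms inverse_of_psd by blast
  have "(qf K v)\<^sup>2 \<le> nsq v * nsq ?u"
    using psd_Cauchy_Schwarz[OF psd_id, of v ?u] by (simp add: qf_id ip_mv_id) (simp add: qf_def)
  also have "\<tau> * (nsq v * nsq ?u) \<le> nsq v * qf K v"
    using assms(4)[of ?u] mult_left_mono[of "\<tau> * nsq ?u" "qf K v" "nsq v"]
    by (simp add: inverse_of_qf[OF H assms(2)] mult_ac)
  finally have *: "\<tau> * (qf K v)\<^sup>2 \<le> nsq v * qf K v" using assms(3) by simp
  show ?thesis
  proof (cases "qf K v = 0")
    case False
    then have "0 < qf K v" using K by (simp add: psd_def less_le)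
    then show ?thesis using * by (simp add: power2_eq_square)
  qed simp
qed

lemma resolvent_identity:
  assumes "inverse_of H A" "inverse_of (H + X) B"
  shows "A - B = A \<odot> X \<odot> B" "A - B = B \<odot> X \<odot> A"
proof -
  have s: "supported A" "supported B" and
    e: "A \<odot> H = id_mat" "H \<odot> A = id_mat" "(H + X) \<odot> B = id_mat" "B \<odot> (H + X) = id_mat"
    using assms by (auto simp: inverse_of_def)
  have "A \<odot> X \<odot> B = A \<odot> ((H + X) \<odot> B) - (A \<odot> H) \<odot> B"
    by (simp add: mm_add_left mm_add_right mm_assoc)
  also have "\<dots> = A - B" unfolding e using s by (simp add: mm_id_left mm_id_right)
  finally show "A - B = A \<odot> X \<odot> B" by simp
  have "B \<odot> X \<odot> A = (B \<odot> (H + X)) \<odot> A - B \<odot> (H \<odot> A)"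
    by (simp add: mm_add_left mm_add_right mm_assoc)
  also have "\<dots> = A - B" unfolding e using s by (simp add: mm_id_left mm_id_right)
  finally show "A - B = B \<odot> X \<odot> A" by simp
qed

text \<open>\<open>- q * D\<close> is the derivative of \<open>tr H^(-q)\<close> in the direction
  \<open>X\<close>. The first bound is the tangent inequality of a convex function; the second says
  that nearly all of the first-order decrease is realized when the relative step
  \<open>r / \<tau>\<close> is small against \<open>1 / q\<close>.\<close>

lemma trace_inverse_power_step:
  assumes H: "psd H" and X: "psd X" and A: "inverse_of H A" and B: "inverse_of (H + X) B"
    and \<tau>: "0 < \<tau>" "\<And>v. \<tau> * nsq v \<le> qf H v"
    and r: "0 \<le> r" "\<And>v. qf X v \<le> r * nsq v" and q: "odd q"
  defines "D \<equiv> Re (tr (mpow A (Suc q) \<odot> X))"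
  shows "Re (tr (mpow A q)) - Re (tr (mpow B q)) \<le> real q * D"
    and "real q * (1 - (real q + 1) * (r / \<tau>) / 2) * D
          \<le> Re (tr (mpow A q)) - Re (tr (mpow B q))"
proof -
  have HX: "psd (H + X)" using H X by (rule psd_add)
  have pA: "psd A" and pB: "psd B" using H HX A B inverse_of_psd by blast+
  have bound: "qf (X \<odot> K \<odot> X) v \<le> r / \<tau> * qf X v" if "\<And>w. \<tau> * qf K w \<le> nsq w" for K v
  proof -
    have "qf (X \<odot> K \<odot> X) v = qf K (mv X v)"
      unfolding qf_def mm_assoc mv_mm by (subst ip_mv_adj) (use X in \<open>simp add: psd_def herm_def\<close>)
    also have "\<dots> \<le> nsq (mv X v) / \<tau>" using that[of "mv X v"] \<tau> by (simp add: field_simps)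
    also have "\<dots> \<le> r * qf X v / \<tau>"
      using nsq_mv_le[OF X r(2), of v] \<tau> by (simp add: divide_right_mono)
    finally show ?thesis by simp
  qed
  have HX\<tau>: "\<tau> * nsq v \<le> qf (H + X) v" for v
    using \<tau>(2)[of v] X by (simp add: qf_add psd_def add_increasing2)
  note main = trace_power_difference[OF pA pB X q resolvent_identity[OF A B],
      OF bound[OF inverse_of_le[OF H A \<tau>]] bound[OF inverse_of_le[OF HX B \<tau>(1) HX\<tau>]]]
  show "Re (tr (mpow A q)) - Re (tr (mpow B q)) \<le> real q * D"
    "real q * (1 - (real q + 1) * (r / \<tau>) / 2) * D
          \<le> Re (tr (mpow A q)) - Re (tr (mpow B q))"
    unfolding D_def using main r \<tau> by auto
qed

end

section \<open>Inverses by Neumann series\<close>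

context finite_index
begin

text \<open>Sum over all pairs of indices of a 2 by 2 inequality, namely positivity at one vector
  supported on \<open>{i, j}\<close>. It makes the trace a norm bound without eigenvalues.\<close>

lemma psd_qf_le_trace:
  assumes P: "psd P"
  shows "qf P v \<le> Re (tr P) * nsq v"
proof -
  have herm: "P j i = cnj (P i j)" for i j
    using P by (metis adj_mat_def herm_def psd_def)
  have *: "2 * Re (cnj (v i) * P i j * v j) \<le> (cmod (v i))\<^sup>2 * Re (P j j) + (cmod (v j))\<^sup>2 * Re (P i i)"
    if ij: "i \<in> S" "j \<in> S" for i j
  proof -
    define e :: "'i \<Rightarrow> 'i \<Rightarrow> complex" where "e k = (\<lambda>l. if l = k then 1 else 0)" for k
    \<comment> \<open>The antisymmetric choice exchanges the weights of the two diagonal entries and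
      gives the cross term a minus sign. For \<open>i = j\<close> the vector \<open>w\<close> is
      zero.\<close>
    define x y where "x = cnj (v j)" and "y = - cnj (v i)"
    define w where "w = (\<lambda>l. x * e i l) + (\<lambda>l. y * e j l)"
    have mve: "mv P (e k) = (\<lambda>l. P l k)" if "k \<in> S" for k
      using that by (auto simp: mv_def e_def fun_eq_iff finite_S if_distrib cong: if_cong)
    have ipe: "ip (e k) u = u k" if "k \<in> S" for k u
    proof -
      have "ip (e k) u = (\<Sum>i\<in>S. if i = k then u i else 0)"
        unfolding ip_def e_def by (intro sum.cong) auto
      then show ?thesis using that by (simp add: finite_S)
    qed
    have "mv P w = (\<lambda>l. x * P l i + y * P l j)"
    proof -
      have "mv P w = (\<lambda>l. x * mv P (e i) l + y * mv P (e j) l)"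
        by (simp add: mv_def w_def fun_eq_iff ring_distribs sum.distrib sum_distrib_left mult_ac)
      then show ?thesis using ij by (simp add: mve)
    qed
    then have "ip w (mv P w) = cnj x * (x * P i i + y * P i j) + cnj y * (x * P j i + y * P j j)"
      using ij by (simp add: w_def ip_add_left ip_scale_left ipe)
    then have "qf P w = Re (cnj x * x * P i i) + Re (cnj y * y * P j j)
        + Re (cnj x * y * P i j) + Re (cnj (cnj x * y * P i j))"
      unfolding qf_def herm[of j i] by (simp add: algebra_simps)
    then have "qf P w = (cmod (v j))\<^sup>2 * Re (P i i) + (cmod (v i))\<^sup>2 * Re (P j j)
        - 2 * Re (cnj (v i) * P i j * v j)"
      unfolding cmod_power2 x_def y_def by (simp add: power2_eq_square algebra_simps)
    moreover have "0 \<le> qf P w" using P by (simp add: psd_def)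
    ultimately show ?thesis by simp
  qed
  have "2 * qf P v = (\<Sum>i\<in>S. \<Sum>j\<in>S. 2 * Re (cnj (v i) * P i j * v j))"
    by (simp add: qf_def ip_def mv_def sum_distrib_left mult.assoc)
  also have "\<dots> \<le> (\<Sum>i\<in>S. \<Sum>j\<in>S. (cmod (v i))\<^sup>2 * Re (P j j) + (cmod (v j))\<^sup>2 * Re (P i i))"
    by (intro sum_mono *)
  also have "\<dots> = 2 * (Re (tr P) * nsq v)"
    unfolding sum.distrib
    by (subst (2) sum.swap) (simp add: tr_def nsq_def flip: sum_product)
  finally show ?thesis by simp
qed

text \<open>The inverse of a positive definite matrix as a Neumann series: unlike an abstract inverse,
  its entries are visibly measurable functions of the entries of the matrix.\<close>
definition neumann :: "'i cmat \<Rightarrow> 'i cmat" where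
  "neumann H = id_mat - (1 / (Re (tr H) + 1)) *\<^sub>m H"

definition minv :: "'i cmat \<Rightarrow> 'i cmat" where
  "minv H = (1 / (Re (tr H) + 1)) *\<^sub>m (\<lambda>i j. \<Sum>k. mpow (neumann H) k i j)"

text \<open>Division by more than the trace puts \<open>neumann H\<close> between zero and a
  multiple \<open>\<rho> < 1\<close> of the identity. Its powers then decay geometrically in every
  entry, and telescoping yields a two-sided inverse.\<close>

lemma inverse_of_minv:
  assumes H: "herm H" and \<tau>: "0 < \<tau>" "\<And>v. \<tau> * nsq v \<le> qf H v"
  shows "inverse_of H (minv H)"
proof -
  let ?T = "neumann H"
  define h where "h = Re (tr H) + 1"
  have pH: "psd H" unfolding psd_def using H \<tau> by (meson mult_nonneg_nonneg less_imp_le nsq_nonneg order_trans)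
  have sH: "supported H" using H by (simp add: herm_def)
  have "0 \<le> Re (tr H)"
    using tr_conj_nonneg[of H id_mat] pH by (simp add: psd_def mm_id_right mm_id_left sH)
  then have h: "1 \<le> h" by (simp add: h_def)
  have T: "?T = id_mat - (1 / h) *\<^sub>m H" by (simp add: neumann_def h_def)
  have H_T: "H = h *\<^sub>m (id_mat - ?T)" using h by (simp add: T smult_mat_def fun_eq_iff)
  have sT: "supported ?T" and aT: "adj_mat ?T = ?T"
    using H by (simp_all add: T supported_diff supported_smult herm_def adj_mat_diff adj_mat_smult)
  have qT: "qf ?T v = nsq v - qf H v / h" for v by (simp add: T qf_diff qf_id qf_smult)
  have "0 \<le> qf ?T v" for v
  proof -
    have "qf H v \<le> h * nsq v"
      using psd_qf_le_trace[OF pH, of v] nsq_nonneg[of v] unfolding h_def distrib_right by linarith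
    then show ?thesis using h by (simp add: qT field_simps)
  qed
  then have pT: "psd ?T" by (simp add: psd_def herm_def sT aT)
  \<comment> \<open>The maximum with 0 covers empty \<open>S\<close>: there \<open>\<tau>\<close> is
    unconstrained and may exceed \<open>h\<close>.\<close>
  define \<rho> where "\<rho> = max 0 (1 - \<tau> / h)"
  have \<rho>: "0 \<le> \<rho>" "\<rho> < 1" using \<tau> h by (auto simp: \<rho>_def)
  have T\<rho>: "qf ?T v \<le> \<rho> * nsq v" for v
  proof -
    have "\<tau> * nsq v / h \<le> qf H v / h" using \<tau>(2)[of v] h by (intro divide_right_mono) auto
    then have "qf ?T v \<le> (1 - \<tau> / h) * nsq v" by (simp add: qT algebra_simps)
    also have "\<dots> \<le> \<rho> * nsq v" by (intro mult_right_mono) (auto simp: \<rho>_def)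
    finally show ?thesis .
  qed
  have Tnsq: "nsq (mv ?T v) \<le> \<rho>\<^sup>2 * nsq v" for v
    using nsq_mv_le[OF pT T\<rho>, of v] mult_left_mono[OF T\<rho>[of v] \<rho>(1)]
    by (simp add: power2_eq_square mult_ac)
  have Tk: "nsq (mv (mpow ?T k) v) \<le> \<rho> ^ (2 * k) * nsq v" for k v
  proof (induction k)
    case 0
    have "nsq (mv id_mat v) = nsq v" by (simp add: nsq_def mv_id)
    then show ?case by simp
  next
    case (Suc k)
    have "nsq (mv (mpow ?T (Suc k)) v) \<le> \<rho>\<^sup>2 * nsq (mv (mpow ?T k) v)"
      by (simp add: mv_mm Tnsq)
    also have "\<dots> \<le> \<rho>\<^sup>2 * (\<rho> ^ (2 * k) * nsq v)" by (intro mult_left_mono Suc) auto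
    also have "\<dots> = \<rho> ^ (2 * Suc k) * nsq v" by (simp add: power2_eq_square)
    finally show ?case .
  qed
  have entry: "cmod (mpow ?T k i j) \<le> \<rho> ^ k" for k i j
  proof (cases "i \<in> S \<and> j \<in> S")
    case True
    define e :: "'i \<Rightarrow> complex" where "e = (\<lambda>l. if l = j then 1 else 0)"
    have "mv (mpow ?T k) e i = mpow ?T k i j"
      using True by (simp add: mv_def e_def finite_S if_distrib cong: if_cong)
    moreover have "nsq e = 1"
    proof -
      have "(cmod (e l))\<^sup>2 = (if l = j then 1 else 0)" for l by (simp add: e_def)
      then show ?thesis using True by (simp add: nsq_def finite_S)
    qed
    moreover have "(cmod (mv (mpow ?T k) e i))\<^sup>2 \<le> nsq (mv (mpow ?T k) e)"
      unfolding nsq_def using True finite_S by (intro member_le_sum) auto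
    ultimately have "(cmod (mpow ?T k i j))\<^sup>2 \<le> (\<rho> ^ k)\<^sup>2"
      using Tk[of k e] by (simp add: power_even_eq power2_eq_square power_add mult_2)
    then show ?thesis using \<rho> by (simp add: abs_le_square_iff[symmetric] power_abs)
  next
    case False
    then show ?thesis using supported_mpow[OF sT, of k] \<rho> by (auto simp: supported_def)
  qed
  have summ: "summable (\<lambda>k. mpow ?T k i j)" for i j
    by (rule summable_comparison_test'[where g = "\<lambda>k. \<rho> ^ k" and N = 0])
      (use \<rho> entry summable_geometric in auto)
  define K where "K = (\<lambda>i j. \<Sum>k. mpow ?T k i j)"
  have sums: "(\<lambda>k. mpow ?T k i j) sums K i j" for i j
    unfolding K_def using summ by (rule summable_sums)
  have lim0: "(\<lambda>k. mpow ?T k i j) \<longlonglongrightarrow> 0" for i j using summ by (rule summable_LIMSEQ_zero)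
  have tele: "(\<lambda>k. (mpow ?T k - mpow ?T (Suc k)) i j) sums id_mat i j" for i j
    using telescope_sums'[OF lim0[of i j]] by simp
  have "((id_mat - ?T) \<odot> K) i j = id_mat i j" for i j
  proof -
    have "(\<lambda>k. \<Sum>l\<in>S. (id_mat - ?T) i l * mpow ?T k l j) sums (\<Sum>l\<in>S. (id_mat - ?T) i l * K l j)"
      by (intro sums_sum sums_mult sums)
    moreover have "(\<Sum>l\<in>S. (id_mat - ?T) i l * mpow ?T k l j) = (mpow ?T k - mpow ?T (Suc k)) i j" for k
    proof -
      have "(id_mat - ?T) \<odot> mpow ?T k = mpow ?T k - mpow ?T (Suc k)"
        by (simp add: mm_diff_left mm_id_left supported_mpow sT)
      then show ?thesis by (metis mm_def)
    qed
    ultimately have "((id_mat - ?T) \<odot> K) i j = (\<Sum>k. (mpow ?T k - mpow ?T (Suc k)) i j)"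
      by (simp add: sums_iff mm_def)
    then show ?thesis using tele[of i j] by (simp add: sums_iff)
  qed
  moreover have "(K \<odot> (id_mat - ?T)) i j = id_mat i j" for i j
  proof -
    have "(\<lambda>k. \<Sum>l\<in>S. mpow ?T k i l * (id_mat - ?T) l j) sums (\<Sum>l\<in>S. K i l * (id_mat - ?T) l j)"
      by (intro sums_sum sums_mult2 sums)
    moreover have "(\<Sum>l\<in>S. mpow ?T k i l * (id_mat - ?T) l j) = (mpow ?T k - mpow ?T (Suc k)) i j" for k
    proof -
      have "mpow ?T k \<odot> (id_mat - ?T) = mpow ?T k - mpow ?T (Suc k)"
        unfolding mpow_Suc_right[OF sT] by (simp add: mm_diff_right mm_id_right supported_mpow sT)
      then show ?thesis by (metis mm_def)
    qed
    ultimately have "(K \<odot> (id_mat - ?T)) i j = (\<Sum>k. (mpow ?T k - mpow ?T (Suc k)) i j)"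
      by (simp add: sums_iff mm_def)
    then show ?thesis using tele[of i j] by (simp add: sums_iff)
  qed
  ultimately have K1: "(id_mat - ?T) \<odot> K = id_mat" and K2: "K \<odot> (id_mat - ?T) = id_mat"
    by (auto intro!: ext)
  have minv: "minv H = (1 / h) *\<^sub>m K" by (simp add: minv_def h_def K_def)
  have cancel: "h *\<^sub>m ((1 / h) *\<^sub>m M) = M" for M :: "'i cmat"
    using h by (simp add: smult_mat_def fun_eq_iff)
  have cancel': "(1 / h) *\<^sub>m (h *\<^sub>m M) = M" for M :: "'i cmat"
    using h by (simp add: smult_mat_def fun_eq_iff)
  have "supported K"
    using supported_mpow[OF sT] by (auto simp: supported_def K_def)
  moreover have "H \<odot> minv H = id_mat"
    unfolding minv by (subst H_T) (simp only: mm_smult_left mm_smult_right K1 cancel cancel')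
  moreover have "minv H \<odot> H = id_mat"
    unfolding minv by (subst H_T) (simp only: mm_smult_left mm_smult_right K2 cancel cancel')
  ultimately show ?thesis
    by (simp add: inverse_of_def minv supported_smult)
qed

lemma measurable_mpow_entry:
  assumes "\<And>i j. (\<lambda>x. H x i j) \<in> borel_measurable M"
  shows "(\<lambda>x. mpow (H x) k i j) \<in> borel_measurable M"
  using assms by (induction k arbitrary: i j) (auto simp: mm_def)

lemma measurable_minv_entry:
  assumes [measurable]: "\<And>i j. (\<lambda>x. H x i j) \<in> borel_measurable M"
  shows "(\<lambda>x. minv (H x) i j) \<in> borel_measurable M"
proof -
  have [measurable]: "(\<lambda>x. Re (tr (H x))) \<in> borel_measurable M"
    unfolding tr_def by measurable
  have [measurable]: "(\<lambda>x. neumann (H x) i j) \<in> borel_measurable M" for i j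
    unfolding neumann_def smult_mat_def by simp
  have [measurable]: "(\<lambda>x. mpow (neumann (H x)) k i j) \<in> borel_measurable M" for i j k
    by (intro measurable_mpow_entry) simp
  show ?thesis unfolding minv_def smult_mat_def by measurable
qed

section \<open>The potential and its change under one step\<close>

definition inv_trace :: "nat \<Rightarrow> 'i cmat \<Rightarrow> real" where
  "inv_trace q H = Re (tr (mpow (minv H) q))"

lemma measurable_inv_trace:
  assumes [measurable]: "\<And>i j. (\<lambda>x. H x i j) \<in> borel_measurable M"
  shows "(\<lambda>x. inv_trace q (H x)) \<in> borel_measurable M"
proof -
  have [measurable]: "(\<lambda>x. mpow (minv (H x)) q i j) \<in> borel_measurable M" for i j
    by (intro measurable_mpow_entry measurable_minv_entry) simp
  show ?thesis unfolding inv_trace_def tr_def by measurable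
qed

text \<open>The explicit bound \<open>\<tau>\<close> survives the addition of positive semidefinite
  matrices, so one value controls the relative size of all later steps.\<close>

definition posdef :: "real \<Rightarrow> 'i cmat \<Rightarrow> bool" where
  "posdef \<tau> H \<longleftrightarrow> 0 < \<tau> \<and> herm H \<and> (\<forall>v. \<tau> * nsq v \<le> qf H v)"

lemma posdef_psd: "posdef \<tau> H \<Longrightarrow> psd H"
  unfolding posdef_def psd_def by (meson mult_nonneg_nonneg less_imp_le nsq_nonneg order_trans)

lemma posdef_add: "posdef \<tau> H \<Longrightarrow> psd X \<Longrightarrow> posdef \<tau> (H + X)"
  by (auto simp: posdef_def psd_def herm_def supported_add adj_mat_add qf_add add_increasing2)

lemma posdef_inverse: "posdef \<tau> H \<Longrightarrow> inverse_of H (minv H)"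
  unfolding posdef_def using inverse_of_minv by blast

lemma tr_psd_nonneg: "psd P \<Longrightarrow> 0 \<le> Re (tr P)"
  using tr_conj_nonneg[of P id_mat] by (simp add: psd_def herm_def mm_id_right mm_id_left)

lemma inv_trace_nonneg: "posdef \<tau> H \<Longrightarrow> 0 \<le> inv_trace q H"
  unfolding inv_trace_def
  by (intro tr_psd_nonneg psd_mpow inverse_of_psd[OF _ posdef_inverse] posdef_psd)

text \<open>Any \<open>c\<close> below the exact fraction is admissible because the first-order term
  is nonnegative: the exponent \<open>Suc q\<close> is even, so the trace is that of a congruence of
  \<open>X\<close>.\<close>

lemma inv_trace_step:
  assumes H: "posdef \<tau> H" and X: "psd X" and r: "0 \<le> r" "\<And>v. qf X v \<le> r * nsq v" and q: "odd q"
    and c: "c \<le> 1 - (real q + 1) * (r / \<tau>) / 2"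
  shows "inv_trace q (H + X) \<le> inv_trace q H - c * real q * Re (tr (mpow (minv H) (Suc q) \<odot> X))"
proof -
  let ?A = "minv H"
  have A: "inverse_of H ?A" and B: "inverse_of (H + X) (minv (H + X))"
    using posdef_inverse H posdef_add[OF H X] by blast+
  have pA: "psd ?A" using inverse_of_psd[OF posdef_psd[OF H] A] .
  have "0 \<le> Re (tr (mpow ?A (Suc q) \<odot> X \<odot> mpow ?A 0 \<odot> id_mat))"
  proof -
    obtain a where a: "Suc q = a + a" using q by (metis evenE even_Suc mult_2)
    have s: "supported ?A" "supported X" and adj: "adj_mat (mpow ?A a) = mpow ?A a"
      using pA X by (auto simp: psd_def herm_def adj_mat_mpow)
    have "tr (mpow ?A (Suc q) \<odot> X) = tr (adj_mat (mpow ?A a) \<odot> X \<odot> mpow ?A a)"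
      using tr_mm_commute[of "mpow ?A a" "mpow ?A a \<odot> X"]
      unfolding a mpow_add[OF s(1)] adj by (simp add: mm_assoc)
    then show ?thesis using tr_conj_nonneg[of X "mpow ?A a"] X s
      by (simp add: psd_def mm_id_right supported_mm supported_mpow del: mpow.simps(2))
  qed
  then have nn: "0 \<le> Re (tr (mpow ?A (Suc q) \<odot> X))" (is "0 \<le> ?D")
    using pA X by (simp add: psd_def herm_def mm_id_right supported_mm supported_mpow)
  have \<tau>: "0 < \<tau>" "\<And>v. \<tau> * nsq v \<le> qf H v" using H by (auto simp: posdef_def)
  have "real q * (1 - (real q + 1) * (r / \<tau>) / 2) * ?D \<le> inv_trace q H - inv_trace q (H + X)"
    unfolding inv_trace_def
    by (rule trace_inverse_power_step(2)[OF posdef_psd[OF H] X A B \<tau> r q])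
  moreover have "c * (real q * ?D) \<le> (1 - (real q + 1) * (r / \<tau>) / 2) * (real q * ?D)"
    using c nn by (intro mult_right_mono) auto
  ultimately show ?thesis by (simp add: algebra_simps)
qed

text \<open>The tangent inequality holds for steps of any size, so the trace of \<open>X\<close> can
  serve as the operator bound \<open>r\<close>.\<close>

lemma inv_trace_convex:
  assumes H: "posdef \<tau> H" and X: "psd X" and q: "odd q"
  shows "inv_trace q H - real q * Re (tr (mpow (minv H) (Suc q) \<odot> X)) \<le> inv_trace q (H + X)"
proof -
  have A: "inverse_of H (minv H)" and B: "inverse_of (H + X) (minv (H + X))"
    using posdef_inverse H posdef_add[OF H X] by blast+
  have \<tau>: "0 < \<tau>" "\<And>v. \<tau> * nsq v \<le> qf H v" using H by (auto simp: posdef_def)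
  show ?thesis
    using trace_inverse_power_step(1)[OF posdef_psd[OF H] X A B \<tau> tr_psd_nonneg[OF X]
        psd_qf_le_trace[OF X] q]
    by (simp add: inv_trace_def)
qed

text \<open>The moments \<open>qf (mpow K k) v\<close> are log-convex, by Cauchy-Schwarz for the
  form of \<open>mpow K k\<close> at \<open>v\<close> and \<open>mv K v\<close>. A ratio of
  consecutive moments that starts at 1 or more therefore stays there.\<close>

lemma qf_power_mono:
  assumes K: "psd K" and v: "0 < nsq v" "nsq v \<le> qf K v"
  shows "nsq v \<le> qf (mpow K (Suc k)) v \<and> qf (mpow K k) v \<le> qf (mpow K (Suc k)) v"
proof (induction k)
  case 0
  then show ?case using K v by (simp add: qf_id mm_id_right psd_def herm_def)
next
  case (Suc k)
  have s: "supported K" and a: "adj_mat K = K" using K by (auto simp: psd_def herm_def)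
  let ?P = "mpow K k"
  have 1: "Re (ip v (mv ?P (mv K v))) = qf (mpow K (Suc k)) v"
    unfolding qf_def mpow_Suc_right[OF s] by (simp add: mv_mm)
  have 2: "qf ?P (mv K v) = qf (mpow K (Suc (Suc k))) v"
  proof -
    have "mpow K (Suc (Suc k)) = K \<odot> (?P \<odot> K)" using mpow_Suc_right[OF s, of k] by simp
    then have "qf (mpow K (Suc (Suc k))) v = Re (ip v (mv K (mv (?P \<odot> K) v)))"
      unfolding qf_def by (simp only: mv_mm)
    also have "\<dots> = qf ?P (mv K v)" unfolding qf_def by (subst ip_mv_adj) (simp add: a mv_mm)
    finally show ?thesis by simp
  qed
  let ?a = "qf (mpow K k) v" and ?b = "qf (mpow K (Suc k)) v" and ?c = "qf (mpow K (Suc (Suc k))) v"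
  have cs: "?b\<^sup>2 \<le> ?a * ?c"
    using psd_Cauchy_Schwarz[OF psd_mpow[OF K], of v k "mv K v"] unfolding 1 2 .
  have pos: "0 < ?b" using Suc v by linarith
  have "0 \<le> ?c" using psd_mpow[OF K, of "Suc (Suc k)"] unfolding psd_def by blast
  then have "?b * ?b \<le> ?b * ?c"
    using cs Suc mult_right_mono[of ?a ?b ?c] by (simp add: power2_eq_square)
  then have "?b \<le> ?c" using pos by simp
  then show ?case using Suc by simp
qed

text \<open>If the inverse exceeded 1 on some vector, so would its \<open>q\<close>-th power
  relative to \<open>nsq\<close>, contradicting the trace bound. Passing from \<open>minv H\<close>
  being at most 1 to \<open>H\<close> being at least 1 is Cauchy-Schwarz for the form of
  \<open>minv H\<close> at \<open>v\<close> and \<open>mv H v\<close>.\<close>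

lemma inv_trace_less_1:
  assumes H: "posdef \<tau> H" and "inv_trace q H < 1" and "odd q"
  shows "nsq v \<le> qf H v"
proof -
  let ?K = "minv H"
  have iK: "inverse_of H ?K" by (rule posdef_inverse[OF H])
  have K: "psd ?K" using inverse_of_psd[OF posdef_psd[OF H] iK] .
  have K1: "qf ?K w \<le> nsq w" for w
  proof (rule ccontr)
    assume neg: "\<not> qf ?K w \<le> nsq w"
    obtain k where q: "q = Suc k" using \<open>odd q\<close> by (cases q) auto
    have pos: "0 < nsq w"
    proof (rule ccontr)
      assume "\<not> 0 < nsq w"
      then have "nsq w = 0" using nsq_nonneg[of w] by linarith
      then show False using psd_qf_le_trace[OF K, of w] neg by simp
    qed
    have "nsq w \<le> qf (mpow ?K q) w" unfolding q
      using qf_power_mono[OF K pos, of k] neg by simp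
    also have "\<dots> \<le> inv_trace q H * nsq w"
      unfolding inv_trace_def by (rule psd_qf_le_trace[OF psd_mpow[OF K]])
    also have "\<dots> < 1 * nsq w" using assms(2) pos by (intro mult_strict_right_mono)
    finally show False by simp
  qed
  have KH: "mv ?K (mv H v) = mv id_mat v"
    using iK by (simp add: inverse_of_def flip: mv_mm)
  have qK: "qf ?K (mv H v) = qf H v"
    unfolding qf_def KH ip_mv_id by (rule Re_ip_commute)
  have "(nsq v)\<^sup>2 \<le> qf ?K v * qf ?K (mv H v)"
    using psd_Cauchy_Schwarz[OF K, of v "mv H v"] unfolding KH ip_mv_id nsq_ip .
  also have "\<dots> \<le> nsq v * qf H v"
    unfolding qK using K1 posdef_psd[OF H] by (intro mult_right_mono) (auto simp: psd_def)
  finally have *: "nsq v * nsq v \<le> nsq v * qf H v" by (simp add: power2_eq_square)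
  show ?thesis
  proof (cases "nsq v = 0")
    case True
    then show ?thesis using posdef_psd[OF H] by (simp add: psd_def)
  next
    case False
    then have "0 < nsq v" using nsq_nonneg[of v] by linarith
    then show ?thesis using * by simp
  qed
qed

end

section \<open>Lower tail of a sum of independent positive semidefinite matrices\<close>

context finite_index
begin

definition mean_mat :: "'a measure \<Rightarrow> ('a \<Rightarrow> 'i cmat) \<Rightarrow> 'i cmat" where
  "mean_mat M X = (\<lambda>i j. integral\<^sup>L M (\<lambda>x. X x i j))"

lemma psd_entry_bound:
  assumes X: "psd X" and r: "\<And>v. qf X v \<le> r * nsq v"
  shows "cmod (X i j) \<le> \<bar>r\<bar>"
proof (cases "i \<in> S \<and> j \<in> S")
  case True
  define e :: "'i \<Rightarrow> complex" where "e = (\<lambda>l. if l = j then 1 else 0)"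
  have mve: "mv X e i = X i j"
    using True by (simp add: mv_def e_def finite_S if_distrib cong: if_cong)
  have "(cmod (e l))\<^sup>2 = (if l = j then 1 else 0)" for l by (simp add: e_def)
  then have ne: "nsq e = 1" using True by (simp add: nsq_def finite_S)
  have qe: "0 \<le> qf X e" "qf X e \<le> r" using X r[of e] ne by (auto simp: psd_def)
  have "(cmod (mv X e i))\<^sup>2 \<le> nsq (mv X e)"
    unfolding nsq_def using True finite_S by (intro member_le_sum) auto
  also have "\<dots> \<le> r * qf X e" by (rule nsq_mv_le[OF X r])
  also have "\<dots> \<le> r\<^sup>2" unfolding power2_eq_square using qe by (intro mult_left_mono) auto
  finally show ?thesis unfolding mve by (simp add: abs_le_square_iff[symmetric])
next
  case False
  then show ?thesis using X by (auto simp: psd_def herm_def supported_def)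
qed

context
  fixes M :: "'a measure" and X :: "'a \<Rightarrow> 'i cmat" and r :: real
  assumes M: "prob_space M"
    and X_meas [measurable]: "\<And>i j. (\<lambda>x. X x i j) \<in> borel_measurable M"
    and X_psd: "\<And>x. psd (X x)"
    and r_nonneg: "0 \<le> r"
    and X_le: "AE x in M. \<forall>v. qf (X x) v \<le> r * nsq v"
begin

interpretation prob_space M by (rule M)

lemma integrable_entry: "integrable M (\<lambda>x. X x i j)"
proof (rule integrable_const_bound)
  show "AE x in M. norm (X x i j) \<le> \<bar>r\<bar>"
    using X_le by eventually_elim (auto intro: psd_entry_bound[OF X_psd])
qed simp

lemma integrable_tr: "integrable M (\<lambda>x. Re (tr (W \<odot> X x)))"
  unfolding tr_def mm_def by (intro integrable_Re Bochner_Integration.integrable_sum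
      integrable_mult_right integrable_entry)

lemma integral_tr: "(\<integral>x. Re (tr (W \<odot> X x)) \<partial>M) = Re (tr (W \<odot> mean_mat M X))"
proof -
  have i: "integrable M (\<lambda>x. W i k * X x k i)" for i k
    by (intro integrable_mult_right integrable_entry)
  have "(\<integral>x. Re (tr (W \<odot> X x)) \<partial>M) = Re (\<integral>x. (\<Sum>i\<in>S. \<Sum>k\<in>S. W i k * X x k i) \<partial>M)"
    unfolding tr_def mm_def by (intro integral_Re Bochner_Integration.integrable_sum i)
  also have "(\<integral>x. (\<Sum>i\<in>S. \<Sum>k\<in>S. W i k * X x k i) \<partial>M) = (\<Sum>i\<in>S. \<integral>x. (\<Sum>k\<in>S. W i k * X x k i) \<partial>M)"
    by (intro Bochner_Integration.integral_sum Bochner_Integration.integrable_sum i)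
  also have "\<dots> = (\<Sum>i\<in>S. \<Sum>k\<in>S. \<integral>x. W i k * X x k i \<partial>M)"
    by (intro sum.cong refl Bochner_Integration.integral_sum i)
  also have "\<dots> = tr (W \<odot> mean_mat M X)"
    by (simp add: tr_def mm_def mean_mat_def integrable_entry)
  finally show ?thesis .
qed

text \<open>A rank-one weight turns a quadratic form into a trace, so integrals of forms are covered
  by those of traces.\<close>

lemma qf_eq_tr: "qf P v = Re (tr ((\<lambda>i j. v i * cnj (v j)) \<odot> P))"
  unfolding qf_def ip_def mv_def tr_def mm_def sum_distrib_left
  by (subst sum.swap) (simp add: mult_ac)

lemma integrable_qf: "integrable M (\<lambda>x. qf (X x) v)"
  unfolding qf_eq_tr by (rule integrable_tr)

lemma integral_qf: "(\<integral>x. qf (X x) v \<partial>M) = qf (mean_mat M X) v"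
  unfolding qf_eq_tr by (rule integral_tr)

lemma psd_mean: "psd (mean_mat M X)"
  unfolding psd_def herm_def
proof (intro conjI allI)
  have s: "supported (X x)" and a: "cnj (X x j i) = X x i j" for x i j
    using X_psd[of x] by (auto simp: psd_def herm_def adj_mat_def fun_eq_iff)
  show "supported (mean_mat M X)" using s by (auto simp: supported_def mean_mat_def)
  show "adj_mat (mean_mat M X) = mean_mat M X"
  proof (intro ext)
    fix i j
    have "cnj (\<integral>x. X x j i \<partial>M) = (\<integral>x. cnj (X x j i) \<partial>M)" by (rule integral_bounded_linear[OF bounded_linear_cnj integrable_entry, symmetric])
    then show "adj_mat (mean_mat M X) i j = mean_mat M X i j"
      by (simp add: adj_mat_def mean_mat_def a)
  qed
  show "0 \<le> qf (mean_mat M X) v" for v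
    unfolding integral_qf[symmetric] using X_psd by (intro integral_nonneg_AE) (simp add: psd_def)
qed

text \<open>\<open>inv_trace_step\<close> gives an upper bound affine in \<open>X\<close>, whose
  expectation depends only on the mean. The tangent inequality for the increment \<open>c\<close>
  times the mean converts this value back into the potential.\<close>

lemma nn_integral_inv_trace_step:
  assumes H: "posdef \<tau> H" and q: "odd q" and c: "0 \<le> c" "c \<le> 1 - (real q + 1) * (r / \<tau>) / 2"
  shows "(\<integral>\<^sup>+x. inv_trace q (H + X x) \<partial>M) \<le> inv_trace q (H + c *\<^sub>m mean_mat M X)"
proof -
  let ?W = "mpow (minv H) (Suc q)"
  let ?g = "\<lambda>x. inv_trace q H - c * real q * Re (tr (?W \<odot> X x))"
  have le: "AE x in M. inv_trace q (H + X x) \<le> ?g x"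
    using X_le by eventually_elim (rule inv_trace_step[OF H X_psd r_nonneg _ q c(2)], simp)
  have "(\<integral>\<^sup>+x. inv_trace q (H + X x) \<partial>M) \<le> (\<integral>\<^sup>+x. ?g x \<partial>M)"
    by (rule nn_integral_mono_AE) (use le in \<open>eventually_elim, simp add: ennreal_leI\<close>)
  also have "\<dots> = ennreal (\<integral>x. ?g x \<partial>M)"
  proof (rule nn_integral_eq_integral)
    show "integrable M ?g" using integrable_tr by simp
    show "AE x in M. 0 \<le> ?g x"
      using le by eventually_elim (rule order_trans[OF inv_trace_nonneg[OF posdef_add[OF H X_psd]]])
  qed
  also have "(\<integral>x. ?g x \<partial>M) = inv_trace q H - c * real q * Re (tr (?W \<odot> mean_mat M X))"
    using integrable_tr by (simp add: prob_space integral_tr del: mpow.simps)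
  also have "\<dots> = inv_trace q H - real q * Re (tr (?W \<odot> (c *\<^sub>m mean_mat M X)))"
    by (simp add: mm_smult_right tr_smult del: mpow.simps)
  also have "ennreal \<dots> \<le> ennreal (inv_trace q (H + c *\<^sub>m mean_mat M X))"
    by (intro ennreal_leI inv_trace_convex[OF H psd_smult[OF psd_mean c(1)] q])
  finally show ?thesis .
qed

end

lemma psd_zero: "psd (\<lambda>i j. 0)"
  by (simp add: psd_def herm_def supported_def adj_mat_def qf_def mv_def ip_def)

lemma psd_sum:
  assumes "finite I" "\<And>l. l \<in> I \<Longrightarrow> psd (X l)"
  shows "psd (\<lambda>i j. \<Sum>l\<in>I. X l i j)"
  using assms
proof (induction I)
  case (insert l I)
  have "(\<lambda>i j. \<Sum>l\<in>insert l I. X l i j) = X l + (\<lambda>i j. \<Sum>l\<in>I. X l i j)"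
    using insert by (simp add: fun_eq_iff)
  then show ?case using insert by (simp add: psd_add)
qed (simp add: psd_zero)

text \<open>The random summands are replaced by multiples of their means one at a time.\<close>
lemma nn_integral_inv_trace:
  fixes F :: "'l \<Rightarrow> 'a measure" and X :: "'l \<Rightarrow> 'a \<Rightarrow> 'i cmat"
  assumes "finite I" and F: "\<And>l. prob_space (F l)"
    and meas: "\<And>l i j. l \<in> I \<Longrightarrow> (\<lambda>x. X l x i j) \<in> borel_measurable (F l)"
    and psd: "\<And>l x. l \<in> I \<Longrightarrow> psd (X l x)"
    and r: "0 \<le> r" "\<And>l. l \<in> I \<Longrightarrow> AE x in F l. \<forall>v. qf (X l x) v \<le> r * nsq v"
    and H: "posdef \<tau> H" and q: "odd q"
    and c: "0 \<le> c" "c \<le> 1 - (real q + 1) * (r / \<tau>) / 2"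
  shows "(\<integral>\<^sup>+x. inv_trace q (H + (\<lambda>i j. \<Sum>l\<in>I. X l (x l) i j)) \<partial>PiM I F)
    \<le> inv_trace q (H + c *\<^sub>m (\<lambda>i j. \<Sum>l\<in>I. mean_mat (F l) (X l) i j))"
  using assms(1,3,4,6,7)
proof (induction I arbitrary: H)
  case empty
  have "(\<lambda>i j. 0) = (0 :: 'i cmat)" "c *\<^sub>m 0 = (0 :: 'i cmat)"
    by (auto simp: fun_eq_iff smult_mat_def)
  then show ?case by (simp add: PiM_empty nn_integral_count_space_finite)
next
  case (insert l I)
  interpret product_prob_space F
    by (simp add: product_prob_space_def product_prob_space_axioms_def product_sigma_finite_def F prob_space_imp_sigma_finite)
  note [measurable] = insert.prems(1)
  let ?M = "mean_mat (F l) (X l)"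
  have pM: "psd ?M" by (rule psd_mean[OF F]) (use insert.prems r in auto)
  have m: "(\<lambda>x. X k (x k) i j) \<in> borel_measurable (PiM (insert l I) F)" if "k \<in> insert l I" for k i j
    using that by measurable
  have fm: "(\<lambda>x. ennreal (inv_trace q (H + (\<lambda>i j. \<Sum>l\<in>insert l I. X l (x l) i j))))
      \<in> borel_measurable (PiM (insert l I) F)"
    by (intro measurable_compose[OF measurable_inv_trace measurable_ennreal])
      (unfold plus_fun_apply, intro borel_measurable_add borel_measurable_sum m, auto)
  have "(\<integral>\<^sup>+x. inv_trace q (H + (\<lambda>i j. \<Sum>l\<in>insert l I. X l (x l) i j)) \<partial>PiM (insert l I) F)
      = (\<integral>\<^sup>+x. \<integral>\<^sup>+y. inv_trace q (H + (\<lambda>i j. \<Sum>k\<in>insert l I. X k ((x(l := y)) k) i j)) \<partial>F l \<partial>PiM I F)"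
    by (rule product_nn_integral_insert[OF insert(1,2) fm])
  also have "\<dots> = (\<integral>\<^sup>+x. \<integral>\<^sup>+y. inv_trace q (H + (\<lambda>i j. \<Sum>k\<in>I. X k (x k) i j) + X l y) \<partial>F l \<partial>PiM I F)"
  proof -
    have eq: "H + (\<lambda>i j. \<Sum>k\<in>insert l I. X k ((x(l := y)) k) i j)
        = H + (\<lambda>i j. \<Sum>k\<in>I. X k (x k) i j) + X l y" for x y
    proof (intro ext)
      fix i j
      have "(\<Sum>k\<in>I. X k ((x(l := y)) k) i j) = (\<Sum>k\<in>I. X k (x k) i j)"
        using insert(2) by (intro sum.cong) auto
      then show "(H + (\<lambda>i j. \<Sum>k\<in>insert l I. X k ((x(l := y)) k) i j)) i j
        = (H + (\<lambda>i j. \<Sum>k\<in>I. X k (x k) i j) + X l y) i j"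
        using insert(1,2) by simp
    qed
    show ?thesis by (simp only: eq)
  qed
  also have "\<dots> \<le> (\<integral>\<^sup>+x. inv_trace q (H + (\<lambda>i j. \<Sum>k\<in>I. X k (x k) i j) + c *\<^sub>m ?M) \<partial>PiM I F)"
  proof (intro nn_integral_mono)
    fix x
    have "psd (\<lambda>i j. \<Sum>k\<in>I. X k (x k) i j)" using insert by (intro psd_sum) auto
    then show "(\<integral>\<^sup>+y. inv_trace q (H + (\<lambda>i j. \<Sum>k\<in>I. X k (x k) i j) + X l y) \<partial>F l)
      \<le> inv_trace q (H + (\<lambda>i j. \<Sum>k\<in>I. X k (x k) i j) + c *\<^sub>m ?M)"
      using insert.prems posdef_add q c r
      by (intro nn_integral_inv_trace_step[where r = r, OF F]) auto
  qed
  \<comment> \<open>The replaced mean moves into the starting matrix, for which the induction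
    hypothesis is general.\<close>
  also have "\<dots> = (\<integral>\<^sup>+x. inv_trace q ((H + c *\<^sub>m ?M) + (\<lambda>i j. \<Sum>k\<in>I. X k (x k) i j)) \<partial>PiM I F)"
    by (simp add: add_ac)
  also have "\<dots> \<le> inv_trace q ((H + c *\<^sub>m ?M) + c *\<^sub>m (\<lambda>i j. \<Sum>k\<in>I. mean_mat (F k) (X k) i j))"
    using insert.prems pM c by (intro insert.IH posdef_add psd_smult) auto
  also have "(H + c *\<^sub>m ?M) + c *\<^sub>m (\<lambda>i j. \<Sum>k\<in>I. mean_mat (F k) (X k) i j)
      = H + c *\<^sub>m (\<lambda>i j. \<Sum>k\<in>insert l I. mean_mat (F k) (X k) i j)"
    using insert(1,2) by (simp add: fun_eq_iff smult_mat_def ring_distribs)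
  finally show ?case .
qed

lemma inv_trace_scalar:
  assumes "0 < a" shows "inv_trace q (a *\<^sub>m id_mat) = real (card S) / a ^ q"
proof -
  have "inverse_of (a *\<^sub>m id_mat) ((1 / a) *\<^sub>m id_mat)"
    using assms by (simp add: inverse_of_def supported_smult mm_smult_left mm_smult_right mm_id_left)
      (simp add: smult_mat_def)
  moreover have "posdef a (a *\<^sub>m id_mat)"
    using assms by (simp add: posdef_def herm_def supported_smult adj_mat_smult qf_smult qf_id)
  ultimately have minv: "minv (a *\<^sub>m id_mat) = (1 / a) *\<^sub>m id_mat"
    using inverse_of_unique posdef_inverse by blast
  have "mpow ((1 / a) *\<^sub>m id_mat) q = (1 / a ^ q) *\<^sub>m id_mat"
    by (induction q) (simp_all add: mm_smult_left mm_smult_right mm_id_left, simp_all add: smult_mat_def mult_ac)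
  then show ?thesis
    by (simp add: inv_trace_def minv tr_smult) (simp add: tr_def id_mat_def)
qed

text \<open>Markov's inequality at level 1. As the means add up to the identity, the matrix left
  after all replacements is the scalar \<open>\<tau> + c\<close>, and the dimension enters only
  through the factor \<open>card S\<close>.\<close>

lemma prob_inv_trace_ge_1:
  fixes F :: "'l \<Rightarrow> 'a measure" and X :: "'l \<Rightarrow> 'a \<Rightarrow> 'i cmat"
  assumes "finite I" and F: "\<And>l. prob_space (F l)"
    and meas: "\<And>l i j. l \<in> I \<Longrightarrow> (\<lambda>x. X l x i j) \<in> borel_measurable (F l)"
    and psd: "\<And>l x. l \<in> I \<Longrightarrow> psd (X l x)"
    and r: "0 \<le> r" "\<And>l. l \<in> I \<Longrightarrow> AE x in F l. \<forall>v. qf (X l x) v \<le> r * nsq v"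
    and mean: "(\<lambda>i j. \<Sum>l\<in>I. mean_mat (F l) (X l) i j) = id_mat"
    and \<tau>: "0 < \<tau>" and q: "odd q"
    and c: "0 \<le> c" "c \<le> 1 - (real q + 1) * (r / \<tau>) / 2"
  shows "measure (PiM I F)
      {x\<in>space (PiM I F). 1 \<le> inv_trace q (\<tau> *\<^sub>m id_mat + (\<lambda>i j. \<Sum>l\<in>I. X l (x l) i j))}
    \<le> real (card S) / (\<tau> + c) ^ q"
proof -
  interpret product_prob_space F
    by (simp add: product_prob_space_def product_prob_space_axioms_def product_sigma_finite_def F prob_space_imp_sigma_finite)
  interpret P: prob_space "PiM I F" by (rule prob_space_PiM[OF F])
  note [measurable] = meas
  have H: "posdef \<tau> (\<tau> *\<^sub>m id_mat)"
    using \<tau> by (simp add: posdef_def herm_def supported_smult adj_mat_smult qf_smult qf_id)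
  let ?f = "\<lambda>x. inv_trace q (\<tau> *\<^sub>m id_mat + (\<lambda>i j. \<Sum>l\<in>I. X l (x l) i j))"
  have m: "(\<lambda>x. X k (x k) i j) \<in> borel_measurable (PiM I F)" if "k \<in> I" for k i j
    using that by measurable
  have [measurable]: "?f \<in> borel_measurable (PiM I F)"
    by (intro measurable_inv_trace)
      (unfold plus_fun_apply, intro borel_measurable_add borel_measurable_sum m, auto)
  have "emeasure (PiM I F) {x\<in>space (PiM I F). 1 \<le> ?f x}
      = emeasure (PiM I F) {x\<in>space (PiM I F). 1 \<le> 1 * ennreal (?f x)}"
    by (auto intro!: arg_cong[where f = "emeasure _"] simp: ennreal_ge_1)
  also have "\<dots> \<le> 1 * (\<integral>\<^sup>+x. ennreal (?f x) * indicator (space (PiM I F)) x \<partial>PiM I F)"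
    by (rule nn_integral_Markov_inequality) auto
  also have "\<dots> = (\<integral>\<^sup>+x. ?f x \<partial>PiM I F)" by (auto intro!: nn_integral_cong)
  also have "\<dots> \<le> inv_trace q (\<tau> *\<^sub>m id_mat + c *\<^sub>m (\<lambda>i j. \<Sum>l\<in>I. mean_mat (F l) (X l) i j))"
    by (rule nn_integral_inv_trace[OF assms(1-6) H q c])
  also have "\<tau> *\<^sub>m id_mat + c *\<^sub>m (\<lambda>i j. \<Sum>l\<in>I. mean_mat (F l) (X l) i j) = (\<tau> + c) *\<^sub>m id_mat"
    unfolding mean by (simp add: fun_eq_iff smult_mat_def ring_distribs)
  also have "inv_trace q \<dots> = real (card S) / (\<tau> + c) ^ q"
    using \<tau> c by (intro inv_trace_scalar) simp
  finally show ?thesis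
    using \<tau> c by (simp add: P.emeasure_eq_measure plus_fun_def)
qed

end

section \<open>A vector Bernstein inequality with weak variance\<close>

lemma exp_le_quadratic:
  fixes x :: real assumes "x \<le> 1" shows "exp x \<le> 1 + x + x\<^sup>2"
proof (cases "0 \<le> x")
  case True
  then show ?thesis using assms exp_bound by blast
next
  case False
  define y where "y = - x"
  have y: "0 \<le> y" using False by (simp add: y_def)
  have "1 + y + y\<^sup>2 / 2 \<le> exp y" by (rule exp_lower_Taylor_quadratic[OF y])
  \<comment> \<open>For negative \<open>x = - y\<close> the claim is a lower bound for
    \<open>exp y\<close> by a reciprocal; multiplying out against the Taylor polynomial leaves 1
    plus nonnegative terms.\<close>
  moreover have "1 \<le> (1 - y + y\<^sup>2) * (1 + y + y\<^sup>2 / 2)"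
  proof -
    have "(1 - y + y\<^sup>2) * (1 + y + y\<^sup>2 / 2) = 1 + (y\<^sup>2 + y ^ 3 + y ^ 4) / 2"
      by (simp add: power2_eq_square power3_eq_cube power4_eq_xxxx field_simps)
    then show ?thesis using y by simp
  qed
  moreover have "0 \<le> 1 - y + y\<^sup>2"
  proof -
    have "1 - y + y\<^sup>2 = (1 - y / 2)\<^sup>2 + 3 / 4 * y\<^sup>2" by (simp add: power2_eq_square field_simps)
    then show ?thesis by simp
  qed
  ultimately have "1 \<le> (1 - y + y\<^sup>2) * exp y"
    by (meson mult_left_mono order_trans)
  then have "exp (- y) \<le> 1 - y + y\<^sup>2" by (simp add: exp_minus field_simps)
  then show ?thesis by (simp add: y_def)
qed

section \<open>Gaussian measures and exponential tilting\<close>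

definition gauss :: "real \<Rightarrow> real measure" where
  "gauss s = density lborel (normal_density 0 s)"

lemma sets_gauss [simp, measurable_cong]: "sets (gauss s) = sets borel"
  and space_gauss [simp]: "space (gauss s) = UNIV"
  by (simp_all add: gauss_def)

lemma prob_space_gauss: "0 < s \<Longrightarrow> prob_space (gauss s)"
  unfolding gauss_def by (rule prob_space_normal_density)

text \<open>Completing the square: an exponential weight moves the centre of a Gaussian and keeps
  its variance, which reduces weighted moments to ordinary ones.\<close>

lemma normal_density_tilt:
  assumes "0 < s"
  shows "normal_density 0 s x * exp (a * x) = exp (a\<^sup>2 * s\<^sup>2 / 2) * normal_density (a * s\<^sup>2) s x"
proof -
  have "- x\<^sup>2 / (2 * s\<^sup>2) + a * x = a\<^sup>2 * s\<^sup>2 / 2 + - (x - a * s\<^sup>2)\<^sup>2 / (2 * s\<^sup>2)"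
    using assms by (simp add: field_simps power2_eq_square)
  then show ?thesis
    unfolding normal_density_def by (simp add: exp_add[symmetric] mult_ac)
qed

lemma integrable_gauss_exp:
  assumes "0 < s"
  shows "integrable (gauss s) (\<lambda>x. exp (a * x))"
    "integrable (gauss s) (\<lambda>x. x * exp (a * x))"
    "(\<integral>x. exp (a * x) \<partial>gauss s) = exp (a\<^sup>2 * s\<^sup>2 / 2)"
    "(\<integral>x. x * exp (a * x) \<partial>gauss s) = a * s\<^sup>2 * exp (a\<^sup>2 * s\<^sup>2 / 2)"
proof -
  have 1: "normal_density 0 s x *\<^sub>R exp (a * x) = exp (a\<^sup>2 * s\<^sup>2 / 2) * normal_density (a * s\<^sup>2) s x" for x
    using normal_density_tilt[OF assms] by simp
  have 2: "normal_density 0 s x *\<^sub>R (x * exp (a * x)) = exp (a\<^sup>2 * s\<^sup>2 / 2) * (normal_density (a * s\<^sup>2) s x * x)" for x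
    using normal_density_tilt[OF assms, of x a] by (simp add: mult_ac)
  show "integrable (gauss s) (\<lambda>x. exp (a * x))" "integrable (gauss s) (\<lambda>x. x * exp (a * x))"
    unfolding gauss_def using assms
    by (subst integrable_density; (simp add: 1 2 integrable_normal_moment_nz_1 del: real_scaleR_def)?)+
  show "(\<integral>x. exp (a * x) \<partial>gauss s) = exp (a\<^sup>2 * s\<^sup>2 / 2)"
    unfolding gauss_def using assms
    by (subst integral_density) (simp_all add: 1 del: real_scaleR_def)
  have "(\<integral>x. normal_density (a * s\<^sup>2) s x * x \<partial>lborel) = a * s\<^sup>2"
    using normal_moment_nz_1[OF assms] by (simp add: has_bochner_integral_iff)
  then show "(\<integral>x. x * exp (a * x) \<partial>gauss s) = a * s\<^sup>2 * exp (a\<^sup>2 * s\<^sup>2 / 2)"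
    unfolding gauss_def using assms
    by (subst integral_density) (simp_all add: 2 del: real_scaleR_def)
qed

locale gaussian_prior =
  fixes T :: "'t set" and s :: real
  assumes finite_T: "finite T" and s_pos: "0 < s"
begin

definition dot :: "('t \<Rightarrow> real) \<Rightarrow> ('t \<Rightarrow> real) \<Rightarrow> real" where
  "dot u v = (\<Sum>t\<in>T. u t * v t)"

abbreviation "\<gamma> \<equiv> PiM T (\<lambda>_. gauss s)"

sublocale G: product_prob_space "\<lambda>_. gauss s" T
  using prob_space_gauss[OF s_pos]
  by (simp add: product_prob_space_def product_prob_space_axioms_def product_sigma_finite_def
      prob_space_imp_sigma_finite)

lemma measurable_dot:
  assumes "\<And>t. t \<in> T \<Longrightarrow> (\<lambda>x. f x t) \<in> borel_measurable M" "\<And>t. t \<in> T \<Longrightarrow> (\<lambda>x. g x t) \<in> borel_measurable M"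
  shows "(\<lambda>x. dot (f x) (g x)) \<in> borel_measurable M"
  unfolding dot_def using assms by measurable

lemma measurable_dot_\<gamma> [measurable]: "(\<lambda>g. dot a g) \<in> borel_measurable \<gamma>"
  by (rule measurable_dot) auto

lemma exp_dot: "exp (dot a g) = (\<Prod>t\<in>T. exp (a t * g t))"
  by (simp add: dot_def exp_sum finite_T)

lemma integrable_exp_dot: "integrable \<gamma> (\<lambda>g. exp (dot a g))"
  unfolding exp_dot
  by (rule G.product_integrable_prod) (simp_all add: finite_T integrable_gauss_exp[OF s_pos])

lemma integral_exp_dot: "(\<integral>g. exp (dot a g) \<partial>\<gamma>) = exp (s\<^sup>2 * dot a a / 2)"
proof -
  have "(\<integral>g. exp (dot a g) \<partial>\<gamma>) = (\<Prod>t\<in>T. exp ((a t)\<^sup>2 * s\<^sup>2 / 2))"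
    unfolding exp_dot
    by (subst G.product_integral_prod) (simp_all add: finite_T integrable_gauss_exp[OF s_pos])
  also have "\<dots> = exp (s\<^sup>2 * dot a a / 2)"
    by (simp add: exp_sum[symmetric] finite_T dot_def sum_distrib_left sum_divide_distrib
        power2_eq_square mult_ac)
  finally show ?thesis .
qed

lemma exp_dot_coord:
  assumes "k \<in> T"
  shows "integrable \<gamma> (\<lambda>g. exp (dot a g) * g k)"
    and "(\<integral>g. exp (dot a g) * g k \<partial>\<gamma>) = s\<^sup>2 * a k * exp (s\<^sup>2 * dot a a / 2)"
proof -
  define f where "f t x = (if t = k then x * exp (a t * x) else exp (a t * x))" for t and x :: real
  have i: "integrable (gauss s) (f t)" for t
    unfolding f_def by (cases "t = k") (simp_all add: integrable_gauss_exp[OF s_pos])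
  have v: "integral\<^sup>L (gauss s) (f t) = (if t = k then a t * s\<^sup>2 else 1) * exp ((a t)\<^sup>2 * s\<^sup>2 / 2)" for t
    unfolding f_def by (cases "t = k") (simp_all add: integrable_gauss_exp[OF s_pos])
  have eq: "exp (dot a g) * g k = (\<Prod>t\<in>T. f t (g t))" for g
  proof -
    have "(\<Prod>t\<in>T. f t (g t)) = (\<Prod>t\<in>T. (if t = k then g t else 1) * exp (a t * g t))"
      by (intro prod.cong) (auto simp: f_def)
    also have "\<dots> = g k * exp (dot a g)"
      using assms by (simp add: prod.distrib finite_T exp_dot)
    finally show ?thesis by simp
  qed
  show "integrable \<gamma> (\<lambda>g. exp (dot a g) * g k)"
    unfolding eq by (rule G.product_integrable_prod) (simp_all add: finite_T i)
  have "(\<integral>g. exp (dot a g) * g k \<partial>\<gamma>) = (\<Prod>t\<in>T. (if t = k then a t * s\<^sup>2 else 1) * exp ((a t)\<^sup>2 * s\<^sup>2 / 2))"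
    unfolding eq by (subst G.product_integral_prod) (simp_all add: finite_T i v)
  also have "\<dots> = a k * s\<^sup>2 * (\<Prod>t\<in>T. exp ((a t)\<^sup>2 * s\<^sup>2 / 2))"
    using assms by (simp add: prod.distrib finite_T)
  also have "(\<Prod>t\<in>T. exp ((a t)\<^sup>2 * s\<^sup>2 / 2)) = exp (s\<^sup>2 * dot a a / 2)"
    by (simp add: exp_sum[symmetric] finite_T dot_def sum_distrib_left sum_divide_distrib power2_eq_square mult_ac)
  finally show "(\<integral>g. exp (dot a g) * g k \<partial>\<gamma>) = s\<^sup>2 * a k * exp (s\<^sup>2 * dot a a / 2)" by simp
qed

lemma exp_dot_dot:
  shows "integrable \<gamma> (\<lambda>g. exp (dot a g) * dot b g)"
    and "(\<integral>g. exp (dot a g) * dot b g \<partial>\<gamma>) = s\<^sup>2 * dot b a * exp (s\<^sup>2 * dot a a / 2)"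
proof -
  have eq: "exp (dot a g) * dot b g = (\<Sum>k\<in>T. b k * (exp (dot a g) * g k))" for g
    by (simp add: dot_def[of b] sum_distrib_left mult_ac)
  show "integrable \<gamma> (\<lambda>g. exp (dot a g) * dot b g)"
    unfolding eq by (intro Bochner_Integration.integrable_sum integrable_mult_right exp_dot_coord)
  have "(\<integral>g. exp (dot a g) * dot b g \<partial>\<gamma>) = (\<Sum>k\<in>T. \<integral>g. b k * (exp (dot a g) * g k) \<partial>\<gamma>)"
    unfolding eq by (intro Bochner_Integration.integral_sum integrable_mult_right exp_dot_coord)
  also have "\<dots> = s\<^sup>2 * dot b a * exp (s\<^sup>2 * dot a a / 2)"
    by (simp add: exp_dot_coord, simp add: dot_def[of b] sum_distrib_left sum_distrib_right mult_ac)
  finally show "(\<integral>g. exp (dot a g) * dot b g \<partial>\<gamma>) = s\<^sup>2 * dot b a * exp (s\<^sup>2 * dot a a / 2)" .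
qed

text \<open>Density of the Gaussian centred at \<open>u\<close> with respect to the prior.\<close>
definition tilt :: "('t \<Rightarrow> real) \<Rightarrow> ('t \<Rightarrow> real) \<Rightarrow> real" where
  "tilt u g = exp (dot u g / s\<^sup>2 - dot u u / (2 * s\<^sup>2))"

lemma tilt_eq: "tilt u g = exp (dot (\<lambda>t. u t / s\<^sup>2) g) * exp (- dot u u / (2 * s\<^sup>2))"
proof -
  have "dot (\<lambda>t. u t / s\<^sup>2) g = dot u g / s\<^sup>2" by (simp add: dot_def sum_divide_distrib)
  then show ?thesis by (simp add: tilt_def exp_diff exp_minus field_simps)
qed

lemma tilt_pos: "0 < tilt u g" by (simp add: tilt_def)

lemma measurable_tilt [measurable]: "tilt u \<in> borel_measurable \<gamma>"
  unfolding tilt_def by measurable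

lemma tilt_norm: "s\<^sup>2 * dot (\<lambda>t. u t / s\<^sup>2) (\<lambda>t. u t / s\<^sup>2) / 2 = dot u u / (2 * s\<^sup>2)"
  using s_pos by (simp add: dot_def sum_distrib_left sum_divide_distrib power2_eq_square field_simps)

lemma integrable_tilt: "integrable \<gamma> (tilt u)" and integral_tilt: "integral\<^sup>L \<gamma> (tilt u) = 1"
  unfolding tilt_eq[abs_def]
  by (simp_all add: integrable_exp_dot integral_exp_dot tilt_norm) (simp flip: exp_add)

lemma integrable_tilt_dot: "integrable \<gamma> (\<lambda>g. tilt u g * dot b g)"
  and integral_tilt_dot: "(\<integral>g. tilt u g * dot b g \<partial>\<gamma>) = dot b u"
proof -
  have eq: "tilt u g * dot b g = exp (- dot u u / (2 * s\<^sup>2)) * (exp (dot (\<lambda>t. u t / s\<^sup>2) g) * dot b g)" for g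
    by (simp add: tilt_eq mult_ac)
  show "integrable \<gamma> (\<lambda>g. tilt u g * dot b g)"
    unfolding eq by (intro integrable_mult_right exp_dot_dot)
  have "s\<^sup>2 * dot b (\<lambda>t. u t / s\<^sup>2) = dot b u"
    using s_pos by (simp add: dot_def sum_distrib_left)
  then show "(\<integral>g. tilt u g * dot b g \<partial>\<gamma>) = dot b u"
    unfolding eq by (simp add: exp_dot_dot tilt_norm) (simp add: mult.assoc flip: exp_add)
qed

lemma nn_integral_tilt_exp:
  "(\<integral>\<^sup>+g. tilt u g * exp (dot y g) \<partial>\<gamma>) = exp (dot u y + s\<^sup>2 * dot y y / 2)"
proof -
  have eq: "tilt u g * exp (dot y g) = exp (dot (\<lambda>t. u t / s\<^sup>2 + y t) g) * exp (- dot u u / (2 * s\<^sup>2))" for g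
    unfolding tilt_eq by (simp add: dot_def ring_distribs sum.distrib exp_add)
  have "(\<integral>\<^sup>+g. tilt u g * exp (dot y g) \<partial>\<gamma>) = ennreal (\<integral>g. tilt u g * exp (dot y g) \<partial>\<gamma>)"
    unfolding eq by (intro nn_integral_eq_integral integrable_mult_left integrable_exp_dot) auto
  also have "(\<integral>g. tilt u g * exp (dot y g) \<partial>\<gamma>)
      = exp (s\<^sup>2 * dot (\<lambda>t. u t / s\<^sup>2 + y t) (\<lambda>t. u t / s\<^sup>2 + y t) / 2 - dot u u / (2 * s\<^sup>2))"
    unfolding eq by (simp add: integral_exp_dot) (simp flip: exp_add)
  also have "s\<^sup>2 * dot (\<lambda>t. u t / s\<^sup>2 + y t) (\<lambda>t. u t / s\<^sup>2 + y t) / 2 - dot u u / (2 * s\<^sup>2)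
      = dot u y + s\<^sup>2 * dot y y / 2"
  proof -
    have eq: "dot (\<lambda>t. u t / s\<^sup>2 + y t) (\<lambda>t. u t / s\<^sup>2 + y t)
        = dot u u / (s\<^sup>2 * s\<^sup>2) + 2 * dot u y / s\<^sup>2 + dot y y"
      unfolding dot_def sum_divide_distrib sum_distrib_left sum.distrib[symmetric]
      using s_pos by (intro sum.cong) (auto simp: field_simps)
    show ?thesis unfolding eq using s_pos by (simp add: field_simps)
  qed
  finally show ?thesis .
qed

text \<open>The Donsker--Varadhan bound for the tilted measure, from \<open>exp x \<ge> 1 + x\<close>.\<close>
lemma nn_integral_exp_ge_tilt:
  assumes [measurable]: "\<Psi> \<in> borel_measurable \<gamma>"
    and int: "integrable \<gamma> (\<lambda>g. tilt u g * \<Psi> g)"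
    and B: "(\<integral>g. tilt u g * \<Psi> g \<partial>\<gamma>) \<le> B"
  shows "ennreal (exp (dot z u - B - dot u u / (2 * s\<^sup>2))) \<le> (\<integral>\<^sup>+g. exp (dot z g - \<Psi> g) \<partial>\<gamma>)"
proof -
  define m where "m = dot z u - (\<integral>g. tilt u g * \<Psi> g \<partial>\<gamma>) - dot u u / (2 * s\<^sup>2)"
  \<comment> \<open>This is \<open>tilt u g\<close> times the tangent of \<open>exp\<close> at
    \<open>m\<close>, evaluated at the exponent minus the logarithm of the tilt. As \<open>m\<close>
    is the tilted mean of that quantity, the linear part integrates to zero and exactly
    \<open>exp m\<close> remains.\<close>
  define R where "R g = exp m * ((1 - m + dot u u / (2 * s\<^sup>2)) * tilt u g + tilt u g * dot z g
      - tilt u g * \<Psi> g - (1 / s\<^sup>2) * (tilt u g * dot u g))" for g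
  have R_le: "R g \<le> exp (dot z g - \<Psi> g)" for g
  proof -
    let ?l = "dot u g / s\<^sup>2 - dot u u / (2 * s\<^sup>2)"
    let ?y = "dot z g - \<Psi> g - ?l - m"
    have "R g = exp ?l * exp m * (1 + ?y)"
      by (simp add: R_def tilt_def algebra_simps)
    also have "\<dots> \<le> exp ?l * exp m * exp ?y" by (intro mult_left_mono exp_ge_add_one_self) auto
    also have "\<dots> = exp (dot z g - \<Psi> g)" by (simp flip: exp_add)
    finally show ?thesis .
  qed
  have iR: "integrable \<gamma> R"
    unfolding R_def by (intro integrable_mult_right Bochner_Integration.integrable_diff
        Bochner_Integration.integrable_add integrable_tilt integrable_tilt_dot int)
  have "(\<integral>g. R g \<partial>\<gamma>) = exp m * (1 - m + dot u u / (2 * s\<^sup>2) + dot z u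
      - (\<integral>g. tilt u g * \<Psi> g \<partial>\<gamma>) - dot u u / s\<^sup>2)"
    unfolding R_def using integrable_tilt integrable_tilt_dot int
    by (simp add: integral_tilt integral_tilt_dot)
  also have "\<dots> = exp m" using s_pos by (simp add: m_def field_simps)
  finally have IR: "(\<integral>g. R g \<partial>\<gamma>) = exp m" .
  have "ennreal (exp (dot z u - B - dot u u / (2 * s\<^sup>2))) \<le> ennreal (exp m)"
    using B by (simp add: m_def)
  also have "\<dots> = ennreal (\<integral>g. R g \<partial>\<gamma>)" by (simp add: IR)
  \<comment> \<open>\<open>R\<close> may be negative, so its positive part carries the bound over to
    the nonnegative integral.\<close>
  also have "\<dots> \<le> ennreal (\<integral>g. max 0 (R g) \<partial>\<gamma>)"
    using iR by (intro ennreal_leI integral_mono integrable_max) auto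
  also have "\<dots> = (\<integral>\<^sup>+g. max 0 (R g) \<partial>\<gamma>)"
    using iR by (intro nn_integral_eq_integral[symmetric] integrable_max) auto
  also have "\<dots> \<le> (\<integral>\<^sup>+g. exp (dot z g - \<Psi> g) \<partial>\<gamma>)"
    using R_le by (intro nn_integral_mono ennreal_leI) simp
  finally show ?thesis .
qed

lemma dot_square_le: "(dot u v)\<^sup>2 \<le> dot u u * dot v v"
  unfolding dot_def using Cauchy_Schwarz_ineq_sum[of u v T] by (simp add: power2_eq_square)

lemma dot_self_nonneg: "0 \<le> dot u u"
  by (simp add: dot_def sum_nonneg)

text \<open>Averaging over the prior controls one exponential moment for all directions together.
  For an outcome with large \<open>Z\<close> the prior is recentred at the vector of length
  \<open>\<theta>\<close> along \<open>Z\<close>, so neither a union over directions nor the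
  dimension appears. The exponent consists of the gain \<open>\<theta> * r\<close>, the relative
  entropy of the shift, the total variance \<open>V\<close> seen by the Gaussian fluctuation, and
  the weak variance \<open>\<sigma>2\<close> seen by the centre.\<close>

theorem vector_Bernstein:
  fixes F :: "'l \<Rightarrow> 'a measure" and Y :: "'l \<Rightarrow> 'a \<Rightarrow> 't \<Rightarrow> real"
  assumes I: "finite I" and F: "\<And>l. prob_space (F l)"
    and meas: "\<And>l t. l \<in> I \<Longrightarrow> t \<in> T \<Longrightarrow> (\<lambda>x. Y l x t) \<in> borel_measurable (F l)"
    and bounded: "\<And>l. l \<in> I \<Longrightarrow> AE x in F l. dot (Y l x) (Y l x) \<le> K\<^sup>2"
    and centered: "\<And>l t. l \<in> I \<Longrightarrow> t \<in> T \<Longrightarrow> (\<integral>x. Y l x t \<partial>F l) = \<mu> l t"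
      "\<And>t. t \<in> T \<Longrightarrow> (\<Sum>l\<in>I. \<mu> l t) = 0"
    and V: "(\<Sum>l\<in>I. \<integral>x. dot (Y l x) (Y l x) \<partial>F l) \<le> V"
    and weak: "\<And>u. (\<Sum>l\<in>I. \<integral>x. (dot u (Y l x))\<^sup>2 \<partial>F l) \<le> \<sigma>2 * dot u u"
    and K: "0 \<le> K" and small: "\<theta> * K + s\<^sup>2 * K\<^sup>2 / 2 \<le> 1" and \<theta>: "0 < \<theta>" and r: "0 < r"
  defines "Z \<equiv> \<lambda>x t. \<Sum>l\<in>I. Y l (x l) t"
  shows "measure (PiM I F) {x\<in>space (PiM I F). r\<^sup>2 \<le> dot (Z x) (Z x)}
    \<le> exp (- \<theta> * r + \<theta>\<^sup>2 / (2 * s\<^sup>2) + s\<^sup>2 * V / 2 * (1 + s\<^sup>2 * K\<^sup>2) + 2 * \<sigma>2 * \<theta>\<^sup>2)"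
proof -
  interpret F: product_prob_space F I
    by (simp add: product_prob_space_def product_prob_space_axioms_def product_sigma_finite_def
        F prob_space_imp_sigma_finite)
  interpret GP: pair_prob_space \<gamma> "PiM I F" ..
  note [measurable] = meas
  have mY: "(\<lambda>x. dot (f x) (Y l (h x))) \<in> borel_measurable M"
    if "l \<in> I" "h \<in> measurable M (F l)" "\<And>t. t \<in> T \<Longrightarrow> (\<lambda>x. f x t) \<in> borel_measurable M"
    for f :: "'b \<Rightarrow> 't \<Rightarrow> real" and h M l
    using that by (intro measurable_dot) (auto intro: measurable_compose[OF that(2) meas])
  have mZ: "(\<lambda>x. Z x t) \<in> borel_measurable (PiM I F)" if "t \<in> T" for t
    unfolding Z_def using that by measurable
  define \<phi> where "\<phi> l g = (\<integral>x. exp (dot g (Y l x)) \<partial>F l)" for l g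
  have dot_le: "AE x in F l. \<bar>dot u (Y l x)\<bar> \<le> sqrt (dot u u) * K" if l: "l \<in> I" for u l
    using bounded[OF l]
  proof eventually_elim
    case (elim x)
    have "(dot u (Y l x))\<^sup>2 \<le> dot u u * K\<^sup>2"
      using dot_square_le[of u "Y l x"] mult_left_mono[OF elim dot_self_nonneg[of u]] by linarith
    then have "sqrt ((dot u (Y l x))\<^sup>2) \<le> sqrt (dot u u * K\<^sup>2)" by (rule real_sqrt_le_mono)
    then show ?case using K by (simp add: real_sqrt_mult)
  qed
  have int_dot: "integrable (F l) (\<lambda>x. dot u (Y l x))"
    and int_exp: "integrable (F l) (\<lambda>x. exp (dot u (Y l x)))"
    and int_sq: "integrable (F l) (\<lambda>x. (dot u (Y l x))\<^sup>2)" if l: "l \<in> I" for u l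
  proof -
    have [measurable]: "(\<lambda>x. dot u (Y l x)) \<in> borel_measurable (F l)"
      by (rule mY[OF l]) auto
    show "integrable (F l) (\<lambda>x. dot u (Y l x))"
      by (rule F.M.integrable_const_bound[where B = "sqrt (dot u u) * K"]) (use dot_le[OF l] in auto)
    show "integrable (F l) (\<lambda>x. exp (dot u (Y l x)))"
      by (rule F.M.integrable_const_bound[where B = "exp (sqrt (dot u u) * K)"])
        (use dot_le[OF l, of u] in auto)
    have "AE x in F l. norm ((dot u (Y l x))\<^sup>2) \<le> (sqrt (dot u u) * K)\<^sup>2"
      using dot_le[OF l, of u] by eventually_elim (simp add: abs_le_square_iff[symmetric] abs_le_iff)
    then show "integrable (F l) (\<lambda>x. (dot u (Y l x))\<^sup>2)"
      by (rule F.M.integrable_const_bound) simp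
  qed
  have int_self: "integrable (F l) (\<lambda>x. dot (Y l x) (Y l x))" if l: "l \<in> I" for l
  proof -
    show ?thesis
      by (rule F.M.integrable_const_bound[where B = "K\<^sup>2"])
        (use bounded[OF l] l in \<open>auto simp: dot_self_nonneg intro!: measurable_dot meas\<close>)
  qed
  have \<phi>_nn: "ennreal (\<phi> l g) = (\<integral>\<^sup>+x. exp (dot g (Y l x)) \<partial>F l)" if "l \<in> I" for l g
    unfolding \<phi>_def using int_exp[OF that] by (intro nn_integral_eq_integral[symmetric]) auto
  have \<phi>_nonneg: "0 \<le> \<phi> l g" for l g unfolding \<phi>_def by (intro integral_nonneg_AE) auto
  have [measurable]: "\<phi> l \<in> borel_measurable \<gamma>" if l: "l \<in> I" for l
  proof -
    show ?thesis unfolding \<phi>_def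
    proof (rule F.M.borel_measurable_lebesgue_integral)
      have "(\<lambda>p. exp (dot (fst p) (Y l (snd p)))) \<in> borel_measurable (\<gamma> \<Otimes>\<^sub>M F l)"
        by (intro measurable_compose[OF mY[OF l] borel_measurable_exp]) auto
      then show "(\<lambda>(g, x). exp (dot g (Y l x))) \<in> borel_measurable (\<gamma> \<Otimes>\<^sub>M F l)"
        by (simp add: case_prod_beta')
    qed
  qed
  \<comment> \<open>Taking \<open>\<phi> l g - 1\<close> in place of its logarithm weakens the
    moment bound slightly but keeps \<open>\<Psi>\<close> linear in the \<open>\<phi> l\<close>, so
    its tilted mean can be computed by Fubini.\<close>
  define \<Psi> where "\<Psi> g = (\<Sum>l\<in>I. \<phi> l g - 1)" for g
  have [measurable]: "\<Psi> \<in> borel_measurable \<gamma>"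
    unfolding \<Psi>_def by (intro borel_measurable_sum borel_measurable_diff) auto
  have dotZ: "dot g (Z x) = (\<Sum>l\<in>I. dot g (Y l (x l)))" for g x
    unfolding dot_def Z_def sum_distrib_left by (rule sum.swap)
  have mgf: "(\<integral>\<^sup>+x. exp (dot g (Z x) - \<Psi> g) \<partial>PiM I F) \<le> 1" for g
  proof -
    have "(\<integral>\<^sup>+x. exp (dot g (Z x)) \<partial>PiM I F) = (\<integral>\<^sup>+x. (\<Prod>l\<in>I. ennreal (exp (dot g (Y l (x l))))) \<partial>PiM I F)"
      by (simp add: dotZ exp_sum I prod_ennreal)
    also have "\<dots> = (\<Prod>l\<in>I. \<integral>\<^sup>+x. exp (dot g (Y l x)) \<partial>F l)"
    proof (rule F.product_nn_integral_prod[OF I])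
      fix l assume l: "l \<in> I"
      show "(\<lambda>x. ennreal (exp (dot g (Y l x)))) \<in> borel_measurable (F l)"
        using borel_measurable_integrable[OF int_exp[OF l]] by simp
    qed
    also have "\<dots> = (\<Prod>l\<in>I. ennreal (\<phi> l g))" by (intro prod.cong) (simp_all add: \<phi>_nn)
    also have "\<dots> \<le> (\<Prod>l\<in>I. ennreal (exp (\<phi> l g - 1)))"
      using exp_ge_add_one_self[of "\<phi> l g - 1" for l] by (intro prod_mono_ennreal ennreal_leI) simp
    also have "\<dots> = ennreal (exp (\<Psi> g))" by (simp add: \<Psi>_def exp_sum I prod_ennreal)
    finally have *: "(\<integral>\<^sup>+x. exp (dot g (Z x)) \<partial>PiM I F) \<le> ennreal (exp (\<Psi> g))" .
    have mgZ [measurable]: "(\<lambda>x. dot g (Z x)) \<in> borel_measurable (PiM I F)"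
      by (intro measurable_dot mZ) auto
    have "(\<integral>\<^sup>+x. exp (dot g (Z x) - \<Psi> g) \<partial>PiM I F)
        = (\<integral>\<^sup>+x. ennreal (exp (- \<Psi> g)) * ennreal (exp (dot g (Z x))) \<partial>PiM I F)"
      by (simp add: ennreal_mult[symmetric] exp_add[symmetric] add.commute)
    also have "\<dots> = ennreal (exp (- \<Psi> g)) * (\<integral>\<^sup>+x. exp (dot g (Z x)) \<partial>PiM I F)"
      by (intro nn_integral_cmult) measurable
    also have "\<dots> \<le> ennreal (exp (- \<Psi> g)) * ennreal (exp (\<Psi> g))" by (intro mult_left_mono *) auto
    also have "\<dots> = 1" by (simp add: ennreal_mult[symmetric] exp_add[symmetric])
    finally show ?thesis .
  qed
  \<comment> \<open>This bounds the tilted mean of \<open>\<Psi>\<close> for every centre of length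
    \<open>\<theta>\<close>. Its independence of the direction allows the centre to be chosen from
    the outcome.\<close>
  define B where "B = s\<^sup>2 * V / 2 * (1 + s\<^sup>2 * K\<^sup>2) + 2 * \<sigma>2 * \<theta>\<^sup>2"
  have posterior: "integrable \<gamma> (\<lambda>g. tilt u g * \<Psi> g) \<and> (\<integral>g. tilt u g * \<Psi> g \<partial>\<gamma>) \<le> B"
    if u: "dot u u = \<theta>\<^sup>2" for u
  proof -
    have l_bound: "integrable \<gamma> (\<lambda>g. tilt u g * \<phi> l g) \<and> (\<integral>g. tilt u g * \<phi> l g \<partial>\<gamma>)
        \<le> 1 + dot u (\<mu> l) + (s\<^sup>2 / 2 * (1 + s\<^sup>2 * K\<^sup>2)) * (\<integral>x. dot (Y l x) (Y l x) \<partial>F l)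
            + 2 * (\<integral>x. (dot u (Y l x))\<^sup>2 \<partial>F l)" (is "_ \<and> _ \<le> ?b") if l: "l \<in> I" for l
    proof -
      interpret GF: pair_prob_space \<gamma> "F l" ..
      let ?e = "\<lambda>x. dot u (Y l x) + s\<^sup>2 * dot (Y l x) (Y l x) / 2"
      let ?q = "\<lambda>x. 1 + dot u (Y l x) + (s\<^sup>2 / 2 * (1 + s\<^sup>2 * K\<^sup>2)) * dot (Y l x) (Y l x)
            + 2 * (dot u (Y l x))\<^sup>2"
      have le: "AE x in F l. exp (?e x) \<le> ?q x"
        using dot_le[OF l, of u] bounded[OF l]
      proof eventually_elim
        case (elim x)
        let ?d = "dot u (Y l x)" and ?n = "dot (Y l x) (Y l x)"
        have "\<bar>?d\<bar> \<le> \<theta> * K" using elim(1) u \<theta> by simp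
        moreover have n: "0 \<le> ?n" by (rule dot_self_nonneg)
        have sn: "s\<^sup>2 * ?n / 2 \<le> s\<^sup>2 * K\<^sup>2 / 2" using elim(2) by (simp add: mult_left_mono)
        ultimately have "?e x \<le> 1" using small by linarith
        then have "exp (?e x) \<le> 1 + ?e x + (?e x)\<^sup>2" by (rule exp_le_quadratic)
        also have "(?e x)\<^sup>2 \<le> 2 * ?d\<^sup>2 + 2 * (s\<^sup>2 * ?n / 2)\<^sup>2"
          using sum_squares_ge_zero[of "?d - s\<^sup>2 * ?n / 2" 0] by (simp add: power2_eq_square algebra_simps)
        \<comment> \<open>One of the two factors is replaced by its almost sure bound, so the
          quartic term becomes the correction \<open>s^2 * K^2\<close> to the total
          variance.\<close>
        also have "(s\<^sup>2 * ?n / 2)\<^sup>2 \<le> (s\<^sup>2 * ?n / 2) * (s\<^sup>2 * K\<^sup>2 / 2)"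
          unfolding power2_eq_square[of "s\<^sup>2 * ?n / 2"] using sn n by (intro mult_left_mono) auto
        finally show ?case by (simp add: algebra_simps)
      qed
      have iq: "integrable (F l) ?q"
        by (intro Bochner_Integration.integrable_add integrable_mult_right int_dot[OF l] int_self[OF l]
            int_sq[OF l]) simp
      have "(\<integral>x. dot u (Y l x) \<partial>F l) = dot u (\<mu> l)"
      proof -
        have it: "integrable (F l) (\<lambda>x. Y l x t)" if "t \<in> T" for t
        proof -
          have "dot (\<lambda>k. if k = t then 1 else 0) v = v t" for v
          proof -
            have "dot (\<lambda>k. if k = t then 1 else 0) v = (\<Sum>k\<in>T. if k = t then v k else 0)"
              unfolding dot_def by (intro sum.cong) auto
            then show ?thesis using that finite_T by simp
          qed
          then show ?thesis using int_dot[OF l, of "\<lambda>k. if k = t then 1 else 0"] by simp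
        qed
        show ?thesis unfolding dot_def
          by (subst Bochner_Integration.integral_sum) (simp_all add: it centered(1)[OF l])
      qed
      then have Iq: "(\<integral>x. ?q x \<partial>F l) = ?b"
        using int_dot[OF l, of u] int_self[OF l] int_sq[OF l, of u] by (simp add: F.M.prob_space)
      have "(\<integral>\<^sup>+g. tilt u g * \<phi> l g \<partial>\<gamma>) = (\<integral>\<^sup>+g. \<integral>\<^sup>+x. ennreal (tilt u g * exp (dot (Y l x) g)) \<partial>F l \<partial>\<gamma>)"
      proof (rule nn_integral_cong)
        fix g
        have "ennreal (tilt u g * \<phi> l g) = ennreal (tilt u g) * (\<integral>\<^sup>+x. exp (dot g (Y l x)) \<partial>F l)"
          using tilt_pos[of u g] \<phi>_nonneg[of l g] by (simp add: ennreal_mult \<phi>_nn[OF l] less_imp_le)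
        also have "\<dots> = (\<integral>\<^sup>+x. ennreal (tilt u g) * exp (dot g (Y l x)) \<partial>F l)"
          by (intro nn_integral_cmult[symmetric] measurable_compose[OF _ measurable_ennreal]
              borel_measurable_integrable[OF int_exp[OF l]])
        also have "\<dots> = (\<integral>\<^sup>+x. ennreal (tilt u g * exp (dot (Y l x) g)) \<partial>F l)"
          using tilt_pos[of u g] by (simp add: ennreal_mult less_imp_le dot_def mult.commute)
        finally show "ennreal (tilt u g * \<phi> l g) = (\<integral>\<^sup>+x. ennreal (tilt u g * exp (dot (Y l x) g)) \<partial>F l)" .
      qed
      also have "\<dots> = (\<integral>\<^sup>+x. \<integral>\<^sup>+g. ennreal (tilt u g * exp (dot (Y l x) g)) \<partial>\<gamma> \<partial>F l)"
      proof (rule GF.Fubini'[symmetric])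
        have [measurable]: "(\<lambda>p. dot (fst p) (Y l (snd p))) \<in> borel_measurable (\<gamma> \<Otimes>\<^sub>M F l)"
          by (rule mY[OF l]) auto
        have [measurable]: "(\<lambda>p. tilt u (fst p)) \<in> borel_measurable (\<gamma> \<Otimes>\<^sub>M F l)" by measurable
        have "dot (Y l x) g = dot g (Y l x)" for x g by (simp add: dot_def mult.commute)
        then show "(\<lambda>(g, x). ennreal (tilt u g * exp (dot (Y l x) g))) \<in> borel_measurable (\<gamma> \<Otimes>\<^sub>M F l)"
          by (simp add: case_prod_beta')
      qed
      also have "\<dots> = (\<integral>\<^sup>+x. exp (?e x) \<partial>F l)" by (simp add: nn_integral_tilt_exp)
      also have "\<dots> \<le> (\<integral>\<^sup>+x. ?q x \<partial>F l)"
        by (rule nn_integral_mono_AE) (use le in \<open>eventually_elim, simp add: ennreal_leI\<close>)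
      also have "\<dots> = ennreal (\<integral>x. ?q x \<partial>F l)"
      proof (rule nn_integral_eq_integral[OF iq])
        show "AE x in F l. 0 \<le> ?q x" using le by eventually_elim (meson exp_ge_zero order_trans)
      qed
      finally have *: "(\<integral>\<^sup>+g. tilt u g * \<phi> l g \<partial>\<gamma>) \<le> ennreal ?b" unfolding Iq .
      have b: "0 \<le> ?b"
        unfolding Iq[symmetric]
        by (rule integral_nonneg_AE) (use le in eventually_elim, meson exp_ge_zero order_trans)
      have nonneg: "0 \<le> tilt u g * \<phi> l g" for g using tilt_pos[of u g] \<phi>_nonneg by simp
      have int: "integrable \<gamma> (\<lambda>g. tilt u g * \<phi> l g)"
        using * l by (intro integrableI_nonneg) (auto simp: nonneg top.extremum_strict order.strict_trans1)
      then show ?thesis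
        using * b nonneg by (simp add: nn_integral_eq_integral)
    qed
    have eq: "tilt u g * \<Psi> g = (\<Sum>l\<in>I. tilt u g * \<phi> l g - tilt u g)" for g
      by (simp add: \<Psi>_def sum_distrib_left algebra_simps)
    have int: "integrable \<gamma> (\<lambda>g. tilt u g * \<Psi> g)"
      unfolding eq using l_bound integrable_tilt
      by (intro Bochner_Integration.integrable_sum Bochner_Integration.integrable_diff) auto
    have "(\<integral>g. tilt u g * \<Psi> g \<partial>\<gamma>) = (\<Sum>l\<in>I. (\<integral>g. tilt u g * \<phi> l g \<partial>\<gamma>) - 1)"
      unfolding eq using l_bound integrable_tilt
      by (subst Bochner_Integration.integral_sum) (auto simp: integral_tilt)
    also have "\<dots> \<le> (\<Sum>l\<in>I. dot u (\<mu> l) + (s\<^sup>2 / 2 * (1 + s\<^sup>2 * K\<^sup>2)) * (\<integral>x. dot (Y l x) (Y l x) \<partial>F l)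
            + 2 * (\<integral>x. (dot u (Y l x))\<^sup>2 \<partial>F l))"
    proof (intro sum_mono)
      fix l assume "l \<in> I"
      from l_bound[OF this] show "(\<integral>g. tilt u g * \<phi> l g \<partial>\<gamma>) - 1 \<le> dot u (\<mu> l)
        + (s\<^sup>2 / 2 * (1 + s\<^sup>2 * K\<^sup>2)) * (\<integral>x. dot (Y l x) (Y l x) \<partial>F l)
            + 2 * (\<integral>x. (dot u (Y l x))\<^sup>2 \<partial>F l)" by linarith
    qed
    also have "\<dots> = (\<Sum>l\<in>I. dot u (\<mu> l))
        + (s\<^sup>2 / 2 * (1 + s\<^sup>2 * K\<^sup>2)) * (\<Sum>l\<in>I. \<integral>x. dot (Y l x) (Y l x) \<partial>F l)
        + 2 * (\<Sum>l\<in>I. \<integral>x. (dot u (Y l x))\<^sup>2 \<partial>F l)"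
      by (simp add: sum.distrib sum_distrib_left)
    also have "(\<Sum>l\<in>I. dot u (\<mu> l)) = 0"
      unfolding dot_def by (subst sum.swap) (simp add: centered(2) flip: sum_distrib_left)
    also have "0 + (s\<^sup>2 / 2 * (1 + s\<^sup>2 * K\<^sup>2)) * (\<Sum>l\<in>I. \<integral>x. dot (Y l x) (Y l x) \<partial>F l)
        + 2 * (\<Sum>l\<in>I. \<integral>x. (dot u (Y l x))\<^sup>2 \<partial>F l)
      \<le> 0 + (s\<^sup>2 / 2 * (1 + s\<^sup>2 * K\<^sup>2)) * V + 2 * (\<sigma>2 * \<theta>\<^sup>2)"
      using weak[of u] V unfolding u
      by (intro add_mono mult_left_mono order_refl) auto
    also have "\<dots> = B" by (simp add: B_def)
    finally show ?thesis using int by simp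
  qed
  let ?A = "{x\<in>space (PiM I F). r\<^sup>2 \<le> dot (Z x) (Z x)}"
  let ?c = "exp (\<theta> * r - B - \<theta>\<^sup>2 / (2 * s\<^sup>2))"
  have [measurable]: "?A \<in> sets (PiM I F)"
  proof -
    have [measurable]: "(\<lambda>x. dot (Z x) (Z x)) \<in> borel_measurable (PiM I F)"
      by (intro measurable_dot mZ)
    show ?thesis by measurable
  qed
  have large: "ennreal ?c \<le> (\<integral>\<^sup>+g. exp (dot g (Z x) - \<Psi> g) \<partial>\<gamma>)" if x: "x \<in> ?A" for x
  proof -
    define N where "N = sqrt (dot (Z x) (Z x))"
    have N: "r \<le> N" unfolding N_def using x r by (intro real_le_rsqrt) auto
    have N2: "dot (Z x) (Z x) = N\<^sup>2" by (simp add: N_def dot_self_nonneg)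
    define u where "u = (\<lambda>t. \<theta> / N * Z x t)"
    have sc: "dot u v = \<theta> / N * dot (Z x) v" for v
      unfolding u_def dot_def by (simp add: sum_distrib_left mult_ac)
    have sc': "dot (Z x) u = dot u (Z x)" by (simp add: dot_def mult.commute)
    have "dot u (Z x) = \<theta> * N" using N r by (simp add: sc N2 power2_eq_square)
    moreover have "dot u u = \<theta>\<^sup>2"
      using N r sc[of u] by (simp add: sc' calculation power2_eq_square)
    ultimately have u: "dot (Z x) u = \<theta> * N" "dot u u = \<theta>\<^sup>2" by (simp_all add: sc')
    have "?c \<le> exp (dot (Z x) u - B - dot u u / (2 * s\<^sup>2))"
      using N \<theta> by (simp add: u)
    then have "ennreal ?c \<le> ennreal (exp (dot (Z x) u - B - dot u u / (2 * s\<^sup>2)))" by (rule ennreal_leI)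
    also have "\<dots> \<le> (\<integral>\<^sup>+g. exp (dot (Z x) g - \<Psi> g) \<partial>\<gamma>)"
      using posterior[OF u(2)] by (intro nn_integral_exp_ge_tilt) auto
    also have "\<dots> = (\<integral>\<^sup>+g. exp (dot g (Z x) - \<Psi> g) \<partial>\<gamma>)" by (simp add: dot_def mult.commute)
    finally show ?thesis .
  qed
  have "ennreal ?c * emeasure (PiM I F) ?A = (\<integral>\<^sup>+x. ennreal ?c * indicator ?A x \<partial>PiM I F)"
    by (subst nn_integral_cmult_indicator) auto
  also have "\<dots> \<le> (\<integral>\<^sup>+x. \<integral>\<^sup>+g. exp (dot g (Z x) - \<Psi> g) \<partial>\<gamma> \<partial>PiM I F)"
    by (intro nn_integral_mono) (use large in \<open>auto simp: indicator_def\<close>)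
  also have "\<dots> = (\<integral>\<^sup>+g. \<integral>\<^sup>+x. exp (dot g (Z x) - \<Psi> g) \<partial>PiM I F \<partial>\<gamma>)"
  proof (rule GP.Fubini')
    have [measurable]: "(\<lambda>p. dot (fst p) (Z (snd p))) \<in> borel_measurable (\<gamma> \<Otimes>\<^sub>M PiM I F)"
      by (intro measurable_dot measurable_compose[OF measurable_snd mZ]) auto
    show "(\<lambda>(g, x). ennreal (exp (dot g (Z x) - \<Psi> g))) \<in> borel_measurable (\<gamma> \<Otimes>\<^sub>M PiM I F)"
      by (simp add: case_prod_beta')
  qed
  also have "\<dots> \<le> (\<integral>\<^sup>+g. 1 \<partial>\<gamma>)" by (intro nn_integral_mono mgf)
  also have "\<dots> = 1" by (simp add: G.P.emeasure_space_1)
  finally have "ennreal ?c * ennreal (measure (PiM I F) ?A) \<le> 1"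
    by (simp only: F.P.emeasure_eq_measure)
  then have "?c * measure (PiM I F) ?A \<le> 1"
    by (simp add: ennreal_mult[symmetric] flip: ennreal_1)
  then have "measure (PiM I F) ?A \<le> exp (- (\<theta> * r - B - \<theta>\<^sup>2 / (2 * s\<^sup>2)))"
    by (simp only: exp_minus) (simp add: field_simps)
  also have "- (\<theta> * r - B - \<theta>\<^sup>2 / (2 * s\<^sup>2))
      = - \<theta> * r + \<theta>\<^sup>2 / (2 * s\<^sup>2) + s\<^sup>2 * V / 2 * (1 + s\<^sup>2 * K\<^sup>2) + 2 * \<sigma>2 * \<theta>\<^sup>2"
    by (simp add: B_def)
  finally show ?thesis .
qed

end

section \<open>Random signs\<close>

lemma rademacher_facts:
  "prob_space rademacher" "sets rademacher = sets borel" "AE z in rademacher. cmod z = 1"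
  "(\<integral>z. z \<partial>rademacher) = 0"
proof -
  let ?p = "measure_pmf (pmf_of_set {1, -1 :: complex})"
  have m: "(\<lambda>z. z) \<in> measurable ?p borel" by simp
  show "prob_space rademacher"
    unfolding rademacher_def by (rule prob_space.prob_space_distr[OF measure_pmf.prob_space_axioms m])
  show "sets rademacher = sets borel" by (simp add: rademacher_def)
  have "AE z in ?p. cmod z = 1" by (subst AE_measure_pmf_iff) auto
  then show "AE z in rademacher. cmod z = 1"
    unfolding rademacher_def by (subst AE_distr_iff[OF m]) auto
  have "(\<integral>z. z \<partial>?p) = 0" by (subst integral_measure_pmf[where A = "{1, -1}"]) auto
  then show "(\<integral>z. z \<partial>rademacher) = 0"
    unfolding rademacher_def by (subst integral_distr[OF m]) auto
qed

lemma integral_cis_unit: "(\<integral>t. indicator {0..1::real} t *\<^sub>R cis (2 * pi * t) \<partial>lborel) = 0"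
proof -
  define G where "G t = cis (2 * pi * t) / (2 * pi * \<i>)" for t :: real
  have "(G has_vector_derivative cis (2 * pi * t)) (at t within A)" for t A
  proof -
    have "((\<lambda>t. cis (2 * pi * t)) has_vector_derivative (2 * pi * \<i> * cis (2 * pi * t))) (at t within A)"
      unfolding cis_conv_exp
      by (auto intro!: derivative_eq_intros has_vector_derivative_real_field simp: mult_ac)
    from has_vector_derivative_divide[OF this, of "2 * pi * \<i>"] show ?thesis
      unfolding G_def by simp
  qed
  then have "(\<integral>t. indicator {0..1::real} t *\<^sub>R cis (2 * pi * t) \<partial>lborel) = G 1 - G 0"
    by (intro integral_FTC_Icc) (auto intro!: continuous_intros)
  then show ?thesis by (simp add: G_def)
qed

lemma steinhaus_facts:
  "prob_space steinhaus" "sets steinhaus = sets borel" "AE z in steinhaus. cmod z = 1"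
  "(\<integral>z. z \<partial>steinhaus) = 0"
proof -
  let ?u = "uniform_measure lborel {0..1::real}"
  have p: "prob_space ?u" by (rule prob_space_uniform_measure) auto
  have m: "(\<lambda>t::real. cis (2 * pi * t)) \<in> measurable ?u borel"
    by (subst measurable_cong_sets[OF sets_uniform_measure refl])
      (auto intro!: borel_measurable_continuous_onI continuous_intros)
  show "prob_space steinhaus"
    unfolding steinhaus_def by (rule prob_space.prob_space_distr[OF p m])
  show "sets steinhaus = sets borel" by (simp add: steinhaus_def)
  show "AE z in steinhaus. cmod z = 1"
    unfolding steinhaus_def by (subst AE_distr_iff[OF m]) auto
  have "(\<integral>z. z \<partial>steinhaus) = (\<integral>t. cis (2 * pi * t) \<partial>?u)"
    unfolding steinhaus_def by (subst integral_distr[OF m]) auto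
  also have "?u = density lborel (\<lambda>t. ennreal (indicator {0..1} t))"
    by (simp add: uniform_measure_def ennreal_indicator divide_ennreal_def)
  also have "(\<integral>t. cis (2 * pi * t) \<partial>\<dots>) = (\<integral>t. indicator {0..1::real} t *\<^sub>R cis (2 * pi * t) \<partial>lborel)"
    by (subst integral_density) (auto intro!: borel_measurable_continuous_onI continuous_intros)
  finally show "(\<integral>z. z \<partial>steinhaus) = 0" by (simp add: integral_cis_unit)
qed

lemma sign_dist_facts:
  "prob_space (sign_dist b)" "sets (sign_dist b) = sets borel" "AE z in sign_dist b. cmod z = 1"
  "(\<integral>z. z \<partial>sign_dist b) = 0"
  unfolding sign_dist_def using rademacher_facts steinhaus_facts by (cases b; simp only: if_True if_False)+

text \<open>Hoeffding's lemma on an interval of length \<open>2 * cmod c\<close>. Only mean zero and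
  unit modulus enter, so real and complex signs are treated alike.\<close>

lemma sign_mgf:
  "(\<integral>\<^sup>+z. exp (l * Re (c * z)) \<partial>sign_dist b) \<le> ennreal (exp (l\<^sup>2 * (cmod c)\<^sup>2 / 2))" if l: "0 < l"
proof -
  interpret prob_space "sign_dist b" by (rule sign_dist_facts)
  note [measurable_cong] = sign_dist_facts(2)
  interpret interval_bounded_random_variable "sign_dist b" "\<lambda>z. Re (c * z)" "- cmod c" "cmod c"
  proof
    show "(\<lambda>z. Re (c * z)) \<in> borel_measurable (sign_dist b)" by measurable
    show "AE z in sign_dist b. Re (c * z) \<in> {- cmod c..cmod c}"
      using sign_dist_facts(3)[of b]
    proof eventually_elim
      case (elim z)
      then show ?case using abs_Re_le_cmod[of "c * z"] by (simp add: norm_mult abs_le_iff)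
    qed
  qed
  have i: "integrable (sign_dist b) (\<lambda>z. z)"
    by (rule integrable_const_bound[where B = 1]) (use sign_dist_facts(3)[of b] in auto)
  have "expectation (\<lambda>z. Re (c * z)) = 0"
    using i sign_dist_facts(4)[of b] by (subst integral_Re) auto
  from Hoeffdings_lemma_nn_integral_0[OF l this] show ?thesis
    by (simp add: power2_eq_square field_simps)
qed

lemma prob_space_signs: "prob_space (PiM S (\<lambda>_. sign_dist b))"
  by (rule prob_space_PiM) (rule sign_dist_facts)

lemma measurable_sign_component:
  "i \<in> S \<Longrightarrow> (\<lambda>x. x i) \<in> borel_measurable (PiM S (\<lambda>_. sign_dist b))"
  using measurable_component_singleton[of i S "\<lambda>_. sign_dist b"]
  by (simp cong: measurable_cong_sets add: sign_dist_facts(2))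

text \<open>Chernoff bound with the optimal parameter \<open>t / N\<close>. \<open>N\<close> is only
  an upper bound of the sum of squares, so that it stays positive when all coefficients
  vanish.\<close>

lemma sign_sum_one_sided:
  assumes S: "finite S" and N: "0 < N" "(\<Sum>i\<in>S. (cmod (c i))\<^sup>2) \<le> N" and t: "0 < t"
  shows "measure (PiM S (\<lambda>_. sign_dist b)) {x\<in>space (PiM S (\<lambda>_. sign_dist b)). t \<le> Re (\<Sum>i\<in>S. c i * x i)}
    \<le> exp (- t\<^sup>2 / (2 * N))"
proof -
  let ?M = "PiM S (\<lambda>_. sign_dist b)"
  interpret P: prob_space ?M by (rule prob_space_signs)
  interpret product_prob_space "\<lambda>_. sign_dist b" S
    by (simp add: product_prob_space_def product_prob_space_axioms_def product_sigma_finite_def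
        sign_dist_facts prob_space_imp_sigma_finite)
  note [measurable_cong] = sign_dist_facts(2)
  have prod: "(\<integral>\<^sup>+x. (\<Prod>i\<in>S. ennreal (exp (l * Re (c i * x i)))) \<partial>?M)
      = (\<Prod>i\<in>S. \<integral>\<^sup>+z. exp (l * Re (c i * z)) \<partial>sign_dist b)" for l
    by (rule product_nn_integral_prod[OF S]) measurable
  note [measurable] = measurable_sign_component
  define l where "l = t / N"
  have l: "0 < l" using N t by (simp add: l_def)
  have "emeasure ?M {x\<in>space ?M. t \<le> Re (\<Sum>i\<in>S. c i * x i)}
      \<le> ennreal (exp (- l * t)) * (\<integral>\<^sup>+x. ennreal (exp (l * Re (\<Sum>i\<in>S. c i * x i))) * indicator (space ?M) x \<partial>?M)"
    by (rule Chernoff_ineq_nn_integral_ge[OF l]) auto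
  also have "(\<integral>\<^sup>+x. ennreal (exp (l * Re (\<Sum>i\<in>S. c i * x i))) * indicator (space ?M) x \<partial>?M)
      = (\<integral>\<^sup>+x. (\<Prod>i\<in>S. ennreal (exp (l * Re (c i * x i)))) \<partial>?M)"
    by (intro nn_integral_cong)
      (simp add: sum_distrib_left exp_sum[OF S] prod_ennreal del: times_complex.sel)
  also have "\<dots> = (\<Prod>i\<in>S. \<integral>\<^sup>+z. exp (l * Re (c i * z)) \<partial>sign_dist b)"
    by (rule prod)
  also have "\<dots> \<le> (\<Prod>i\<in>S. ennreal (exp (l\<^sup>2 * (cmod (c i))\<^sup>2 / 2)))"
    by (intro prod_mono_ennreal sign_mgf[OF l])
  also have "\<dots> = ennreal (exp (l\<^sup>2 * (\<Sum>i\<in>S. (cmod (c i))\<^sup>2) / 2))"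
    by (simp add: prod_ennreal exp_sum[OF S, symmetric] sum_distrib_left sum_divide_distrib)
  also have "\<dots> \<le> ennreal (exp (l\<^sup>2 * N / 2))"
    using N by (intro ennreal_leI) (simp add: mult_left_mono)
  finally have "emeasure ?M {x\<in>space ?M. t \<le> Re (\<Sum>i\<in>S. c i * x i)}
      \<le> ennreal (exp (- l * t)) * ennreal (exp (l\<^sup>2 * N / 2))"
    by (simp add: mult_left_mono)
  also have "\<dots> = ennreal (exp (- t\<^sup>2 / (2 * N)))"
    using N by (simp add: ennreal_mult[symmetric] exp_add[symmetric] l_def field_simps power2_eq_square)
  finally show ?thesis by (simp add: P.emeasure_eq_measure)
qed

text \<open>If the modulus exceeds \<open>\<rho>\<close>, then the real or the imaginary part is at
  least \<open>\<rho> / sqrt 2\<close> in absolute value; rotating the coefficients by the four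
  units 1, -1, \<i>, -\<i> reduces each case to the one-sided bound.\<close>

lemma sign_sum_tail:
  assumes S: "finite S" and N: "0 < N" "(\<Sum>i\<in>S. (cmod (c i))\<^sup>2) \<le> N" and \<rho>: "0 < \<rho>"
  shows "measure (PiM S (\<lambda>_. sign_dist b))
      {x\<in>space (PiM S (\<lambda>_. sign_dist b)). \<rho> < cmod (\<Sum>i\<in>S. c i * x i)}
    \<le> 4 * exp (- \<rho>\<^sup>2 / (4 * N))"
proof -
  let ?M = "PiM S (\<lambda>_. sign_dist b)"
  interpret P: prob_space ?M by (rule prob_space_signs)
  note [measurable] = measurable_sign_component
  define t where "t = \<rho> / sqrt 2"
  have t: "0 < t" "t\<^sup>2 = \<rho>\<^sup>2 / 2" using \<rho> by (auto simp: t_def power_divide)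
  define A where "A d = {x\<in>space ?M. t \<le> Re (\<Sum>i\<in>S. (d * c i) * x i)}" for d
  have A_sets [measurable]: "A d \<in> sets ?M" for d unfolding A_def by measurable
  have A: "measure ?M (A d) \<le> exp (- \<rho>\<^sup>2 / (4 * N))" if "cmod d = 1" for d
    using sign_sum_one_sided[OF S N(1) _ t(1), of "\<lambda>i. d * c i" b] N(2) that
    by (simp add: A_def norm_mult t(2))
  have "{x\<in>space ?M. \<rho> < cmod (\<Sum>i\<in>S. c i * x i)} \<subseteq> (A 1 \<union> A (-1)) \<union> (A \<i> \<union> A (-\<i>))"
  proof
    fix x assume x: "x \<in> {x\<in>space ?M. \<rho> < cmod (\<Sum>i\<in>S. c i * x i)}"
    define w where "w = (\<Sum>i\<in>S. c i * x i)"
    have dw: "(\<Sum>i\<in>S. (d * c i) * x i) = d * w" for d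
      by (simp add: w_def sum_distrib_left mult.assoc)
    have "t \<le> \<bar>Re w\<bar> \<or> t \<le> \<bar>Im w\<bar>"
    proof (rule ccontr)
      assume "\<not> ?thesis"
      then have "\<bar>Re w\<bar> < t" "\<bar>Im w\<bar> < t" by linarith+
      from this[THEN power_strict_mono[of _ _ 2]]
      have "(Re w)\<^sup>2 + (Im w)\<^sup>2 < t\<^sup>2 + t\<^sup>2" by simp
      then have "(cmod w)\<^sup>2 < \<rho>\<^sup>2" unfolding cmod_power2 using t(2) by linarith
      then have "cmod w < \<rho>" by (rule power2_less_imp_less) (use \<rho> in linarith)
      then show False using x unfolding w_def by simp
    qed
    then show "x \<in> (A 1 \<union> A (-1)) \<union> (A \<i> \<union> A (-\<i>))"
    proof -
      have xs: "x \<in> space ?M" using x by simp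
      have mem: "x \<in> A d \<longleftrightarrow> t \<le> Re (d * w)" for d
        unfolding A_def mem_Collect_eq dw using xs by blast
      show ?thesis using \<open>t \<le> \<bar>Re w\<bar> \<or> t \<le> \<bar>Im w\<bar>\<close> unfolding Un_iff mem by auto
    qed
  qed
  then have "measure ?M {x\<in>space ?M. \<rho> < cmod (\<Sum>i\<in>S. c i * x i)}
      \<le> measure ?M ((A 1 \<union> A (-1)) \<union> (A \<i> \<union> A (-\<i>)))"
    by (intro P.finite_measure_mono) auto
  also have "\<dots> \<le> (measure ?M (A 1) + measure ?M (A (-1))) + (measure ?M (A \<i>) + measure ?M (A (-\<i>)))"
    by (intro order_trans[OF measure_Un_le] add_mono measure_Un_le) auto
  also have "\<dots> \<le> 4 * exp (- \<rho>\<^sup>2 / (4 * N))"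
    using A[of 1] A[of "-1"] A[of \<i>] A[of "-\<i>"] by simp
  finally show ?thesis .
qed

lemma AE_signs_unit:
  assumes "finite S"
  shows "AE x in PiM S (\<lambda>_. sign_dist b). \<forall>i\<in>S. cmod (x i) = 1"
proof -
  interpret product_prob_space "\<lambda>_. sign_dist b" S
    by (simp add: product_prob_space_def product_prob_space_axioms_def product_sigma_finite_def
        sign_dist_facts prob_space_imp_sigma_finite)
  show ?thesis
    using assms by (intro AE_finite_allI AE_component) (auto intro: sign_dist_facts)
qed

section \<open>Recovery from a dual certificate\<close>

context finite_index
begin

lemma cmod_ip_le: "cmod (ip u v) \<le> sqrt (nsq u) * sqrt (nsq v)"
proof -
  have "cmod (ip u v) \<le> (\<Sum>i\<in>S. cmod (u i) * cmod (v i))"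
    unfolding ip_def by (rule order_trans[OF norm_sum]) (simp add: norm_mult)
  also have "\<dots> = sqrt ((\<Sum>i\<in>S. cmod (u i) * cmod (v i))\<^sup>2)"
    by (simp add: sum_nonneg)
  also have "\<dots> \<le> sqrt (nsq u * nsq v)"
    unfolding nsq_def by (intro real_sqrt_le_mono Cauchy_Schwarz_ineq_sum)
  finally show ?thesis by (simp add: real_sqrt_mult)
qed

end

lemma vnorm_nsq: "finite I \<Longrightarrow> vnorm I v = sqrt (finite_index.nsq I v)"
  by (simp add: vnorm_def finite_index.nsq_def finite_index_def)

locale measurement =
  fixes n :: nat and S :: "nat set" and R :: "'q set" and col :: "nat \<Rightarrow> 'q \<Rightarrow> complex"
  assumes S_sub: "S \<subseteq> {..<n}" and fin_R: "finite R"
begin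

sublocale S: finite_index S
  using S_sub finite_subset by unfold_locales auto

sublocale R: finite_index R
  using fin_R by unfold_locales

definition gramS :: "nat cmat" where
  "gramS = (\<lambda>i j. if i \<in> S \<and> j \<in> S then R.ip (col i) (col j) else 0)"

definition corr :: "nat \<Rightarrow> nat \<Rightarrow> complex" where
  "corr i = (\<lambda>j. R.ip (col j) (col i))"

definition action :: "(nat \<Rightarrow> complex) \<Rightarrow> 'q \<Rightarrow> complex" where
  "action v = (\<lambda>q. \<Sum>j<n. col j q * v j)"

lemma R_ip_combination: "finite J \<Longrightarrow> R.ip u (\<lambda>q. \<Sum>j\<in>J. col j q * v j) = (\<Sum>j\<in>J. v j * R.ip u (col j))"
  unfolding R.ip_def sum_distrib_left by (subst sum.swap) (simp add: mult_ac)

lemma R_ip_action: "R.ip u (action v) = (\<Sum>j<n. v j * R.ip u (col j))"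
  by (simp add: action_def R_ip_combination)

lemma R_ip_combination_left:
  "finite J \<Longrightarrow> R.ip (\<lambda>q. \<Sum>j\<in>J. col j q * v j) u = (\<Sum>j\<in>J. cnj (v j) * R.ip (col j) u)"
  by (subst R.ip_commute, simp add: R_ip_combination)
    (metis R.ip_commute)

lemma herm_gramS: "S.herm gramS"
proof -
  have "cnj (R.ip (col j) (col i)) = R.ip (col i) (col j)" for i j by (rule R.ip_commute[symmetric])
  then show ?thesis
    unfolding S.herm_def S.supported_def adj_mat_def gramS_def by (auto simp: fun_eq_iff)
qed

lemma mv_gramS: "i \<in> S \<Longrightarrow> S.mv gramS v i = (\<Sum>k\<in>S. v k * R.ip (col i) (col k))"
  by (simp add: S.mv_def gramS_def mult.commute)

lemma qf_gramS: "S.qf gramS v = R.nsq (\<lambda>q. \<Sum>j\<in>S. col j q * v j)"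
proof -
  have "R.ip (\<lambda>q. \<Sum>j\<in>S. col j q * v j) (\<lambda>q. \<Sum>j\<in>S. col j q * v j)
      = (\<Sum>i\<in>S. cnj (v i) * (\<Sum>j\<in>S. v j * R.ip (col i) (col j)))"
    by (subst R_ip_combination_left[OF S.finite_S]) (simp add: R_ip_combination S.finite_S)
  also have "\<dots> = S.ip v (S.mv gramS v)"
    by (simp add: S.ip_def mv_gramS)
  finally show ?thesis by (simp add: S.qf_def R.nsq_ip)
qed

lemma psd_gramS: "S.psd gramS"
  using herm_gramS by (simp add: S.psd_def qf_gramS)

text \<open>The image of the error \<open>v\<close> is tested twice. Against the certificate
  \<open>h\<close> it bounds the mass \<open>T\<close> off the support by the noise; against
  \<open>y\<close>, the image of the part of \<open>v\<close> on \<open>S\<close>, it bounds that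
  part by the noise and \<open>T\<close>. Off the support each column enters singly, through its
  correlation with the columns in \<open>S\<close>.\<close>

lemma dual_certificate_recovery:
  assumes G: "\<And>v. (1 / 2) * S.nsq v \<le> S.qf gramS v"
    and corr: "\<And>i. i < n \<Longrightarrow> i \<notin> S \<Longrightarrow> S.nsq (corr i) \<le> 1"
    and dual: "\<And>i. i < n \<Longrightarrow> i \<notin> S \<Longrightarrow> cmod (S.ip (S.mv (S.minv gramS) (corr i)) \<sigma>) \<le> 9 / 10"
    and unit: "\<And>j. j \<in> S \<Longrightarrow> cmod (\<sigma> j) = 1" and a: "\<And>j. j \<in> S \<Longrightarrow> 0 < a j"
    and x: "x = signal S a \<sigma>"
    and l1: "l1norm n (\<lambda>i. x i + v i) \<le> l1norm n x"
    and e: "vnorm R (action v) \<le> e"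
  shows "vnorm {..<n} v \<le> (3 / 2 + 45 * sqrt (real (card S))) * e"
proof -
  define K where "K = S.minv gramS"
  have pd: "S.posdef (1 / 2) gramS" unfolding S.posdef_def using herm_gramS G by auto
  have iK: "S.inverse_of gramS K" unfolding K_def by (rule S.posdef_inverse[OF pd])
  have K: "S.psd K" by (rule S.inverse_of_psd[OF psd_gramS iK])
  define h where "h = (\<lambda>q. \<Sum>k\<in>S. col k q * S.mv K \<sigma> k)"
  have h_on: "R.ip h (col i) = cnj (\<sigma> i)" if "i \<in> S" for i
  proof -
    have "R.ip (col i) h = S.mv gramS (S.mv K \<sigma>) i"
      using that by (simp add: h_def R_ip_combination S.finite_S mv_gramS)
    also have "\<dots> = \<sigma> i"
      using iK that by (simp add: S.inverse_of_def S.mv_id flip: S.mv_mm)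
    finally show ?thesis by (metis R.ip_commute)
  qed
  have h_off: "cmod (R.ip h (col i)) \<le> 9 / 10" if "i < n" "i \<notin> S" for i
  proof -
    have "R.ip h (col i) = S.ip (S.mv K \<sigma>) (corr i)"
      by (simp add: h_def R_ip_combination_left S.finite_S S.ip_def corr_def)
    also have "\<dots> = S.ip \<sigma> (S.mv K (corr i))"
      using K by (simp add: S.ip_mv_adj[of \<sigma>] S.psd_def S.herm_def)
    finally have "cmod (R.ip h (col i)) = cmod (S.ip (S.mv K (corr i)) \<sigma>)"
      by (metis S.ip_commute complex_mod_cnj)
    then show ?thesis using dual[OF that] by (simp add: K_def)
  qed
  have nsq_h: "R.nsq h \<le> 2 * real (card S)"
  proof -
    have "R.ip h h = S.ip \<sigma> (S.mv K \<sigma>)"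
      by (subst (2) h_def) (simp add: R_ip_combination S.finite_S S.ip_def h_on mult.commute)
    then have "R.nsq h = S.qf K \<sigma>" by (simp add: R.nsq_ip S.qf_def)
    also have "\<dots> \<le> 2 * S.nsq \<sigma>"
      using S.inverse_of_le[OF psd_gramS iK _ G, of \<sigma>] by simp
    also have "S.nsq \<sigma> = real (card S)" by (simp add: S.nsq_def unit)
    finally show ?thesis .
  qed
  define T where "T = (\<Sum>i\<in>{..<n} - S. cmod (v i))"
  define f where "f = sqrt (R.nsq (action v))"
  have fe: "f \<le> e" using e by (simp add: f_def vnorm_nsq fin_R)
  have f0: "0 \<le> f" by (simp add: f_def)
  have T0: "0 \<le> T" by (simp add: T_def sum_nonneg)
  have split: "(\<Sum>i<n. g i) = (\<Sum>i\<in>S. g i) + (\<Sum>i\<in>{..<n} - S. g i)" for g :: "nat \<Rightarrow> 'b::comm_monoid_add"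
    using sum.subset_diff[OF S_sub, of g] by (simp add: add.commute)
  \<comment> \<open>The sign vector is a subgradient of the l1 norm at \<open>x\<close>, and
    \<open>x\<close> vanishes off \<open>S\<close>, so there the whole mass of \<open>v\<close>
    counts.\<close>
  have cone: "T \<le> - Re (S.ip \<sigma> v)"
  proof -
    have "cmod (x i) + Re (cnj (\<sigma> i) * v i) \<le> cmod (x i + v i)" if i: "i \<in> S" for i
    proof -
      have "cnj (\<sigma> i) * \<sigma> i = 1"
        using unit[OF i] by (simp add: complex_norm_square[symmetric] mult.commute)
      then have "cnj (\<sigma> i) * x i = of_real (a i)"
        using i by (simp add: x signal_def mult_ac)
      then have "a i + Re (cnj (\<sigma> i) * v i) = Re (cnj (\<sigma> i) * (x i + v i))"
        by (simp add: distrib_left)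
      also have "\<dots> \<le> cmod (cnj (\<sigma> i) * (x i + v i))" by (rule complex_Re_le_cmod)
      also have "\<dots> = cmod (x i + v i)" using unit[OF i] by (simp add: norm_mult)
      finally show ?thesis using i a[OF i] unit[OF i] by (simp add: x signal_def norm_mult)
    qed
    then have "(\<Sum>i\<in>S. cmod (x i)) + Re (S.ip \<sigma> v) \<le> (\<Sum>i\<in>S. cmod (x i + v i))"
      unfolding S.ip_def Re_sum sum.distrib[symmetric] by (intro sum_mono)
    moreover have "(\<Sum>i\<in>{..<n} - S. cmod (x i)) = 0" "(\<Sum>i\<in>{..<n} - S. cmod (x i + v i)) = T"
      by (auto simp: x signal_def T_def intro!: sum.cong)
    ultimately show ?thesis using l1 unfolding l1norm_def split by simp
  qed
  have "R.ip h (action v) = S.ip \<sigma> v + (\<Sum>i\<in>{..<n} - S. v i * R.ip h (col i))"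
    unfolding R_ip_action split by (simp add: S.ip_def h_on mult.commute)
  then have "- Re (S.ip \<sigma> v) = Re (\<Sum>i\<in>{..<n} - S. v i * R.ip h (col i)) - Re (R.ip h (action v))"
    by simp
  also have "\<dots> \<le> cmod (\<Sum>i\<in>{..<n} - S. v i * R.ip h (col i)) + cmod (R.ip h (action v))"
    using complex_Re_le_cmod[of "\<Sum>i\<in>{..<n} - S. v i * R.ip h (col i)"]
      abs_Re_le_cmod[of "R.ip h (action v)"] by linarith
  also have "cmod (\<Sum>i\<in>{..<n} - S. v i * R.ip h (col i)) \<le> 9 / 10 * T"
  proof -
    have "cmod (\<Sum>i\<in>{..<n} - S. v i * R.ip h (col i)) \<le> (\<Sum>i\<in>{..<n} - S. 9 / 10 * cmod (v i))"
    proof (rule order_trans[OF norm_sum], intro sum_mono)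
      fix i assume "i \<in> {..<n} - S"
      then show "cmod (v i * R.ip h (col i)) \<le> 9 / 10 * cmod (v i)"
        using mult_left_mono[OF h_off[of i], of "cmod (v i)"] by (simp add: norm_mult)
    qed
    then show ?thesis by (simp add: T_def sum_distrib_left)
  qed
  also have "cmod (R.ip h (action v)) \<le> sqrt (2 * real (card S)) * f"
    using R.cmod_ip_le[of h "action v"] mult_right_mono[OF real_sqrt_le_mono[OF nsq_h] f0]
    by (simp add: f_def)
  \<comment> \<open>Absorbing \<open>9 / 10 * T\<close> on the left produces the factor 10.\<close>
  finally have T_le: "T \<le> 10 * sqrt (2 * real (card S)) * f" using cone by simp
  define y where "y = (\<lambda>q. \<Sum>j\<in>S. col j q * v j)"
  define w where "w = sqrt (R.nsq y)"
  define b where "b = sqrt (S.nsq v)"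
  have b_w: "b \<le> sqrt 2 * w"
    using G[of v] unfolding b_def w_def qf_gramS y_def real_sqrt_mult[symmetric]
    by (intro real_sqrt_le_mono) simp
  have w0: "0 \<le> w" and b0: "0 \<le> b" by (simp_all add: w_def b_def)
  have corr_y: "cmod (R.ip y (col i)) \<le> b" if "i < n" "i \<notin> S" for i
  proof -
    have "R.ip y (col i) = S.ip v (corr i)"
      by (simp add: y_def R_ip_combination_left S.finite_S S.ip_def corr_def)
    then have "cmod (R.ip y (col i)) \<le> b * sqrt (S.nsq (corr i))"
      using S.cmod_ip_le[of v "corr i"] by (simp add: b_def)
    also have "\<dots> \<le> b * 1" using corr[OF that] b0 by (intro mult_left_mono) auto
    finally show ?thesis by simp
  qed
  have "R.ip y (action v) = R.ip y y + (\<Sum>i\<in>{..<n} - S. v i * R.ip y (col i))"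
  proof -
    have "R.ip y y = (\<Sum>j\<in>S. v j * R.ip y (col j))"
      by (subst (2) y_def) (simp add: R_ip_combination S.finite_S)
    then show ?thesis by (simp only: R_ip_action split)
  qed
  then have "w * w = Re (R.ip y (action v)) - Re (\<Sum>i\<in>{..<n} - S. v i * R.ip y (col i))"
    by (simp add: w_def flip: R.nsq_ip)
  also have "\<dots> \<le> cmod (R.ip y (action v)) + cmod (\<Sum>i\<in>{..<n} - S. v i * R.ip y (col i))"
    using complex_Re_le_cmod[of "R.ip y (action v)"]
      abs_Re_le_cmod[of "\<Sum>i\<in>{..<n} - S. v i * R.ip y (col i)"] by linarith
  also have "cmod (R.ip y (action v)) \<le> w * f"
    using R.cmod_ip_le[of y "action v"] by (simp add: w_def f_def)
  also have "cmod (\<Sum>i\<in>{..<n} - S. v i * R.ip y (col i)) \<le> T * b"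
  proof -
    have "cmod (\<Sum>i\<in>{..<n} - S. v i * R.ip y (col i)) \<le> (\<Sum>i\<in>{..<n} - S. cmod (v i) * b)"
      by (rule order_trans[OF norm_sum], intro sum_mono)
        (use corr_y in \<open>simp add: norm_mult mult_left_mono\<close>)
    then show ?thesis by (simp add: T_def sum_distrib_right)
  qed
  also have "T * b \<le> T * (sqrt 2 * w)" by (intro mult_left_mono b_w T0)
  finally have "w * w \<le> w * (f + sqrt 2 * T)" by (simp add: algebra_simps)
  then have w_le: "w \<le> f + sqrt 2 * T"
  proof (cases "w = 0")
    case False
    then show ?thesis using \<open>w * w \<le> w * (f + sqrt 2 * T)\<close> w0 by (simp add: less_le)
  qed (use f0 T0 in simp)
  have "b \<le> sqrt 2 * (f + sqrt 2 * T)" by (rule order_trans[OF b_w]) (intro mult_left_mono w_le, simp)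
  then have b_le: "b \<le> sqrt 2 * f + 2 * T" by (simp add: distrib_left mult.assoc[symmetric])
  have "vnorm {..<n} v \<le> b + T"
  proof -
    have "(\<Sum>i\<in>{..<n} - S. (cmod (v i))\<^sup>2) \<le> T\<^sup>2"
    proof -
      have "sqrt (\<Sum>i\<in>{..<n} - S. (cmod (v i))\<^sup>2) \<le> T"
        using L2_set_le_sum[of "{..<n} - S" "\<lambda>i. cmod (v i)"] by (simp add: L2_set_def T_def)
      then show ?thesis by (rule sqrt_le_D)
    qed
    then have "(\<Sum>i<n. (cmod (v i))\<^sup>2) \<le> b\<^sup>2 + T\<^sup>2"
      unfolding split by (simp add: b_def S.nsq_def sum_nonneg)
    also have "\<dots> \<le> (b + T)\<^sup>2" using b0 T0 by (simp add: power2_sum)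
    finally show ?thesis unfolding vnorm_def using b0 T0 by (intro real_le_lsqrt) (auto simp: sum_nonneg)
  qed
  also have "\<dots> \<le> sqrt 2 * f + 3 * T" using b_le by simp
  also have "\<dots> \<le> sqrt 2 * f + 3 * (10 * sqrt (2 * real (card S)) * f)" using T_le by linarith
  also have "\<dots> = (sqrt 2 + 30 * sqrt 2 * sqrt (real (card S))) * f"
    by (simp add: real_sqrt_mult algebra_simps)
  also have "\<dots> \<le> (3 / 2 + 45 * sqrt (real (card S))) * f"
  proof -
    have s2: "sqrt 2 \<le> 3 / 2" by (intro real_le_lsqrt) (auto simp: power2_eq_square)
    then have "30 * sqrt 2 * sqrt (real (card S)) \<le> 45 * sqrt (real (card S))"
      by (intro mult_right_mono) auto
    then show ?thesis using s2 f0 by (intro mult_right_mono add_mono) auto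
  qed
  also have "\<dots> \<le> (3 / 2 + 45 * sqrt (real (card S))) * e"
    using fe by (intro mult_left_mono) auto
  finally show ?thesis .
qed

end

section \<open>The random sensing matrix\<close>

context measurement
begin

lemma ip_corr: "S.ip v (corr i) = R.ip (\<lambda>q. \<Sum>j\<in>S. col j q * v j) (col i)"
  by (simp add: R_ip_combination_left S.finite_S S.ip_def corr_def)

text \<open>The pairing is an inner product of a combination of the columns in \<open>S\<close> with
  column \<open>i\<close>. Used for a single block this gives the weak variance: the quadratic forms
  average to \<open>nsq v\<close> by isotropy, and the block column stays below
  \<open>\<Gamma> / m\<close>.\<close>

lemma ip_corr_square_le: "(Re (S.ip v (corr i)))\<^sup>2 \<le> S.qf gramS v * R.nsq (col i)"
proof -
  have "\<bar>Re (S.ip v (corr i))\<bar> \<le> sqrt (S.qf gramS v) * sqrt (R.nsq (col i))"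
    unfolding ip_corr qf_gramS by (rule order_trans[OF abs_Re_le_cmod R.cmod_ip_le])
  then have "\<bar>Re (S.ip v (corr i))\<bar>\<^sup>2 \<le> (sqrt (S.qf gramS v) * sqrt (R.nsq (col i)))\<^sup>2"
    by (rule power_mono) simp
  then show ?thesis by (simp add: power_mult_distrib qf_gramS)
qed

text \<open>The preceding inequality at \<open>v = corr i\<close>, divided by
  \<open>nsq (corr i)\<close>. Used for a single block it gives both the almost sure bound and the
  total variance.\<close>

lemma nsq_corr_le:
  assumes "\<And>v. S.qf gramS v \<le> r * S.nsq v" and "0 \<le> r"
  shows "S.nsq (corr i) \<le> r * R.nsq (col i)"
proof -
  have "(S.nsq (corr i))\<^sup>2 \<le> S.qf gramS (corr i) * R.nsq (col i)"
    using ip_corr_square_le[of "corr i" i] by (simp add: S.nsq_ip)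
  also have "\<dots> \<le> r * S.nsq (corr i) * R.nsq (col i)"
    by (intro mult_right_mono assms) simp
  finally have "S.nsq (corr i) * S.nsq (corr i) \<le> S.nsq (corr i) * (r * R.nsq (col i))"
    by (simp add: power2_eq_square mult_ac)
  then show ?thesis
  proof (cases "S.nsq (corr i) = 0")
    case False
    then have "0 < S.nsq (corr i)" using S.nsq_nonneg[of "corr i"] by linarith
    then show ?thesis using \<open>S.nsq (corr i) * S.nsq (corr i) \<le> _\<close> by simp
  qed (use assms in simp)
qed

end

section \<open>From the setting of the theorem to columns and blocks\<close>

lemma op_norm22_bound:
  assumes R: "finite R" and C: "finite C"
  shows "vnorm R (matvec C M v) \<le> op_norm22 R C M * vnorm C v"
proof -
  \<comment> \<open>A crude bound from the entries; its only purpose is to make the set under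
    \<open>Sup\<close> bounded, without which the supremum would carry no information.\<close>
  define B where "B = sqrt (\<Sum>i\<in>R. (\<Sum>j\<in>C. cmod (M (i, j)))\<^sup>2)"
  have le_B: "vnorm R (matvec C M u) \<le> B" if u: "vnorm C u \<le> 1" for u
  proof -
    have uj: "cmod (u j) \<le> 1" if "j \<in> C" for j
    proof -
      have "(cmod (u j))\<^sup>2 \<le> (\<Sum>j\<in>C. (cmod (u j))\<^sup>2)"
        using that C by (intro member_le_sum) auto
      also have "\<dots> \<le> 1\<^sup>2" using u by (intro sqrt_le_D) (simp add: vnorm_def)
      finally show ?thesis using power2_le_imp_le[of "cmod (u j)" 1] by simp
    qed
    have "cmod (matvec C M u i) \<le> (\<Sum>j\<in>C. cmod (M (i, j)))" for i
      unfolding matvec_def using uj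
      by (intro order_trans[OF norm_sum] sum_mono) (simp add: norm_mult mult_left_le)
    then show ?thesis unfolding vnorm_def B_def
      by (intro real_sqrt_le_mono sum_mono power_mono) auto
  qed
  have bdd: "bdd_above {vnorm R (matvec C M v) | v. vnorm C v \<le> 1}"
    by (rule bdd_aboveI[where M = B]) (use le_B in auto)
  have vn0: "0 \<le> vnorm I w" for I and w :: "'x \<Rightarrow> complex" by (simp add: vnorm_def sum_nonneg)
  show ?thesis
  proof (cases "vnorm C v = 0")
    case True
    then have "\<forall>j\<in>C. v j = 0"
      using C by (simp add: vnorm_def sum_nonneg_eq_0_iff)
    then have "matvec C M v = (\<lambda>i. 0)" by (simp add: matvec_def fun_eq_iff)
    then show ?thesis using True by (simp add: vnorm_def)
  next
    case False
    define t where "t = vnorm C v"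
    have t: "0 < t" using False vn0[of C v] by (simp add: t_def less_le)
    define u where "u = (\<lambda>j. v j / of_real t)"
    have scale: "vnorm I (\<lambda>j. w j / of_real t) = vnorm I w / t" for I and w :: "'x \<Rightarrow> complex"
    proof -
      have "(\<Sum>j\<in>I. (cmod (w j / of_real t))\<^sup>2) = (\<Sum>j\<in>I. (cmod (w j))\<^sup>2) / t\<^sup>2"
        using t by (simp add: norm_divide power_divide sum_divide_distrib)
      then show ?thesis using t by (simp add: vnorm_def real_sqrt_divide)
    qed
    have "vnorm C u = 1" unfolding u_def scale using t by (simp add: t_def[symmetric])
    then have "vnorm R (matvec C M u) \<le> op_norm22 R C M"
      unfolding op_norm22_def by (intro cSup_upper bdd) auto
    moreover have "matvec C M u = (\<lambda>i. matvec C M v i / of_real t)"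
      by (simp add: matvec_def u_def sum_divide_distrib)
    ultimately show ?thesis using t by (simp add: scale t_def[symmetric] field_simps)
  qed
qed

text \<open>With the factor \<open>1 / sqrt m\<close> placed in the block, both a single block and
  the stacked matrix are instances of \<open>measurement\<close>, and Gram matrices and correlations
  of the latter are plain sums over blocks.\<close>

definition block_col :: "nat \<Rightarrow> (nat \<times> nat \<Rightarrow> complex) \<Rightarrow> nat \<Rightarrow> nat \<Rightarrow> complex" where
  "block_col m b j r = complex_of_real (1 / sqrt (real m)) * b (r, j)"

definition stacked_col :: "nat \<Rightarrow> (nat \<Rightarrow> nat \<times> nat \<Rightarrow> complex) \<Rightarrow> nat \<Rightarrow> nat \<times> nat \<Rightarrow> complex" where
  "stacked_col m B j = (\<lambda>(l, r). block_col m (B l) j r)"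

lemma finite_rows: "finite (rows m p)"
  by (simp add: rows_def)

lemma sum_rows: "(\<Sum>q\<in>rows m p. f q) = (\<Sum>l<m. \<Sum>r<p l. f (l, r))"
  unfolding rows_def by (simp add: sum.Sigma)

lemma ip_stacked_col:
  "finite_index.ip (rows m p) (stacked_col m B i) (stacked_col m B j)
    = (\<Sum>l<m. finite_index.ip {..<p l} (block_col m (B l) i) (block_col m (B l) j))"
  by (simp add: finite_index.ip_def finite_index_def finite_rows sum_rows stacked_col_def)

lemma ip_block_col:
  "finite_index.ip {..<d} (block_col m b i) (block_col m b j) = of_real (1 / real m) * gram {..<d} b (i, j)"
proof -
  have "complex_of_real (1 / sqrt (real m)) * complex_of_real (1 / sqrt (real m)) = of_real (1 / real m)"
    by (simp flip: of_real_mult)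
  then have "cnj (block_col m b i r) * block_col m b j r = of_real (1 / real m) * (cnj (b (r, i)) * b (r, j))" for r
    unfolding block_col_def by (simp add: mult_ac)
  then show ?thesis
    by (simp add: finite_index.ip_def finite_index_def gram_def sum_distrib_left)
qed

lemma nsq_block_col:
  "finite_index.nsq {..<d} (block_col m b i) = (1 / real m) * (\<Sum>r<d. (cmod (b (r, i)))\<^sup>2)"
  by (simp add: finite_index.nsq_def finite_index_def block_col_def norm_mult power_mult_distrib
      norm_divide power_divide sum_distrib_left)

locale sensing_setting =
  fixes n m :: nat and p :: "nat \<Rightarrow> nat" and F :: "nat \<Rightarrow> (nat \<times> nat \<Rightarrow> complex) measure"
    and S :: "nat set" and \<Lambda> \<Gamma> \<epsilon> :: real
  assumes setting: "setting n m p F S \<Lambda> \<Gamma>" and eps: "0 < \<epsilon>" "\<epsilon> < 1"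
    and \<Lambda>_ge: "\<Lambda> \<ge> 50 * \<Gamma> * ln (3 * real n / \<epsilon>)"
    and m_ge: "real m \<ge> 100 * \<Lambda> * ln (3 * real n / \<epsilon>)"
begin

definition L :: real where "L = ln (3 * real n / \<epsilon>)"
definition r :: real where "r = \<Lambda> / real m"
text \<open>Product measures are handled by a locale that asks every component to be a probability
  space, whereas \<open>setting\<close> speaks only of \<open>l < m\<close>. Outside this range
  \<open>F 0\<close> is repeated, which is legitimate since \<open>m \<ge> 1\<close>.\<close>

definition F' :: "nat \<Rightarrow> (nat \<times> nat \<Rightarrow> complex) measure" where "F' l = (if l < m then F l else F 0)"

lemma basic: "1 \<le> n" "1 \<le> m" "S \<subseteq> {..<n}" "0 < \<Lambda>" "0 < \<Gamma>"
  and prob_F: "l < m \<Longrightarrow> prob_space (F l)"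
  and sets_F: "l < m \<Longrightarrow> sets (F l) = sets (block_space (p l) n)"
  and isotropy: "j < n \<Longrightarrow> k < n \<Longrightarrow>
      complex_of_real (1 / real m) * (\<Sum>l<m. integral\<^sup>L (F l) (\<lambda>B. gram {..<p l} B (j, k))) = (if j = k then 1 else 0)"
  and AE_\<Lambda>: "l < m \<Longrightarrow> AE B in F l. op_norm22 S S (gram {..<p l} B) \<le> \<Lambda>"
  and AE_\<Gamma>: "l < m \<Longrightarrow> AE B in F l. \<forall>i<n. (\<Sum>r<p l. (cmod (B (r, i)))\<^sup>2) \<le> \<Gamma>"
  using setting unfolding setting_def by auto

lemma prob_F': "prob_space (F' l)"
  using prob_F basic(2) by (auto simp: F'_def)

lemma PiM_F': "PiM {..<m} F' = PiM {..<m} F"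
  by (rule PiM_cong) (auto simp: F'_def)

lemma F'_eq: "l < m \<Longrightarrow> F' l = F l"
  by (simp add: F'_def)

lemma L_gt_1: "1 < L" and exp_L: "exp (- L) = \<epsilon> / (3 * real n)"
proof -
  have "3 \<le> 3 * real n / \<epsilon>" using basic(1) eps by (simp add: field_simps)
  moreover have "exp 1 < (3::real)" using e_less_272 by simp
  ultimately have "exp 1 < 3 * real n / \<epsilon>" by linarith
  then have "ln (exp 1) < ln (3 * real n / \<epsilon>)"
    by (subst ln_less_cancel_iff) (use eps basic(1) in auto)
  then show "1 < L" by (simp add: L_def)
  show "exp (- L) = \<epsilon> / (3 * real n)"
    using basic(1) eps by (simp add: L_def exp_minus)
qed

text \<open>The constants 50 and 100 in scaled form: \<open>r\<close> bounds the norm of a summand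
  of the Gram matrix, and \<open>\<Gamma> / m\<close> the squared norm of a column within a
  block.\<close>

lemma r_bounds: "0 < r" "r \<le> 1 / (100 * L)" "\<Gamma> / real m \<le> r / (50 * L)"
proof -
  have m: "0 < real m" using basic(2) by simp
  show "0 < r" using basic(4) m by (simp add: r_def)
  have L: "0 < L" using L_gt_1 by simp
  have "100 * \<Lambda> * L \<le> real m" "50 * \<Gamma> * L \<le> \<Lambda>"
    unfolding L_def by (rule m_ge \<Lambda>_ge)+
  then show "r \<le> 1 / (100 * L)" "\<Gamma> / real m \<le> r / (50 * L)"
    using L m by (simp_all add: r_def field_simps)
qed

sublocale S: finite_index S
  using basic(3) finite_subset by unfold_locales auto

lemma block_measurement: "measurement n S {..<p l}"
  using basic(3) by (simp add: measurement_def)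

abbreviation X :: "nat \<Rightarrow> (nat \<times> nat \<Rightarrow> complex) \<Rightarrow> nat cmat" where
  "X l b \<equiv> measurement.gramS S {..<p l} (block_col m b)"

abbreviation Y :: "nat \<Rightarrow> nat \<Rightarrow> (nat \<times> nat \<Rightarrow> complex) \<Rightarrow> nat \<Rightarrow> complex" where
  "Y i l b \<equiv> measurement.corr {..<p l} (block_col m b) i"

lemma X_eq: "X l b i j = (if i \<in> S \<and> j \<in> S then of_real (1 / real m) * gram {..<p l} b (i, j) else 0)"
  by (simp add: measurement.gramS_def[OF block_measurement] ip_block_col)

lemma Y_eq: "Y i l b j = of_real (1 / real m) * gram {..<p l} b (j, i)"
  by (simp add: measurement.corr_def[OF block_measurement] ip_block_col)

lemma measurable_entry:
  assumes "l < m" "d < p l" "j < n"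
  shows "(\<lambda>b. b (d, j)) \<in> borel_measurable (F l)"
proof -
  have "(\<lambda>b. b (d, j)) \<in> measurable (block_space (p l) n) borel"
    unfolding block_space_def using assms by (intro measurable_component_singleton) auto
  then show ?thesis using sets_F[OF assms(1)] by (simp cong: measurable_cong_sets)
qed

lemma measurable_gram:
  assumes "l < m" "i < n" "j < n"
  shows "(\<lambda>b. gram {..<p l} b (i, j)) \<in> borel_measurable (F l)"
proof -
  have [measurable]: "(\<lambda>b. b (d, k)) \<in> borel_measurable (F l)" if "d \<in> {..<p l}" "k < n" for d k
    using that assms(1) by (intro measurable_entry) auto
  have [measurable]: "cnj \<in> borel_measurable borel"
    by (intro borel_measurable_continuous_onI continuous_intros)
  show ?thesis unfolding gram_def using assms(2,3)
    by (simp add: prod.case) measurable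
qed

text \<open>Cauchy-Schwarz and the column bound make the entries almost surely bounded by
  \<open>\<Gamma>\<close>. The integrals in the isotropy condition are thus true expectations and
  not the default value of a nonintegrable function.\<close>

lemma integrable_gram:
  assumes "l < m" "i < n" "j < n"
  shows "integrable (F l) (\<lambda>b. gram {..<p l} b (i, j))"
proof -
  interpret prob_space "F l" using prob_F assms by blast
  interpret P: finite_index "{..<p l}" by unfold_locales simp
  show ?thesis
  proof (rule integrable_const_bound[OF _ measurable_gram[OF assms]])
    show "AE b in F l. norm (gram {..<p l} b (i, j)) \<le> \<Gamma>"
      using AE_\<Gamma>[OF assms(1)]
    proof eventually_elim
      case (elim b)
      have "norm (gram {..<p l} b (i, j)) = cmod (P.ip (\<lambda>r. b (r, i)) (\<lambda>r. b (r, j)))"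
        by (simp add: gram_def P.ip_def)
      also have "\<dots> \<le> sqrt (P.nsq (\<lambda>r. b (r, i))) * sqrt (P.nsq (\<lambda>r. b (r, j)))" by (rule P.cmod_ip_le)
      also have "\<dots> \<le> sqrt \<Gamma> * sqrt \<Gamma>"
        using elim assms basic(5) by (intro mult_mono real_sqrt_le_mono) (auto simp: P.nsq_def sum_nonneg)
      finally show ?case using basic(5) by simp
    qed
  qed
qed

lemma X_psd: "S.psd (X l b)"
  by (rule measurement.psd_gramS[OF block_measurement])

lemma measurable_X: "l < m \<Longrightarrow> (\<lambda>b. X l b i j) \<in> borel_measurable (F l)"
  unfolding X_eq using measurable_gram[of l i j] basic(3)
  by (cases "i \<in> S \<and> j \<in> S")
    (auto intro!: borel_measurable_times borel_measurable_const simp del: of_real_divide)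

lemma X_le:
  assumes "l < m" shows "AE b in F l. \<forall>v. S.qf (X l b) v \<le> r * S.nsq v"
  using AE_\<Lambda>[OF assms]
proof eventually_elim
  case (elim b)
  show ?case
  proof
    fix v
    let ?G = "gram {..<p l} b"
    have mv: "S.mv (X l b) v i = of_real (1 / real m) * matvec S ?G v i" if "i \<in> S" for i
      using that by (simp add: S.mv_def X_eq matvec_def sum_distrib_left mult.assoc)
    have vn: "sqrt (S.nsq (matvec S ?G v)) \<le> \<Lambda> * sqrt (S.nsq v)"
    proof -
      have "vnorm S (matvec S ?G v) \<le> op_norm22 S S ?G * vnorm S v"
        by (rule op_norm22_bound) (rule S.finite_S)+
      also have "\<dots> \<le> \<Lambda> * vnorm S v"
        using elim by (intro mult_right_mono) (simp_all add: vnorm_def sum_nonneg)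
      finally show ?thesis by (simp add: vnorm_nsq S.finite_S)
    qed
    have "S.qf (X l b) v \<le> cmod (S.ip v (\<lambda>i. of_real (1 / real m) * matvec S ?G v i))"
      unfolding S.qf_def using mv by (intro order_trans[OF complex_Re_le_cmod]) (simp cong: S.ip_cong)
    also have "\<dots> = (1 / real m) * cmod (S.ip v (matvec S ?G v))"
      by (subst S.ip_scale_right) (simp add: norm_mult norm_divide)
    also have "\<dots> \<le> (1 / real m) * (sqrt (S.nsq v) * sqrt (S.nsq (matvec S ?G v)))"
      by (intro mult_left_mono S.cmod_ip_le) simp
    also have "\<dots> \<le> (1 / real m) * (sqrt (S.nsq v) * (\<Lambda> * sqrt (S.nsq v)))"
      using vn by (intro mult_left_mono) auto
    finally show "S.qf (X l b) v \<le> r * S.nsq v"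
      by (simp add: r_def mult.left_commute)
  qed
qed

lemma sum_mean_X: "(\<lambda>i j. \<Sum>l<m. S.mean_mat (F l) (X l) i j) = S.id_mat"
proof (intro ext)
  fix i j
  show "(\<Sum>l<m. S.mean_mat (F l) (X l) i j) = S.id_mat i j"
  proof (cases "i \<in> S \<and> j \<in> S")
    case True
    then have "(\<Sum>l<m. S.mean_mat (F l) (X l) i j)
        = of_real (1 / real m) * (\<Sum>l<m. integral\<^sup>L (F l) (\<lambda>b. gram {..<p l} b (i, j)))"
      by (simp add: S.mean_mat_def X_eq sum_distrib_left)
    moreover have "i < n" "j < n" using True basic(3) by auto
    ultimately show ?thesis using isotropy[of i j] True by (auto simp: S.id_mat_def)
  qed (auto simp: S.mean_mat_def X_eq S.id_mat_def)
qed

text \<open>The product \<open>3 * L\<close> rounded up to an odd number: large enough for the decay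
  of \<open>(7 / 5)^q\<close>, small enough that \<open>q * r\<close> stays small.\<close>

definition q :: nat where "q = (SOME k. odd k \<and> 3 * L \<le> real k \<and> real k \<le> 3 * L + 2)"

lemma q: "odd q" "3 * L \<le> real q" "real q \<le> 3 * L + 2"
proof -
  define k where "k = nat \<lceil>3 * L\<rceil>"
  have k: "3 * L \<le> real k" "real k \<le> 3 * L + 1"
    using L_gt_1 unfolding k_def by linarith+
  have "\<exists>k. odd k \<and> 3 * L \<le> real k \<and> real k \<le> 3 * L + 2"
    by (cases "odd k") (use k in \<open>auto intro: exI[of _ k] exI[of _ "Suc k"]\<close>)
  from someI_ex[OF this] show "odd q" "3 * L \<le> real q" "real q \<le> 3 * L + 2"
    unfolding q_def by auto
qed

text \<open>The cube of 7/5 is 2.744, just above Euler's number; this is why the exponent is about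
  \<open>3 * L\<close>.\<close>

lemma exp_L_le: "exp L \<le> (7 / 5) ^ q"
proof -
  have "exp (1 / 3 :: real) ^ 3 = exp 1" by (simp flip: exp_of_nat_mult)
  also have "\<dots> \<le> (7 / 5) ^ 3" using e_less_272 by (simp add: power3_eq_cube)
  finally have e: "exp (1 / 3 :: real) \<le> 7 / 5" by (rule power_le_imp_le_base[of _ 2, unfolded numeral_3_eq_3[symmetric] Suc_eq_plus1, simplified]) simp
  have "exp L \<le> exp (real q * (1 / 3))" using q(2) by simp
  also have "\<dots> = exp (1 / 3) ^ q" by (rule exp_of_nat_mult)
  also have "\<dots> \<le> (7 / 5) ^ q" using e by (intro power_mono) auto
  finally show ?thesis .
qed

section \<open>Lower bound for the Gram matrix on the support\<close>

abbreviation G :: "(nat \<Rightarrow> nat \<times> nat \<Rightarrow> complex) \<Rightarrow> nat cmat" where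
  "G B \<equiv> measurement.gramS S (rows m p) (stacked_col m B)"

abbreviation Z :: "nat \<Rightarrow> (nat \<Rightarrow> nat \<times> nat \<Rightarrow> complex) \<Rightarrow> nat \<Rightarrow> complex" where
  "Z i B \<equiv> measurement.corr (rows m p) (stacked_col m B) i"

lemma stacked_measurement: "measurement n S (rows m p)"
  using basic(3) by (simp add: measurement_def finite_rows)

lemma G_eq: "G B = (\<lambda>i j. \<Sum>l<m. X l (B l) i j)"
  by (auto simp: measurement.gramS_def[OF stacked_measurement] measurement.gramS_def[OF block_measurement]
      ip_stacked_col fun_eq_iff)

lemma Z_eq: "Z i B j = (\<Sum>l<m. Y i l (B l) j)"
  by (simp add: measurement.corr_def[OF stacked_measurement] measurement.corr_def[OF block_measurement]
      ip_stacked_col)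

lemma G_tail:
  "measure (PiM {..<m} F) {B \<in> space (PiM {..<m} F). 1 \<le> S.inv_trace q ((1 / 2) *\<^sub>m S.id_mat + G B)}
    \<le> real (card S) * exp (- L)"
proof -
  have "measure (PiM {..<m} F') {B \<in> space (PiM {..<m} F'). 1 \<le> S.inv_trace q ((1 / 2) *\<^sub>m S.id_mat + (\<lambda>i j. \<Sum>l<m. X l (B l) i j))}
    \<le> real (card S) / (1 / 2 + 9 / 10) ^ q"
  proof (rule S.prob_inv_trace_ge_1[where r = r])
    show "finite {..<m}" by simp
    show "prob_space (F' l)" for l by (rule prob_F')
    show "(\<lambda>x. X l x i j) \<in> borel_measurable (F' l)" if "l \<in> {..<m}" for l i j
      using that measurable_X by (simp add: F'_def)
    show "S.psd (X l x)" for l x by (rule X_psd)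
    show "0 \<le> r" using r_bounds by simp
    show "AE x in F' l. \<forall>v. S.qf (X l x) v \<le> r * S.nsq v" if "l \<in> {..<m}" for l
    proof -
      have l: "l < m" using that by simp
      show ?thesis unfolding F'_eq[OF l] by (rule X_le[OF l])
    qed
    have "(\<Sum>l<m. S.mean_mat (F' l) (X l) i j) = (\<Sum>l<m. S.mean_mat (F l) (X l) i j)" for i j
      by (intro sum.cong) (auto simp: F'_def)
    then show "(\<lambda>i j. \<Sum>l<m. S.mean_mat (F' l) (X l) i j) = S.id_mat" using sum_mean_X by simp
    show "odd q" by (rule q)
    \<comment> \<open>With \<open>\<tau> = 1/2\<close> the lost fraction is
      \<open>(q + 1) * r\<close>; it is below 6/100 because \<open>L > 1\<close>, so
      \<open>c = 9/10\<close> is admissible.\<close>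
    have "(real q + 1) * r \<le> (3 * L + 3) * (1 / (100 * L))"
      using q(3) r_bounds L_gt_1 by (intro mult_mono) auto
    also have "\<dots> \<le> 1 / 10" using L_gt_1 by (simp add: field_simps)
    finally show "9 / 10 \<le> 1 - (real q + 1) * (r / (1 / 2)) / 2" by simp
  qed auto
  also have "real (card S) / (1 / 2 + 9 / 10) ^ q \<le> real (card S) / exp L"
    using exp_L_le by (intro divide_left_mono) auto
  finally show ?thesis unfolding PiM_F' G_eq by (simp add: exp_minus field_simps)
qed

end

section \<open>Correlations with the columns off the support\<close>

lemma (in finite_index) qf_sum: "qf (\<lambda>i j. \<Sum>l\<in>I. M l i j) v = (\<Sum>l\<in>I. qf (M l) v)"
proof -
  have "mv (\<lambda>i j. \<Sum>l\<in>I. M l i j) v i = (\<Sum>l\<in>I. mv (M l) v i)" for i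
    unfolding mv_def sum_distrib_right by (rule sum.swap)
  then have "ip v (mv (\<lambda>i j. \<Sum>l\<in>I. M l i j) v) = (\<Sum>i\<in>S. \<Sum>l\<in>I. cnj (v i) * mv (M l) v i)"
    by (simp add: ip_def sum_distrib_left)
  also have "\<dots> = (\<Sum>l\<in>I. ip v (mv (M l) v))" unfolding ip_def by (rule sum.swap)
  finally show ?thesis by (simp add: qf_def)
qed

text \<open>The Gaussian argument is real, so complex vectors over \<open>S\<close> become real
  vectors over \<open>S \<times> UNIV\<close>. The real pairing with \<open>u\<close> is then the
  real part of the complex pairing with \<open>complexify u\<close>.\<close>

definition realify :: "('i \<Rightarrow> complex) \<Rightarrow> 'i \<times> bool \<Rightarrow> real" where
  "realify y = (\<lambda>(j, t). if t then Re (y j) else Im (y j))"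

definition complexify :: "('i \<times> bool \<Rightarrow> real) \<Rightarrow> 'i \<Rightarrow> complex" where
  "complexify u j = Complex (u (j, True)) (u (j, False))"

context finite_index
begin

lemma sum_realify:
  fixes f :: "'i \<times> bool \<Rightarrow> 'b::comm_monoid_add"
  shows "(\<Sum>t\<in>S \<times> UNIV. f t) = (\<Sum>j\<in>S. f (j, True) + f (j, False))"
proof -
  have "(\<Sum>t\<in>S \<times> UNIV. f t) = (\<Sum>j\<in>S. \<Sum>t\<in>UNIV. f (j, t))"
    by (simp add: sum.cartesian_product)
  then show ?thesis by (simp add: UNIV_bool add.commute)
qed

lemma dot_realify:
  shows "gaussian_prior.dot (S \<times> UNIV) u (realify y) = Re (ip (complexify u) y)"
    and "gaussian_prior.dot (S \<times> UNIV) u u = nsq (complexify u)"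
    and "gaussian_prior.dot (S \<times> UNIV) (realify y) (realify y) = nsq y"
proof -
  interpret gaussian_prior "S \<times> (UNIV :: bool set)" 1
    using finite_S by unfold_locales auto
  show "dot u (realify y) = Re (ip (complexify u) y)"
    "dot u u = nsq (complexify u)" "dot (realify y) (realify y) = nsq y"
    unfolding dot_def sum_realify ip_def nsq_def cmod_power2
    by (auto simp: realify_def complexify_def power2_eq_square)
qed

end

context sensing_setting
begin

lemma nsq_block_col_eq: "finite_index.nsq {..<p l} (block_col m b i) = Re (of_real (1 / real m) * gram {..<p l} b (i, i))"
  unfolding ip_block_col[symmetric] by (simp add: finite_index.nsq_ip finite_index_def)

lemma nsq_block_col_le:
  assumes "l < m" "i < n"
  shows "AE b in F l. finite_index.nsq {..<p l} (block_col m b i) \<le> \<Gamma> / real m"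
  using AE_\<Gamma>[OF assms(1)] by eventually_elim (use assms in \<open>auto simp: nsq_block_col divide_right_mono\<close>)

lemma integrable_nsq_block_col:
  assumes "l < m" "i < n"
  shows "integrable (F l) (\<lambda>b. finite_index.nsq {..<p l} (block_col m b i))"
  unfolding nsq_block_col_eq by (intro integrable_Re integrable_mult_right integrable_gram assms)

lemma sum_integral_nsq_block_col:
  assumes "i < n"
  shows "(\<Sum>l<m. \<integral>b. finite_index.nsq {..<p l} (block_col m b i) \<partial>F l) = 1"
proof -
  have "(\<integral>b. finite_index.nsq {..<p l} (block_col m b i) \<partial>F l)
      = Re (of_real (1 / real m) * (\<integral>b. gram {..<p l} b (i, i) \<partial>F l))" if "l < m" for l
    unfolding nsq_block_col_eq
    by (subst integral_Re) (intro integrable_mult_right integrable_gram that assms, simp)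
  then have "(\<Sum>l<m. \<integral>b. finite_index.nsq {..<p l} (block_col m b i) \<partial>F l)
      = (\<Sum>l<m. Re (of_real (1 / real m) * (\<integral>b. gram {..<p l} b (i, i) \<partial>F l)))"
    by (intro sum.cong) auto
  also have "\<dots> = Re (of_real (1 / real m) * (\<Sum>l<m. \<integral>b. gram {..<p l} b (i, i) \<partial>F l))"
    by (simp only: sum_distrib_left Re_sum)
  also have "\<dots> = 1" by (subst isotropy[OF assms assms]) simp
  finally show ?thesis .
qed

lemma measurable_Y:
  assumes "l < m" "i < n" "j \<in> S"
  shows "(\<lambda>b. Y i l b j) \<in> borel_measurable (F l)"
proof -
  have "j < n" using assms basic(3) by auto
  from measurable_gram[OF assms(1) this assms(2)] show ?thesis
    unfolding Y_eq by (intro borel_measurable_times borel_measurable_const)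
qed

lemma integral_Y:
  assumes "l < m" "i < n" "j \<in> S"
  shows "integrable (F l) (\<lambda>b. Y i l b j)"
    and "(\<integral>b. Y i l b j \<partial>F l) = of_real (1 / real m) * (\<integral>b. gram {..<p l} b (j, i) \<partial>F l)"
proof -
  have "j < n" using assms basic(3) by auto
  from integrable_gram[OF assms(1) this assms(2)]
  show "integrable (F l) (\<lambda>b. Y i l b j)"
    "(\<integral>b. Y i l b j \<partial>F l) = of_real (1 / real m) * (\<integral>b. gram {..<p l} b (j, i) \<partial>F l)"
    unfolding Y_eq by (auto simp del: of_real_divide)
qed

lemma Y_bounds:
  assumes "l < m" "i < n"
  shows "AE b in F l. S.nsq (Y i l b) \<le> r * finite_index.nsq {..<p l} (block_col m b i)"
    and "AE b in F l. (Re (S.ip v (Y i l b)))\<^sup>2 \<le> \<Gamma> / real m * S.qf (X l b) v"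
proof -
  show "AE b in F l. S.nsq (Y i l b) \<le> r * finite_index.nsq {..<p l} (block_col m b i)"
    using X_le[OF assms(1)]
    by eventually_elim (use measurement.nsq_corr_le[OF block_measurement] r_bounds in auto)
  show "AE b in F l. (Re (S.ip v (Y i l b)))\<^sup>2 \<le> \<Gamma> / real m * S.qf (X l b) v"
    using nsq_block_col_le[OF assms]
  proof eventually_elim
    case (elim b)
    have "(Re (S.ip v (Y i l b)))\<^sup>2 \<le> S.qf (X l b) v * finite_index.nsq {..<p l} (block_col m b i)"
      by (rule measurement.ip_corr_square_le[OF block_measurement])
    also have "\<dots> \<le> S.qf (X l b) v * (\<Gamma> / real m)"
      using elim X_psd by (intro mult_left_mono) (auto simp: S.psd_def)
    finally show ?case by (simp add: mult.commute)
  qed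
qed

text \<open>For a column off the support isotropy makes the means of the summands cancel in total
  but not block by block, which is why \<open>vector_Bernstein\<close> admits individual means
  \<open>\<mu>\<close>. It is applied with total variance \<open>1 / (100 * L)\<close> and weak
  variance \<open>1 / (5000 * L^2)\<close>.\<close>

lemma Z_tail:
  assumes i: "i < n" "i \<notin> S"
  shows "measure (PiM {..<m} F) {B \<in> space (PiM {..<m} F). (15 / 100)\<^sup>2 / L \<le> S.nsq (Z i B)} \<le> exp (- L)"
proof -
  define w where "w = sqrt L"
  have w: "1 < w" "L = w\<^sup>2" using L_gt_1 by (auto simp: w_def)
  have w0: "0 < w" using w by simp
  \<comment> \<open>\<open>s^2 = \<theta> / sqrt V\<close> with \<open>V = 1 / (100 * w^2)\<close>,
    which balances the relative entropy against the total-variance term: both are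
    \<open>5 / 2 * L\<close>.\<close>
  define s where "s = sqrt 500 * w\<^sup>2"
  \<comment> \<open>A round value above the almost sure bound: \<open>K^2\<close> is twice
    \<open>1 / (500000 * w^6)\<close>, which dominates \<open>r * (\<Gamma> / m)\<close>.\<close>
  define K where "K = 1 / (500 * w ^ 3)"
  \<comment> \<open>Chosen so that the weak-variance term of the exponent is exactly
    \<open>L\<close>.\<close>
  define \<theta> where "\<theta> = 50 * w ^ 3"
  have s: "0 < s" "s\<^sup>2 = 500 * w ^ 4"
    using w0 by (auto simp: s_def power_mult_distrib)
  have sK: "s\<^sup>2 * K\<^sup>2 \<le> 1 / 500" and \<theta>K: "\<theta> * K = 1 / 10"
  proof -
    have "s\<^sup>2 * K\<^sup>2 = 1 / (500 * w\<^sup>2)"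
      unfolding s(2) using w0 by (simp add: K_def power_divide power_mult_distrib field_simps eval_nat_numeral)
    also have "\<dots> \<le> 1 / 500" using w by (simp add: divide_le_eq_1)
    finally show "s\<^sup>2 * K\<^sup>2 \<le> 1 / 500" .
    show "\<theta> * K = 1 / 10" using w0 by (simp add: \<theta>_def K_def)
  qed
  have rw: "r \<le> 1 / (100 * w\<^sup>2)" using r_bounds w by simp
  have \<Gamma>w: "\<Gamma> / real m \<le> 1 / (5000 * w ^ 4)"
  proof -
    have "\<Gamma> / real m \<le> r / (50 * w\<^sup>2)" using r_bounds w by simp
    also have "\<dots> \<le> 1 / (100 * w\<^sup>2) / (50 * w\<^sup>2)" using rw by (intro divide_right_mono) auto
    finally show ?thesis by (simp add: power2_eq_square power4_eq_xxxx)
  qed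
  have r\<Gamma>: "r * (\<Gamma> / real m) \<le> K\<^sup>2"
  proof -
    have "r * (\<Gamma> / real m) \<le> 1 / (100 * w\<^sup>2) * (1 / (5000 * w ^ 4))"
      using rw \<Gamma>w r_bounds basic by (intro mult_mono) auto
    also have "\<dots> \<le> K\<^sup>2" using w0 by (simp add: K_def power_divide power_mult_distrib field_simps eval_nat_numeral)
    finally show ?thesis .
  qed
  interpret P: gaussian_prior "S \<times> (UNIV :: bool set)" s
    using S.finite_S s by unfold_locales auto
  note dot = S.dot_realify
  have F: "F' l = F l" if "l \<in> {..<m}" for l using that F'_eq by simp
  define \<mu> where "\<mu> l = realify (\<lambda>j. \<integral>b. Y i l b j \<partial>F' l)" for l
  have sum_Y: "(\<lambda>t. \<Sum>l<m. realify (Y i l (B l)) t) = realify (Z i B)" for B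
    by (auto simp: realify_def Z_eq fun_eq_iff)
  have "measure (PiM {..<m} F') {B \<in> space (PiM {..<m} F').
        (15 / (100 * w))\<^sup>2 \<le> P.dot (\<lambda>t. \<Sum>l<m. realify (Y i l (B l)) t) (\<lambda>t. \<Sum>l<m. realify (Y i l (B l)) t)}
      \<le> exp (- \<theta> * (15 / (100 * w)) + \<theta>\<^sup>2 / (2 * s\<^sup>2) + s\<^sup>2 * (1 / (100 * w\<^sup>2)) / 2 * (1 + s\<^sup>2 * K\<^sup>2)
          + 2 * (1 / (5000 * w ^ 4)) * \<theta>\<^sup>2)"
  proof (rule P.vector_Bernstein[where \<mu> = \<mu>])
    show "finite {..<m}" by simp
    show "prob_space (F' l)" for l by (rule prob_F')
    show "(\<lambda>x. realify (Y i l x) t) \<in> borel_measurable (F' l)"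
      if "l \<in> {..<m}" "t \<in> S \<times> UNIV" for l t
    proof -
      obtain j b where t: "t = (j, b)" by (cases t)
      have [measurable]: "(\<lambda>x. Y i l x j) \<in> borel_measurable (F l)"
        using that i by (intro measurable_Y) (auto simp: t)
      show ?thesis unfolding F[OF that(1)] realify_def t prod.case by (cases b; simp; measurable)
    qed
    show "AE x in F' l. P.dot (realify (Y i l x)) (realify (Y i l x)) \<le> K\<^sup>2" if "l \<in> {..<m}" for l
    proof -
      have l: "l < m" using that by simp
      show ?thesis unfolding F[OF that] dot(3)
        using Y_bounds(1)[OF l i(1)] nsq_block_col_le[OF l i(1)]
      proof eventually_elim
        case (elim x)
        have "r * finite_index.nsq {..<p l} (block_col m x i) \<le> r * (\<Gamma> / real m)"
          using elim(2) r_bounds by (intro mult_left_mono) auto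
        then show ?case using elim(1) r\<Gamma> by linarith
      qed
    qed
    show "(\<integral>x. realify (Y i l x) t \<partial>F' l) = \<mu> l t" if "l \<in> {..<m}" "t \<in> S \<times> UNIV" for l t
    proof -
      obtain j b where t: "t = (j, b)" by (cases t)
      have "integrable (F' l) (\<lambda>x. Y i l x j)"
        unfolding F[OF that(1)] using that i by (intro integral_Y) (auto simp: t)
      from integral_Re[OF this] integral_Im[OF this] show ?thesis
        unfolding \<mu>_def realify_def t prod.case by (cases b; simp)
    qed
    show "(\<Sum>l<m. \<mu> l t) = 0" if t: "t \<in> S \<times> UNIV" for t
    proof -
      have j: "fst t \<in> S" "fst t < n" using t basic(3) by auto
      have "(\<Sum>l<m. \<integral>b. Y i l b (fst t) \<partial>F' l)
          = (\<Sum>l<m. of_real (1 / real m) * (\<integral>b. gram {..<p l} b (fst t, i) \<partial>F l))"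
        using integral_Y(2)[OF _ i(1) j(1)] by (intro sum.cong) (auto simp: F)
      also have "\<dots> = of_real (1 / real m) * (\<Sum>l<m. \<integral>b. gram {..<p l} b (fst t, i) \<partial>F l)"
        by (rule sum_distrib_left[symmetric])
      also have "\<dots> = 0" using isotropy[OF j(2) i(1)] j(1) i(2) by auto
      finally have "(\<Sum>l<m. Re (\<integral>b. Y i l b (fst t) \<partial>F' l)) = 0" "(\<Sum>l<m. Im (\<integral>b. Y i l b (fst t) \<partial>F' l)) = 0"
        unfolding Re_sum[symmetric] Im_sum[symmetric] by simp_all
      then show ?thesis unfolding \<mu>_def realify_def by (cases t; cases "snd t"; simp)
    qed
    show "(\<Sum>l<m. \<integral>x. P.dot (realify (Y i l x)) (realify (Y i l x)) \<partial>F' l) \<le> 1 / (100 * w\<^sup>2)"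
    proof -
      have "(\<Sum>l<m. \<integral>x. P.dot (realify (Y i l x)) (realify (Y i l x)) \<partial>F' l)
          \<le> (\<Sum>l<m. \<integral>b. r * finite_index.nsq {..<p l} (block_col m b i) \<partial>F l)"
      proof (intro sum_mono)
        fix l assume lm: "l \<in> {..<m}"
        then have l: "l < m" by simp
        show "(\<integral>x. P.dot (realify (Y i l x)) (realify (Y i l x)) \<partial>F' l)
          \<le> (\<integral>b. r * finite_index.nsq {..<p l} (block_col m b i) \<partial>F l)"
          unfolding F[OF lm] dot(3)
        proof (rule integral_mono_AE')
          show "integrable (F l) (\<lambda>b. r * finite_index.nsq {..<p l} (block_col m b i))"
            by (intro integrable_mult_right integrable_nsq_block_col l i)
          show "AE b in F l. S.nsq (Y i l b) \<le> r * finite_index.nsq {..<p l} (block_col m b i)"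
            by (rule Y_bounds(1)[OF l i(1)])
          show "AE b in F l. 0 \<le> r * finite_index.nsq {..<p l} (block_col m b i)"
            using r_bounds by (simp add: nsq_block_col sum_nonneg)
        qed
      qed
      also have "\<dots> = r"
        using sum_integral_nsq_block_col[OF i(1)] by (simp flip: sum_distrib_left)
      finally show ?thesis using rw by simp
    qed
    show "(\<Sum>l<m. \<integral>x. (P.dot u (realify (Y i l x)))\<^sup>2 \<partial>F' l) \<le> 1 / (5000 * w ^ 4) * P.dot u u" for u
    proof -
      let ?v = "complexify u"
      have "(\<Sum>l<m. \<integral>x. (P.dot u (realify (Y i l x)))\<^sup>2 \<partial>F' l)
          \<le> (\<Sum>l<m. \<Gamma> / real m * S.qf (S.mean_mat (F l) (X l)) ?v)"
      proof (intro sum_mono)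
        fix l assume lm: "l \<in> {..<m}"
        then have l: "l < m" by simp
        note iX = prob_F[OF l] measurable_X[OF l] X_psd r_bounds(1)[THEN less_imp_le] X_le[OF l]
        have "(\<integral>x. (P.dot u (realify (Y i l x)))\<^sup>2 \<partial>F' l) \<le> (\<integral>b. \<Gamma> / real m * S.qf (X l b) ?v \<partial>F l)"
          unfolding F[OF lm] dot(1)
        proof (rule integral_mono_AE')
          show "integrable (F l) (\<lambda>b. \<Gamma> / real m * S.qf (X l b) ?v)"
            by (intro integrable_mult_right S.integrable_qf[OF iX])
          show "AE b in F l. (Re (S.ip ?v (Y i l b)))\<^sup>2 \<le> \<Gamma> / real m * S.qf (X l b) ?v"
            by (rule Y_bounds(2)[OF l i(1)])
          show "AE b in F l. 0 \<le> \<Gamma> / real m * S.qf (X l b) ?v"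
            using X_psd basic by (simp add: S.psd_def)
        qed
        also have "\<dots> = \<Gamma> / real m * (\<integral>b. S.qf (X l b) ?v \<partial>F l)" by (rule integral_mult_right_zero)
        also have "(\<integral>b. S.qf (X l b) ?v \<partial>F l) = S.qf (S.mean_mat (F l) (X l)) ?v"
          by (rule S.integral_qf[OF iX])
        finally show "(\<integral>x. (P.dot u (realify (Y i l x)))\<^sup>2 \<partial>F' l)
          \<le> \<Gamma> / real m * S.qf (S.mean_mat (F l) (X l)) ?v" .
      qed
      also have "\<dots> = \<Gamma> / real m * S.nsq ?v"
        unfolding sum_distrib_left[symmetric] S.qf_sum[symmetric] sum_mean_X S.qf_id ..
      also have "\<dots> \<le> 1 / (5000 * w ^ 4) * S.nsq ?v" by (intro mult_right_mono \<Gamma>w) simp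
      finally show ?thesis by (simp add: dot(2))
    qed
    show "0 \<le> K" using w0 by (simp add: K_def)
    show "\<theta> * K + s\<^sup>2 * K\<^sup>2 / 2 \<le> 1" using sK \<theta>K by simp
    show "0 < \<theta>" "0 < 15 / (100 * w)" using w0 by (auto simp: \<theta>_def)
  qed
  also have "\<dots> \<le> exp (- L)"
  proof -
    \<comment> \<open>In units of \<open>L\<close> the exponent is -15/2 + 5/2 + 5/2 + 1 plus a
      correction of at most 1/200, which is below -1.\<close>
    have e: "- \<theta> * (15 / (100 * w)) = - (15 / 2 * L)" "\<theta>\<^sup>2 / (2 * s\<^sup>2) = 5 / 2 * L"
      "s\<^sup>2 * (1 / (100 * w\<^sup>2)) / 2 = 5 / 2 * L" "2 * (1 / (5000 * w ^ 4)) * \<theta>\<^sup>2 = L"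
      unfolding s(2) using w0 by (simp_all add: \<theta>_def w(2) power_mult_distrib field_simps eval_nat_numeral)
    define c where "c = 5 / 2 * L * (1 + s\<^sup>2 * K\<^sup>2)"
    have "c \<le> 5 / 2 * L * (1 + 1 / 500)"
      unfolding c_def using sK L_gt_1 by (intro mult_left_mono) auto
    then have "c \<le> 501 / 200 * L" by simp
    then show ?thesis unfolding exp_le_cancel_iff e c_def[symmetric] using L_gt_1 by linarith
  qed
  finally show ?thesis
    unfolding sum_Y dot(3) PiM_F' by (simp add: w(2) power_divide power_mult_distrib)
qed

section \<open>The good event and its probability\<close>

abbreviation BM :: "(nat \<Rightarrow> nat \<times> nat \<Rightarrow> complex) measure" where "BM \<equiv> PiM {..<m} F"

lemma prob_BM: "prob_space BM"
  unfolding PiM_F'[symmetric] by (rule prob_space_PiM[OF prob_F'])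

lemma measurable_G: "(\<lambda>B. G B i j) \<in> borel_measurable BM"
  unfolding G_eq
proof (rule borel_measurable_sum)
  fix l assume l: "l \<in> {..<m}"
  then have "l < m" by simp
  from measurable_compose[OF measurable_component_singleton[OF l, of F] measurable_X[OF this]]
  show "(\<lambda>B. X l (B l) i j) \<in> borel_measurable BM" .
qed

lemma measurable_Z:
  assumes "i < n" "j \<in> S" shows "(\<lambda>B. Z i B j) \<in> borel_measurable BM"
  unfolding Z_eq
proof (rule borel_measurable_sum)
  fix l assume l: "l \<in> {..<m}"
  then have "l < m" by simp
  from measurable_compose[OF measurable_component_singleton[OF l, of F] measurable_Y[OF this assms]]
  show "(\<lambda>B. Y i l (B l) j) \<in> borel_measurable BM" .
qed

definition dual :: "nat \<Rightarrow> (nat \<Rightarrow> nat \<times> nat \<Rightarrow> complex) \<Rightarrow> nat \<Rightarrow> complex" where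
  "dual i B = S.mv (S.minv (G B)) (Z i B)"

lemma measurable_dual: "i < n \<Longrightarrow> (\<lambda>B. dual i B j) \<in> borel_measurable BM"
  unfolding dual_def S.mv_def
  by (intro borel_measurable_sum borel_measurable_times S.measurable_minv_entry measurable_G measurable_Z)

text \<open>These conditions concern the matrix only; the signs are treated afterwards for a fixed
  good matrix. The strict inequalities are the complements of the events in \<open>G_tail\<close>
  and \<open>Z_tail\<close>.\<close>

definition good :: "(nat \<Rightarrow> nat \<times> nat \<Rightarrow> complex) \<Rightarrow> bool" where
  "good B \<longleftrightarrow> S.inv_trace q ((1 / 2) *\<^sub>m S.id_mat + G B) < 1 \<and>
    (\<forall>i\<in>{..<n} - S. S.nsq (Z i B) < (15 / 100)\<^sup>2 / L)"

text \<open>The Gram matrix costs \<open>card S\<close> and the columns off the support cost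
  \<open>n - card S\<close> terms \<open>exp (- L)\<close>; together these are
  \<open>n * exp (- L) = \<epsilon> / 3\<close>.\<close>

lemma sets_good: "{B \<in> space BM. good B} \<in> sets BM"
  and prob_good: "1 - \<epsilon> / 3 \<le> measure BM {B \<in> space BM. good B}"
proof -
  interpret prob_space BM by (rule prob_BM)
  note [measurable] = measurable_G
  have [measurable]: "(\<lambda>B. S.inv_trace q ((1 / 2) *\<^sub>m S.id_mat + G B)) \<in> borel_measurable BM"
    by (intro S.measurable_inv_trace) (simp add: smult_mat_def)
  have nsq_Z: "(\<lambda>B. S.nsq (Z i B)) \<in> borel_measurable BM" if "i < n" for i
    unfolding S.nsq_def using measurable_Z[OF that] by measurable
  define A where "A = {B \<in> space BM. 1 \<le> S.inv_trace q ((1 / 2) *\<^sub>m S.id_mat + G B)}"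
  define C where "C i = {B \<in> space BM. (15 / 100)\<^sup>2 / L \<le> S.nsq (Z i B)}" for i
  have [measurable]: "A \<in> sets BM" unfolding A_def by measurable
  have C_sets: "C i \<in> sets BM" if "i \<in> {..<n} - S" for i
  proof -
    have [measurable]: "(\<lambda>B. S.nsq (Z i B)) \<in> borel_measurable BM" using that by (intro nsq_Z) auto
    show ?thesis unfolding C_def by measurable
  qed
  have UC: "(\<Union>i\<in>{..<n} - S. C i) \<in> sets BM" using C_sets by (intro sets.finite_UN) auto
  have eq: "{B \<in> space BM. good B} = space BM - (A \<union> (\<Union>i\<in>{..<n} - S. C i))"
    unfolding good_def A_def C_def not_le[symmetric] by blast
  show "{B \<in> space BM. good B} \<in> sets BM" unfolding eq using UC by auto
  have "prob (A \<union> (\<Union>i\<in>{..<n} - S. C i)) \<le> prob A + prob (\<Union>i\<in>{..<n} - S. C i)"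
    using UC by (intro measure_Un_le) auto
  also have "prob (\<Union>i\<in>{..<n} - S. C i) \<le> (\<Sum>i\<in>{..<n} - S. prob (C i))"
    using C_sets by (intro measure_UNION_le) auto
  also have "\<dots> \<le> (\<Sum>i\<in>{..<n} - S. exp (- L))"
    unfolding C_def by (intro sum_mono Z_tail) auto
  also have "\<dots> = real (card ({..<n} - S)) * exp (- L)" by simp
  also have "prob A \<le> real (card S) * exp (- L)" unfolding A_def by (rule G_tail)
  also have "real (card S) * exp (- L) + real (card ({..<n} - S)) * exp (- L) = real n * exp (- L)"
  proof -
    have "card S + card ({..<n} - S) = n"
      using basic(3) by (subst card_Diff_subset) (auto simp: S.finite_S card_mono[of "{..<n}" S, simplified])
    then show ?thesis by (simp flip: distrib_right of_nat_add)
  qed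
  also have "\<dots> = \<epsilon> / 3" unfolding exp_L using basic(1) by simp
  finally have "prob (A \<union> (\<Union>i\<in>{..<n} - S. C i)) \<le> \<epsilon> / 3" by simp
  then show "1 - \<epsilon> / 3 \<le> prob {B \<in> space BM. good B}"
    unfolding eq using UC by (subst prob_compl) auto
qed

lemma G_lower: "good B \<Longrightarrow> (1 / 2) * S.nsq v \<le> S.qf (G B) v"
proof -
  assume g: "good B"
  have "S.posdef (1 / 2) ((1 / 2) *\<^sub>m S.id_mat)"
    by (simp add: S.posdef_def S.herm_def S.supported_smult adj_mat_smult S.qf_smult S.qf_id)
  then have "S.posdef (1 / 2) ((1 / 2) *\<^sub>m S.id_mat + G B)"
    by (rule S.posdef_add) (rule measurement.psd_gramS[OF stacked_measurement])
  from S.inv_trace_less_1[OF this _ q(1), of v] g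
  show ?thesis by (simp add: good_def S.qf_add S.qf_smult S.qf_id)
qed

text \<open>The inverse Gram matrix has norm at most 2, so the bound on the correlation is
  multiplied by 4, and \<open>4 * (15 / 100)^2 = 9 / 100\<close>.\<close>

lemma nsq_dual:
  assumes g: "good B" and i: "i \<in> {..<n} - S"
  shows "S.nsq (dual i B) \<le> 9 / (100 * L)"
proof -
  have pG: "S.psd (G B)" by (rule measurement.psd_gramS[OF stacked_measurement])
  have iK: "S.inverse_of (G B) (S.minv (G B))"
    using G_lower[OF g] pG by (intro S.posdef_inverse[of "1 / 2"]) (simp add: S.posdef_def S.psd_def)
  have K2: "S.qf (S.minv (G B)) v \<le> 2 * S.nsq v" for v
    using S.inverse_of_le[OF pG iK _ G_lower[OF g], of v] by simp
  have "S.nsq (dual i B) \<le> 2 * S.qf (S.minv (G B)) (Z i B)"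
    unfolding dual_def by (rule S.nsq_mv_le[OF S.inverse_of_psd[OF pG iK] K2])
  also have "\<dots> \<le> 2 * (2 * S.nsq (Z i B))" by (intro mult_left_mono K2) simp
  also have "S.nsq (Z i B) \<le> (15 / 100)\<^sup>2 / L" using g i unfolding good_def by (meson less_imp_le)
  finally show ?thesis by (simp add: power2_eq_square)
qed

abbreviation "SM b \<equiv> PiM S (\<lambda>_. sign_dist b)"

definition bad_signs where
  "bad_signs b i B = {\<sigma> \<in> space (SM b). 9 / 10 < cmod (S.ip (dual i B) \<sigma>)}"

lemma measurable_ip_signs: "(\<lambda>\<sigma>. S.ip v \<sigma>) \<in> borel_measurable (SM b)"
  unfolding S.ip_def
  by (intro borel_measurable_sum borel_measurable_times borel_measurable_const measurable_sign_component)

lemma prob_bad_signs: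
  assumes g: "good B" and i: "i \<in> {..<n} - S"
  shows "measure (SM b) (bad_signs b i B) \<le> 4 * exp (- 2 * L)"
proof -
  have L: "0 < L" using L_gt_1 by simp
  have "measure (SM b) {\<sigma> \<in> space (SM b). 9 / 10 < cmod (\<Sum>j\<in>S. cnj (dual i B j) * \<sigma> j)}
      \<le> 4 * exp (- (9 / 10)\<^sup>2 / (4 * (9 / (100 * L))))"
    by (rule sign_sum_tail)
      (use nsq_dual[OF g i] S.finite_S L in \<open>auto simp: S.nsq_def\<close>)
  \<comment> \<open>The exponent is \<open>9 / 4 * L\<close>, since 81/100 divided by 36/100 is
    9/4.\<close>
  also have "\<dots> \<le> 4 * exp (- 2 * L)" using L by (simp add: power2_eq_square field_simps)
  finally show ?thesis by (simp add: bad_signs_def S.ip_def)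
qed

text \<open>The exponent \<open>2 * L\<close> supplies \<open>(\<epsilon> / (3 * n))^2\<close>;
  after the union over at most \<open>n\<close> columns, \<open>4 * \<epsilon>^2 / (9 * n)\<close>
  remains, which is at most \<open>4 * \<epsilon> / 9\<close>.\<close>

lemma good_signs:
  assumes g: "good B"
  shows "1 - 4 * \<epsilon> / 9 \<le> measure (SM b)
    {\<sigma> \<in> space (SM b). (\<forall>j\<in>S. cmod (\<sigma> j) = 1) \<and> (\<forall>i\<in>{..<n} - S. cmod (S.ip (dual i B) \<sigma>) \<le> 9 / 10)}"
    (is "_ \<le> measure _ ?A")
proof -
  interpret prob_space "SM b" by (rule prob_space_signs)
  have bad: "bad_signs b i B \<in> events" for i
    unfolding bad_signs_def using measurable_ip_signs[of "dual i B" b] by measurable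
  have A: "?A \<in> events"
  proof -
    have [measurable]: "(\<lambda>\<sigma>. S.ip (dual i B) \<sigma>) \<in> borel_measurable (SM b)" for i
      by (rule measurable_ip_signs)
    have [measurable]: "(\<lambda>\<sigma>. \<sigma> j) \<in> borel_measurable (SM b)" if "j \<in> S" for j
      using that by (rule measurable_sign_component)
    show ?thesis using S.finite_S by measurable
  qed
  have UB: "(\<Union>i\<in>{..<n} - S. bad_signs b i B) \<in> events" using bad by (intro sets.finite_UN) auto
  have "prob (\<Union>i\<in>{..<n} - S. bad_signs b i B) \<le> (\<Sum>i\<in>{..<n} - S. prob (bad_signs b i B))"
    using bad by (intro measure_UNION_le) auto
  also have "\<dots> \<le> (\<Sum>i\<in>{..<n} - S. 4 * exp (- 2 * L))" by (intro sum_mono prob_bad_signs g)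
  also have "\<dots> \<le> real n * (4 * exp (- 2 * L))"
  proof -
    have "card ({..<n} - S) \<le> n" using card_mono[of "{..<n}" "{..<n} - S"] by auto
    then show ?thesis by simp
  qed
  also have "\<dots> = 4 * \<epsilon> / 9 * (\<epsilon> / real n)"
  proof -
    have "exp (- 2 * L) = exp (- L) * exp (- L)" by (simp flip: exp_add)
    then show ?thesis unfolding exp_L using basic(1) by (simp add: field_simps)
  qed
  also have "\<dots> \<le> 4 * \<epsilon> / 9 * 1" using eps basic(1) by (intro mult_left_mono) auto
  finally have b: "prob (\<Union>i\<in>{..<n} - S. bad_signs b i B) \<le> 4 * \<epsilon> / 9" by simp
  have "1 - prob (\<Union>i\<in>{..<n} - S. bad_signs b i B) = prob (space (SM b) - (\<Union>i\<in>{..<n} - S. bad_signs b i B))"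
    using UB by (simp add: prob_compl)
  also have "\<dots> \<le> prob ?A"
  proof (rule finite_measure_mono_AE[OF _ A])
    show "AE \<sigma> in SM b. \<sigma> \<in> space (SM b) - (\<Union>i\<in>{..<n} - S. bad_signs b i B) \<longrightarrow> \<sigma> \<in> ?A"
      using AE_signs_unit[OF S.finite_S, of b] by eventually_elim (auto simp: bad_signs_def not_less)
  qed
  finally show ?thesis using b by simp
qed

text \<open>Unit modulus of the signs holds only almost surely, whereas recovery is asserted at
  every point of the event; hence it is part of the event.\<close>

definition good_event where
  "good_event b = {\<omega> \<in> space (BM \<Otimes>\<^sub>M SM b). good (fst \<omega>) \<and> (\<forall>j\<in>S. cmod (snd \<omega> j) = 1) \<and>
    (\<forall>i\<in>{..<n} - S. cmod (S.ip (dual i (fst \<omega>)) (snd \<omega>)) \<le> 9 / 10)}"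

lemma sets_good_event: "good_event b \<in> sets (BM \<Otimes>\<^sub>M SM b)"
proof -
  have s [measurable]: "(\<lambda>\<omega>. snd \<omega> j) \<in> borel_measurable (BM \<Otimes>\<^sub>M SM b)" if "j \<in> S" for j
    by (rule measurable_compose[OF measurable_snd measurable_sign_component[OF that]])
  have [measurable]: "cnj \<in> borel_measurable borel"
    by (intro borel_measurable_continuous_onI continuous_intros)
  have "(\<lambda>\<omega>. dual i (fst \<omega>) j) \<in> borel_measurable (BM \<Otimes>\<^sub>M SM b)" if "i < n" for i j
    by (rule measurable_compose[OF measurable_fst measurable_dual[OF that]])
  note d = this
  have ip: "(\<lambda>\<omega>. S.ip (dual i (fst \<omega>)) (snd \<omega>)) \<in> borel_measurable (BM \<Otimes>\<^sub>M SM b)" if "i < n" for i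
    unfolding S.ip_def using d[OF that] s by measurable
  have "{\<omega> \<in> space (BM \<Otimes>\<^sub>M SM b). good (fst \<omega>)}
      = fst -` {B \<in> space BM. good B} \<inter> space (BM \<Otimes>\<^sub>M SM b)"
    by (auto simp: space_pair_measure)
  then have "{\<omega> \<in> space (BM \<Otimes>\<^sub>M SM b). good (fst \<omega>)} \<in> sets (BM \<Otimes>\<^sub>M SM b)"
    using measurable_sets[OF measurable_fst sets_good] by simp
  moreover have "{\<omega> \<in> space (BM \<Otimes>\<^sub>M SM b). cmod (snd \<omega> j) = 1} \<in> sets (BM \<Otimes>\<^sub>M SM b)" if "j \<in> S" for j
  proof -
    note [measurable] = s[OF that]
    show ?thesis by measurable
  qed
  moreover have "{\<omega> \<in> space (BM \<Otimes>\<^sub>M SM b). cmod (S.ip (dual i (fst \<omega>)) (snd \<omega>)) \<le> 9 / 10}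
      \<in> sets (BM \<Otimes>\<^sub>M SM b)" if "i \<in> {..<n} - S" for i
  proof -
    have [measurable]: "(\<lambda>\<omega>. S.ip (dual i (fst \<omega>)) (snd \<omega>)) \<in> borel_measurable (BM \<Otimes>\<^sub>M SM b)"
      using that by (intro ip) auto
    show ?thesis by measurable
  qed
  ultimately show ?thesis unfolding good_event_def
    by (intro sets.sets_Collect_conj sets.sets_Collect_finite_All S.finite_S) auto
qed

text \<open>Fubini over the matrices: each good matrix leaves the signs a success probability of at
  least \<open>1 - 4 * \<epsilon> / 9\<close>. The product with \<open>1 - \<epsilon> / 3\<close>
  suffices because 4/9 + 1/3 is less than 1.\<close>

lemma prob_good_event: "1 - \<epsilon> \<le> measure (BM \<Otimes>\<^sub>M SM b) (good_event b)"
proof -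
  interpret B: prob_space BM by (rule prob_BM)
  interpret M: prob_space "SM b" by (rule prob_space_signs)
  interpret P: pair_prob_space BM "SM b" ..
  let ?A = "{B \<in> space BM. good B}"
  let ?c = "1 - 4 * \<epsilon> / 9"
  have c0: "0 \<le> ?c" using eps by simp
  have "ennreal (?c * measure BM ?A) = ennreal ?c * emeasure BM ?A"
    using c0 by (simp add: ennreal_mult B.emeasure_eq_measure)
  also have "\<dots> = (\<integral>\<^sup>+B. ennreal ?c * indicator ?A B \<partial>BM)"
    by (rule nn_integral_cmult_indicator[OF sets_good, symmetric])
  also have "\<dots> \<le> (\<integral>\<^sup>+B. emeasure (SM b) (Pair B -` good_event b) \<partial>BM)"
  proof (rule nn_integral_mono)
    fix B assume B: "B \<in> space BM"
    show "ennreal ?c * indicator ?A B \<le> emeasure (SM b) (Pair B -` good_event b)"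
    proof (cases "good B")
      case True
      have "Pair B -` good_event b = {\<sigma> \<in> space (SM b). (\<forall>j\<in>S. cmod (\<sigma> j) = 1) \<and>
          (\<forall>i\<in>{..<n} - S. cmod (S.ip (dual i B) \<sigma>) \<le> 9 / 10)}"
        using B True by (auto simp: good_event_def space_pair_measure)
      then show ?thesis
        using good_signs[OF True, of b] B True by (simp add: M.emeasure_eq_measure ennreal_leI)
    qed simp
  qed
  also have "\<dots> = emeasure (BM \<Otimes>\<^sub>M SM b) (good_event b)"
    by (rule M.emeasure_pair_measure_alt[OF sets_good_event, symmetric])
  finally have "?c * measure BM ?A \<le> measure (BM \<Otimes>\<^sub>M SM b) (good_event b)"
    by (simp add: P.P.emeasure_eq_measure)
  moreover have "?c * (1 - \<epsilon> / 3) \<le> ?c * measure BM ?A" using prob_good c0 by (intro mult_left_mono)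
  moreover have "1 - \<epsilon> \<le> ?c * (1 - \<epsilon> / 3)"
  proof -
    have "?c * (1 - \<epsilon> / 3) = 1 - 7 / 9 * \<epsilon> + 4 / 27 * \<epsilon>\<^sup>2" by (simp add: power2_eq_square field_simps)
    then show ?thesis using eps by (simp add: add_increasing2)
  qed
  ultimately show ?thesis by linarith
qed

section \<open>Recovery on the good event\<close>

lemma sensing_eq_action: "sensing m n B z = measurement.action n (stacked_col m B) z"
  by (simp add: measurement.action_def[OF stacked_measurement] sensing_def stacked_col_def block_col_def
      fun_eq_iff sum_distrib_left mult.assoc)

lemma sensing_diff: "sensing m n B (\<lambda>i. z i - x i) = (\<lambda>k. sensing m n B z k - sensing m n B x k)"
  by (simp add: sensing_def fun_eq_iff sum_subtractf right_diff_distrib flip: diff_divide_distrib)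

lemma recovery_on_good_event:
  assumes \<omega>: "\<omega> \<in> good_event b" and a: "\<forall>i\<in>S. 0 < a i"
    and l1: "l1norm n z \<le> l1norm n (signal S a (snd \<omega>))"
    and e: "vnorm (rows m p) (\<lambda>q. sensing m n (fst \<omega>) z q - sensing m n (fst \<omega>) (signal S a (snd \<omega>)) q) \<le> e"
  shows "vnorm {..<n} (\<lambda>i. z i - signal S a (snd \<omega>) i) \<le> (3 / 2 + 45 * sqrt (real (card S))) * e"
proof -
  let ?x = "signal S a (snd \<omega>)"
  have g: "good (fst \<omega>)" and unit: "\<And>j. j \<in> S \<Longrightarrow> cmod (snd \<omega> j) = 1"
    and d: "\<And>i. i < n \<Longrightarrow> i \<notin> S \<Longrightarrow> cmod (S.ip (dual i (fst \<omega>)) (snd \<omega>)) \<le> 9 / 10"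
    using \<omega> by (auto simp: good_event_def)
  have "(15 / 100)\<^sup>2 / L \<le> 1" using L_gt_1 by (simp add: power2_eq_square)
  moreover have "S.nsq (Z i (fst \<omega>)) < (15 / 100)\<^sup>2 / L" if "i < n" "i \<notin> S" for i
    using g that unfolding good_def by blast
  ultimately have Z: "S.nsq (Z i (fst \<omega>)) \<le> 1" if "i < n" "i \<notin> S" for i
    using that by (meson less_le_trans less_imp_le)
  show ?thesis
  proof (rule measurement.dual_certificate_recovery[OF stacked_measurement, where \<sigma> = "snd \<omega>" and x = ?x and a = a])
    show "l1norm n (\<lambda>i. ?x i + (z i - ?x i)) \<le> l1norm n ?x" using l1 by simp
    show "vnorm (rows m p) (measurement.action n (stacked_col m (fst \<omega>)) (\<lambda>i. z i - ?x i)) \<le> e"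
      using e by (simp add: sensing_diff flip: sensing_eq_action)
  qed (use G_lower[OF g] Z d unit a in \<open>auto simp: dual_def\<close>)
qed

lemma in_Cn_signal: "in_Cn n (signal S a \<sigma>)"
  using basic(3) by (auto simp: in_Cn_def signal_def)

end

lemma vnorm_diff_le: "vnorm I (\<lambda>q. f q - g q) \<le> vnorm I f + vnorm I g"
proof -
  have "vnorm I (\<lambda>q. f q - g q) = L2_set (\<lambda>q. cmod (f q - g q)) I"
    by (simp add: vnorm_def L2_set_def)
  also have "\<dots> \<le> L2_set (\<lambda>q. cmod (f q) + cmod (g q)) I"
    by (intro L2_set_mono norm_triangle_ineq4) simp
  also have "\<dots> \<le> L2_set (\<lambda>q. cmod (f q)) I + L2_set (\<lambda>q. cmod (g q)) I" by (rule L2_set_triangle_ineq)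
  finally show ?thesis by (simp add: vnorm_def L2_set_def)
qed

lemma vnorm_minus_commute: "vnorm I (\<lambda>q. f q - g q) = vnorm I (\<lambda>q. g q - f q)"
  by (simp add: vnorm_def norm_minus_commute)

context sensing_setting
begin

text \<open>The signal is feasible, so a minimizer has no larger l1 norm, and the images of the two
  differ by at most \<open>2 * \<eta>\<close>; this doubles the constants 3/2 and 45. The event does
  not involve \<open>e\<close>, so the noise may depend on the outcome.\<close>

lemma noisy_recovery:
  assumes \<omega>: "\<omega> \<in> good_event b" and a: "\<forall>i\<in>S. 0 < a i" and e: "vnorm (rows m p) e \<le> \<eta>"
    and z: "qBP_minimizer n m p (fst \<omega>) (\<lambda>q. sensing m n (fst \<omega>) (signal S a (snd \<omega>)) q + e q) \<eta> z"
  shows "vnorm {..<n} (\<lambda>i. signal S a (snd \<omega>) i - z i) \<le> (3 + 90 * sqrt (real (card S))) * \<eta>"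
proof -
  let ?x = "signal S a (snd \<omega>)" and ?A = "sensing m n (fst \<omega>)"
  let ?y = "\<lambda>q. ?A ?x q + e q"
  have l1: "l1norm n z \<le> l1norm n ?x" and res: "vnorm (rows m p) (\<lambda>q. ?y q - ?A z q) \<le> \<eta>"
    using z e in_Cn_signal unfolding qBP_minimizer_def by auto
  have "vnorm (rows m p) (\<lambda>q. ?A z q - ?A ?x q) \<le> 2 * \<eta>"
  proof -
    have "vnorm (rows m p) (\<lambda>q. e q - (?y q - ?A z q)) \<le> vnorm (rows m p) e + vnorm (rows m p) (\<lambda>q. ?y q - ?A z q)"
      by (rule vnorm_diff_le)
    then show ?thesis using e res by simp
  qed
  then have "vnorm {..<n} (\<lambda>i. z i - ?x i) \<le> (3 / 2 + 45 * sqrt (real (card S))) * (2 * \<eta>)"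
    by (rule recovery_on_good_event[OF \<omega> a l1])
  then show ?thesis by (subst vnorm_minus_commute) (simp add: algebra_simps)
qed

text \<open>A competitor of no larger norm with the same image falls under the recovery bound with
  \<open>e = 0\<close>, so it agrees with the signal below \<open>n\<close>; from \<open>n\<close>
  on both vanish.\<close>

lemma exact_recovery:
  assumes \<omega>: "\<omega> \<in> good_event b" and a: "\<forall>i\<in>S. 0 < a i"
  shows "BP_unique_minimizer n m p (fst \<omega>) (sensing m n (fst \<omega>) (signal S a (snd \<omega>))) (signal S a (snd \<omega>))"
  unfolding BP_unique_minimizer_def
proof (intro conjI allI impI in_Cn_signal ballI refl)
  let ?x = "signal S a (snd \<omega>)" and ?A = "sensing m n (fst \<omega>)"
  fix z assume z: "in_Cn n z \<and> (\<forall>q\<in>rows m p. ?A z q = ?A ?x q) \<and> z \<noteq> ?x"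
  show "l1norm n ?x < l1norm n z"
  proof (rule ccontr)
    assume "\<not> ?thesis"
    then have "l1norm n z \<le> l1norm n ?x" by simp
    moreover have "vnorm (rows m p) (\<lambda>q. ?A z q - ?A ?x q) \<le> 0" using z by (simp add: vnorm_def)
    ultimately have "vnorm {..<n} (\<lambda>i. z i - ?x i) \<le> (3 / 2 + 45 * sqrt (real (card S))) * 0"
      by (rule recovery_on_good_event[OF \<omega> a])
    then have "(\<Sum>i<n. (cmod (z i - ?x i))\<^sup>2) \<le> 0" by (simp add: vnorm_def)
    then have "(\<Sum>i<n. (cmod (z i - ?x i))\<^sup>2) = 0" by (simp add: sum_nonneg order_antisym)
    then have "z i = ?x i" if "i < n" for i using that by (simp add: sum_nonneg_eq_0_iff)
    moreover have "z i = ?x i" if "\<not> i < n" for i using z in_Cn_signal[of a "snd \<omega>"] that by (simp add: in_Cn_def)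
    ultimately have "z = ?x" by blast
    then show False using z by simp
  qed
qed

end

theorem mainTheorem7:
  shows
  "(\<exists>c\<^sub>1 c\<^sub>2 C\<^sub>1 C\<^sub>2 :: real. c\<^sub>1 > 0 \<and> c\<^sub>2 > 0 \<and> C\<^sub>1 > 0 \<and> C\<^sub>2 > 0 \<and>
     (\<forall>n m p F S \<Lambda> \<Gamma> a real_case \<eta> \<epsilon>.
        setting n m p F S \<Lambda> \<Gamma> \<and> real (card S) \<le> real n / 2 \<and> (\<forall>i\<in>S. a i > 0) \<and>
        \<eta> \<ge> 0 \<and> 0 < \<epsilon> \<and> \<epsilon> < 1 \<and>
        \<Lambda> \<ge> c\<^sub>1 * \<Gamma> * ln (3 * real n / \<epsilon>) \<and>
        real m \<ge> c\<^sub>2 * \<Lambda> * ln (3 * real n / \<epsilon>)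
        \<longrightarrow> (\<exists>E\<in>sets (sample_space m F S real_case).
               measure (sample_space m F S real_case) E \<ge> 1 - \<epsilon> \<and>
               (\<forall>\<omega>\<in>E. \<forall>e. vnorm (rows m p) e \<le> \<eta> \<longrightarrow>
                  (\<forall>z. qBP_minimizer n m p (fst \<omega>)
                         (\<lambda>q. sensing m n (fst \<omega>) (signal S a (snd \<omega>)) q + e q) \<eta> z
                       \<longrightarrow> vnorm {..<n} (\<lambda>i. signal S a (snd \<omega>) i - z i)
                             \<le> (C\<^sub>1 + C\<^sub>2 * sqrt (real (card S))) * \<eta>)))))
   \<and>
   (\<forall>n m p F S \<Lambda> \<Gamma> a real_case \<epsilon>.
        setting n m p F S \<Lambda> \<Gamma> \<and> real (card S) \<le> real n / 2 \<and> (\<forall>i\<in>S. a i > 0) \<and>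
        0 < \<epsilon> \<and> \<epsilon> < 1 \<and>
        \<Lambda> \<ge> 50 * \<Gamma> * ln (3 * real n / \<epsilon>) \<and>
        real m \<ge> 100 * \<Lambda> * ln (3 * real n / \<epsilon>)
        \<longrightarrow> (\<exists>E\<in>sets (sample_space m F S real_case).
               measure (sample_space m F S real_case) E \<ge> 1 - \<epsilon> \<and>
               (\<forall>\<omega>\<in>E. BP_unique_minimizer n m p (fst \<omega>)
                         (sensing m n (fst \<omega>) (signal S a (snd \<omega>))) (signal S a (snd \<omega>)))))"
  (is "?noisy \<and> ?exact")
proof
  show ?noisy
  \<comment> \<open>The constants 50 and 100 of the noiseless case serve here too, because both
    claims hold on the same \<open>good_event\<close>.\<close>
  proof (rule exI[of _ 50], rule exI[of _ 100], rule exI[of _ 3], rule exI[of _ 90],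
      intro conjI allI impI)
    fix n m p F S \<Lambda> \<Gamma> and a :: "nat \<Rightarrow> real" and real_case \<eta> \<epsilon>
    assume H: "setting n m p F S \<Lambda> \<Gamma> \<and> real (card S) \<le> real n / 2 \<and> (\<forall>i\<in>S. a i > 0) \<and>
        (0::real) \<le> \<eta> \<and> 0 < \<epsilon> \<and> \<epsilon> < 1 \<and>
        \<Lambda> \<ge> 50 * \<Gamma> * ln (3 * real n / \<epsilon>) \<and> real m \<ge> 100 * \<Lambda> * ln (3 * real n / \<epsilon>)"
    then interpret sensing_setting n m p F S \<Lambda> \<Gamma> \<epsilon> by unfold_locales auto
    show "\<exists>E\<in>sets (sample_space m F S real_case).
               measure (sample_space m F S real_case) E \<ge> 1 - \<epsilon> \<and>
               (\<forall>\<omega>\<in>E. \<forall>e. vnorm (rows m p) e \<le> \<eta> \<longrightarrow>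
                  (\<forall>z. qBP_minimizer n m p (fst \<omega>)
                         (\<lambda>q. sensing m n (fst \<omega>) (signal S a (snd \<omega>)) q + e q) \<eta> z
                       \<longrightarrow> vnorm {..<n} (\<lambda>i. signal S a (snd \<omega>) i - z i)
                             \<le> (3 + 90 * sqrt (real (card S))) * \<eta>))"
      unfolding sample_space_def
      using sets_good_event prob_good_event noisy_recovery H
      by (intro bexI[of _ "good_event real_case"]) blast+
  qed simp_all
  show ?exact
  proof (intro allI impI)
    fix n m p F S \<Lambda> \<Gamma> and a :: "nat \<Rightarrow> real" and real_case \<epsilon>
    assume H: "setting n m p F S \<Lambda> \<Gamma> \<and> real (card S) \<le> real n / 2 \<and> (\<forall>i\<in>S. a i > 0) \<and>
        0 < \<epsilon> \<and> \<epsilon> < 1 \<and>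
        \<Lambda> \<ge> 50 * \<Gamma> * ln (3 * real n / \<epsilon>) \<and> real m \<ge> 100 * \<Lambda> * ln (3 * real n / \<epsilon>)"
    then interpret sensing_setting n m p F S \<Lambda> \<Gamma> \<epsilon> by unfold_locales auto
    show "\<exists>E\<in>sets (sample_space m F S real_case).
               measure (sample_space m F S real_case) E \<ge> 1 - \<epsilon> \<and>
               (\<forall>\<omega>\<in>E. BP_unique_minimizer n m p (fst \<omega>)
                         (sensing m n (fst \<omega>) (signal S a (snd \<omega>))) (signal S a (snd \<omega>)))"
      unfolding sample_space_def
      using sets_good_event prob_good_event exact_recovery H
      by (intro bexI[of _ "good_event real_case"]) blast+
  qed
qed

end
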